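(* Let $k$ be a field of characteristic $p>0$, let $\mathbf{A}=(\mathbf{A}^n)_{n\ge1}$ be an unentangled closed inductive system over $k$, let $n\in\mathbb{Z}_{>0}$ and let $M\in\mathbf{A}^n$ be indecomposable. Then the following conditions are equivalent: (1) $M$ is not a direct summand of $\mathrm{Ind}^{S_n}_{S_i\times S_j}(V\boxtimes W)$ for any $i,j\in\mathbb{Z}_{>0}$ with $i+j=n$, $V\in\mathbf{A}^i$ and $W\in\mathbf{A}^j$; (2) $M$ is not a direct summand of any $S_n$-representation induced from a proper Young subgroup of $S_n$; (3) the vertex of $M$ is a transitive subgroup of $S_n$ (acting on $\{1,\dots,n\}$). Moreover, a necessary condition for (1)-(3) to be satisfied is that $n=p^m$ for some $m\in\mathbb{Z}_{\ge0}$.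
   Context: $\mathrm{Rep}\,S_n$ is the category of finite-dimensional $k$-representations of the symmetric group $S_n$. A closed inductive system is an assignment, to each $n\in\mathbb{Z}_{>0}$, of a full subcategory $\mathbf{A}^n\subset\mathrm{Rep}\,S_n$ closed under isomorphisms, finite direct sums and direct summands, such that: $\mathrm{Res}^{S_n}_{S_{n-1}}$ sends $\mathbf{A}^n$ into $\mathbf{A}^{n-1}$; each $\mathbf{A}^n$ is a rigid monoidal subcategory (contains the trivial representation and is closed under tensor products and duals); and for all $m,n>0$ and $V\in\mathbf{A}^m$, $W\in\mathbf{A}^n$, the representation $\mathrm{Ind}^{S_{m+n}}_{S_m\times S_n}(V\boxtimes W)$ lies in $\mathbf{A}^{m+n}$. An $S_n$-representation is unentangled if, for every composition $\lambda=(\lambda_1,\dots,\lambda_l)$ of $n$, its restriction to the Young subgroup $S_\lambda=S_{\lambda_1}\times\cdots\times S_{\lambda_l}$ is a direct summand of a module $M_1\boxtimes\cdots\boxtimes M_l$ with $M_i\in\mathrm{Rep}\,S_{\lambda_i}$. The closed inductive system $\mathbf{A}$ is unentangled if every representation in every $\mathbf{A}^n$ is unentangled; then, for $i+j=n$, the restriction to $S_i\times S_j$ of a representation in $\mathbf{A}^n$ is a direct summand of a direct sum of modules $V\boxtimes W$ with $V\in\mathbf{A}^i$, $W\in\mathbf{A}^j$. A vertex of an indecomposable representation $V$ of a finite group $G$ is a minimal subgroup $H<G$ such that $V$ is a direct summand of a representation induced from $H$ to $G$; it is unique up to conjugation. *)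

theory Defs
  imports "HOL-Algebra.Sym_Groups" "Jordan_Normal_Form.Matrix"
begin

section \<open>Finite-dimensional representations\<close>

text \<open>
  Objects of Rep G are matrix representations: a dimension \<open>d\<close> and a homomorphism from \<open>G\<close> to
  the invertible \<open>d \<times> d\<close> matrices over \<open>'k\<close>. Every finite-dimensional representation is
  isomorphic to one of these, and the dimension 0 is allowed (zero object). The values of
  \<open>rep_mat M\<close> outside the carrier of the group are irrelevant, and isomorphism ignores them.
  A subgroup \<open>H\<close> of \<open>G\<close> is a set, and is turned into a group as \<open>G\<lparr>carrier := H\<rparr>\<close>.
\<close>

datatype ('g, 'k) rep = Rep (rep_dim: nat) (rep_mat: "'g \<Rightarrow> 'k mat")

definition representation :: "('g, 'b) monoid_scheme \<Rightarrow> ('g, 'k::field) rep \<Rightarrow> bool" where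
  "representation G M \<longleftrightarrow>
     (\<forall>g\<in>carrier G. rep_mat M g \<in> carrier_mat (rep_dim M) (rep_dim M)) \<and>
     rep_mat M \<one>\<^bsub>G\<^esub> = 1\<^sub>m (rep_dim M) \<and>
     (\<forall>g\<in>carrier G. \<forall>h\<in>carrier G. rep_mat M (g \<otimes>\<^bsub>G\<^esub> h) = rep_mat M g * rep_mat M h)"

definition rep_iso :: "('g, 'b) monoid_scheme \<Rightarrow> ('g, 'k::field) rep \<Rightarrow> ('g, 'k) rep \<Rightarrow> bool" where
  "rep_iso G M N \<longleftrightarrow> rep_dim M = rep_dim N \<and>
     (\<exists>P\<in>carrier_mat (rep_dim M) (rep_dim M). invertible_mat P \<and>
        (\<forall>g\<in>carrier G. P * rep_mat M g = rep_mat N g * P))"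

definition direct_sum :: "('g, 'k::field) rep \<Rightarrow> ('g, 'k) rep \<Rightarrow> ('g, 'k) rep" where
  "direct_sum M N = Rep (rep_dim M + rep_dim N)
     (\<lambda>g. four_block_mat (rep_mat M g) (0\<^sub>m (rep_dim M) (rep_dim N))
                          (0\<^sub>m (rep_dim N) (rep_dim M)) (rep_mat N g))"

definition direct_summand :: "('g, 'b) monoid_scheme \<Rightarrow> ('g, 'k::field) rep \<Rightarrow> ('g, 'k) rep \<Rightarrow> bool" where
  "direct_summand G M N \<longleftrightarrow> (\<exists>M'. representation G M' \<and> rep_iso G N (direct_sum M M'))"

definition indecomposable :: "('g, 'b) monoid_scheme \<Rightarrow> ('g, 'k::field) rep \<Rightarrow> bool" where
  "indecomposable G M \<longleftrightarrow> rep_dim M > 0 \<and>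
     (\<forall>U V. representation G U \<longrightarrow> representation G V \<longrightarrow> rep_iso G M (direct_sum U V) \<longrightarrow>
        rep_dim U = 0 \<or> rep_dim V = 0)"

definition trivial_rep :: "('g, 'k::field) rep" where
  "trivial_rep = Rep 1 (\<lambda>_. 1\<^sub>m 1)"

definition kronecker :: "'k::field mat \<Rightarrow> 'k mat \<Rightarrow> 'k mat" where
  "kronecker A B = mat (dim_row A * dim_row B) (dim_col A * dim_col B)
     (\<lambda>(i, j). A $$ (i div dim_row B, j div dim_col B) * B $$ (i mod dim_row B, j mod dim_col B))"

definition tensor_rep :: "('g, 'k::field) rep \<Rightarrow> ('g, 'k) rep \<Rightarrow> ('g, 'k) rep" where
  "tensor_rep M N = Rep (rep_dim M * rep_dim N) (\<lambda>g. kronecker (rep_mat M g) (rep_mat N g))"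

definition dual_rep :: "('g, 'b) monoid_scheme \<Rightarrow> ('g, 'k::field) rep \<Rightarrow> ('g, 'k) rep" where
  "dual_rep G M = Rep (rep_dim M) (\<lambda>g. transpose_mat (rep_mat M (inv\<^bsub>G\<^esub> g)))"

definition restrict_rep :: "'g set \<Rightarrow> ('g, 'k::field) rep \<Rightarrow> ('g, 'k) rep" where
  "restrict_rep H M = Rep (rep_dim M) (restrict (rep_mat M) H)"


section \<open>Induction and vertices\<close>

definition left_transversal :: "('g, 'b) monoid_scheme \<Rightarrow> 'g set \<Rightarrow> 'g list \<Rightarrow> bool" where
  "left_transversal G H rs \<longleftrightarrow> set rs \<subseteq> carrier G \<and>
     (\<forall>g\<in>carrier G. \<exists>!a. a < length rs \<and> g \<in> rs ! a <#\<^bsub>G\<^esub> H)"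

text \<open>
  If \<open>r\<^sub>0, r\<^sub>1, \<dots>\<close> represent the left cosets of \<open>H\<close>, the space of \<open>k[G] \<otimes>\<^bsub>k[H]\<^esub> M\<close> is the
  direct sum of the \<open>r\<^sub>b \<otimes> M\<close>, and \<open>g (r\<^sub>b \<otimes> v) = r\<^sub>a \<otimes> (r\<^sub>a\<inverse> g r\<^sub>b) v\<close> for the unique \<open>a\<close> such
  that \<open>r\<^sub>a\<inverse> g r\<^sub>b\<close> lies in \<open>H\<close>. Index \<open>i\<close> below belongs to block \<open>i div d\<close>.
\<close>

definition induced_rep_along ::
  "('g, 'b) monoid_scheme \<Rightarrow> 'g set \<Rightarrow> 'g list \<Rightarrow> ('g, 'k::field) rep \<Rightarrow> ('g, 'k) rep" where
  "induced_rep_along G H rs M = (let d = rep_dim M in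
     Rep (length rs * d) (\<lambda>g. mat (length rs * d) (length rs * d)
       (\<lambda>(i, j). let x = inv\<^bsub>G\<^esub> (rs ! (i div d)) \<otimes>\<^bsub>G\<^esub> g \<otimes>\<^bsub>G\<^esub> rs ! (j div d)
                 in if x \<in> H then rep_mat M x $$ (i mod d, j mod d) else 0)))"

text \<open>The choice of the transversal does not matter up to isomorphism.\<close>

definition induced_rep ::
  "('g, 'b) monoid_scheme \<Rightarrow> 'g set \<Rightarrow> ('g, 'k::field) rep \<Rightarrow> ('g, 'k) rep" where
  "induced_rep G H M = induced_rep_along G H (SOME rs. left_transversal G H rs) M"

definition summand_of_induced ::
  "('g, 'b) monoid_scheme \<Rightarrow> 'g set \<Rightarrow> ('g, 'k::field) rep \<Rightarrow> bool" where
  "summand_of_induced G H M \<longleftrightarrow>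
     (\<exists>N. representation (G\<lparr>carrier := H\<rparr>) N \<and> direct_summand G M (induced_rep G H N))"

definition is_vertex :: "('g, 'b) monoid_scheme \<Rightarrow> 'g set \<Rightarrow> ('g, 'k::field) rep \<Rightarrow> bool" where
  "is_vertex G H M \<longleftrightarrow> subgroup H G \<and> summand_of_induced G H M \<and>
     (\<forall>K. subgroup K G \<longrightarrow> K \<subset> H \<longrightarrow> \<not> summand_of_induced G K M)"

definition transitive_on :: "('x \<Rightarrow> 'x) set \<Rightarrow> 'x set \<Rightarrow> bool" where
  "transitive_on H X \<longleftrightarrow> (\<forall>x\<in>X. \<forall>y\<in>X. \<exists>\<sigma>\<in>H. \<sigma> x = y)"


section \<open>Young subgroups\<close>

definition composition :: "nat \<Rightarrow> nat list \<Rightarrow> bool" where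
  "composition n \<mu> \<longleftrightarrow> (\<forall>l\<in>set \<mu>. l > 0) \<and> sum_list \<mu> = n"

definition offset :: "nat list \<Rightarrow> nat \<Rightarrow> nat" where
  "offset \<mu> i = sum_list (take i \<mu>)"

definition block :: "nat list \<Rightarrow> nat \<Rightarrow> nat set" where
  "block \<mu> i = {offset \<mu> i + 1 .. offset \<mu> i + \<mu> ! i}"

definition young_subgroup :: "nat list \<Rightarrow> (nat \<Rightarrow> nat) set" where
  "young_subgroup \<mu> = {\<sigma>. \<sigma> permutes {1..sum_list \<mu>} \<and>
     (\<forall>i<length \<mu>. \<sigma> ` block \<mu> i = block \<mu> i)}"

abbreviation young_group :: "nat list \<Rightarrow> (nat \<Rightarrow> nat) monoid" where
  "young_group \<mu> \<equiv> (sym_group (sum_list \<mu>))\<lparr>carrier := young_subgroup \<mu>\<rparr>"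

text \<open>
  The \<open>i\<close>-th component of an element of the Young subgroup, that is, its action on the \<open>i\<close>-th
  block, transported to a permutation of \<open>{1..\<mu> ! i}\<close>.
\<close>

definition young_component :: "nat list \<Rightarrow> nat \<Rightarrow> (nat \<Rightarrow> nat) \<Rightarrow> nat \<Rightarrow> nat" where
  "young_component \<mu> i \<sigma> =
     (\<lambda>x. if x \<in> {1..\<mu> ! i} then \<sigma> (x + offset \<mu> i) - offset \<mu> i else x)"

text \<open>
  The external tensor product of \<open>Ms ! 0\<close>, \<open>Ms ! 1\<close>, \<open>\<dots>\<close>, where \<open>Ms ! i\<close> is a representation
  of the symmetric group on \<open>\<mu> ! i\<close> letters, as a representation of the Young subgroup.
\<close>

definition outer_tensor ::
  "nat list \<Rightarrow> (nat \<Rightarrow> nat, 'k::field) rep list \<Rightarrow> (nat \<Rightarrow> nat, 'k) rep" where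
  "outer_tensor \<mu> Ms = Rep (prod_list (map rep_dim Ms))
     (\<lambda>\<sigma>. foldr kronecker
        (map (\<lambda>i. rep_mat (Ms ! i) (young_component \<mu> i \<sigma>)) [0..<length \<mu>]) (1\<^sub>m 1))"


section \<open>Closed inductive systems\<close>

text \<open>
  A full subcategory is given by its class of objects. Only the values \<open>A n\<close> for positive \<open>n\<close>
  are relevant. The zero representation is in each \<open>A n\<close>, being a direct summand of the trivial
  one, so binary direct sums give all finite ones.
\<close>

locale closed_inductive_system =
  fixes A :: "nat \<Rightarrow> (nat \<Rightarrow> nat, 'k::field) rep set"
  assumes objects: "\<lbrakk>n > 0; M \<in> A n\<rbrakk> \<Longrightarrow> representation (sym_group n) M"
    and iso_closed:
      "\<lbrakk>n > 0; M \<in> A n; representation (sym_group n) N; rep_iso (sym_group n) M N\<rbrakk> \<Longrightarrow> N \<in> A n"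
    and sum_closed: "\<lbrakk>n > 0; M \<in> A n; N \<in> A n\<rbrakk> \<Longrightarrow> direct_sum M N \<in> A n"
    and summand_closed:
      "\<lbrakk>n > 0; M \<in> A n; representation (sym_group n) N; direct_summand (sym_group n) N M\<rbrakk>
        \<Longrightarrow> N \<in> A n"
    and res_closed:
      "\<lbrakk>n > 1; M \<in> A n\<rbrakk> \<Longrightarrow> restrict_rep (carrier (sym_group (n - 1))) M \<in> A (n - 1)"
    and trivial_closed: "n > 0 \<Longrightarrow> trivial_rep \<in> A n"
    and tensor_closed: "\<lbrakk>n > 0; M \<in> A n; N \<in> A n\<rbrakk> \<Longrightarrow> tensor_rep M N \<in> A n"
    and dual_closed: "\<lbrakk>n > 0; M \<in> A n\<rbrakk> \<Longrightarrow> dual_rep (sym_group n) M \<in> A n"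
    and ind_closed:
      "\<lbrakk>m > 0; n > 0; V \<in> A m; W \<in> A n\<rbrakk> \<Longrightarrow>
        induced_rep (sym_group (m + n)) (young_subgroup [m, n]) (outer_tensor [m, n] [V, W])
          \<in> A (m + n)"

definition unentangled_rep :: "nat \<Rightarrow> (nat \<Rightarrow> nat, 'k::field) rep \<Rightarrow> bool" where
  "unentangled_rep n M \<longleftrightarrow> (\<forall>\<mu>. composition n \<mu> \<longrightarrow>
     (\<exists>Ms. length Ms = length \<mu> \<and>
        (\<forall>i<length \<mu>. representation (sym_group (\<mu> ! i)) (Ms ! i)) \<and>
        direct_summand (young_group \<mu>) (restrict_rep (young_subgroup \<mu>) M)
          (outer_tensor \<mu> Ms)))"

locale unentangled_closed_inductive_system = closed_inductive_system A
  for A :: "nat \<Rightarrow> (nat \<Rightarrow> nat, 'k::field) rep set" +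
  assumes unentangled: "\<lbrakk>n > 0; M \<in> A n\<rbrakk> \<Longrightarrow> unentangled_rep n M"

end

theory Submission
  imports Defs "Jordan_Normal_Form.Determinant" "HOL-Algebra.Exponent"
begin

text \<open>
  By Higman's criterion, \<open>M\<close> is a summand of a representation induced from \<open>H\<close> if and only if
  the identity of \<open>M\<close> is a relative trace of an \<open>H\<close>-endomorphism. In this form it is clear that
  the property passes to larger subgroups and to conjugates. An intransitive subgroup lies in a
  conjugate of some \<open>S\<^sub>i \<times> S\<^sub>j\<close> with \<open>i, j > 0\<close>, hence (2) and (3) both say that \<open>M\<close> is not
  projective relative to any such \<open>S\<^sub>i \<times> S\<^sub>j\<close>. If \<open>n\<close> is not a power of \<open>p\<close>, some
  \<open>S\<^sub>i \<times> S\<^sub>j\<close> has index prime to \<open>p\<close>, and every \<open>M\<close> is projective relative to it. For (1) it remains to replace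
  the restriction of \<open>M\<close> to \<open>S\<^sub>i \<times> S\<^sub>j\<close>, a summand of some \<open>V\<^sub>0 \<boxtimes> W\<^sub>0\<close>, by a \<open>V \<boxtimes> W\<close> with
  \<open>V\<close> and \<open>W\<close> in the system; direct sums of copies of the restrictions of \<open>M\<close> to \<open>S\<^sub>i\<close> and \<open>S\<^sub>j\<close> work.
\<close>

text \<open>The obstacle is in the step for (1): unentangledness supplies arbitrary
  \<open>V0\<close> and \<open>W0\<close>, and a summand of \<open>V0 \<boxtimes> W0\<close> need
  not be an external tensor product of summands, so closure of the system under summands says
  nothing about the factors. What helps is that fixing a basis vector of one factor commutes with
  the group acting on the other. Cutting the inclusion and the projection of \<open>M\<close> in
  this way yields many maps between \<open>V0\<close> and the restriction of \<open>M\<close> to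
  \<open>S_i\<close>, and likewise for \<open>W0\<close> and \<open>S_j\<close>. The idempotent that
  cuts \<open>M\<close> out of \<open>V0 \<boxtimes> W0\<close> must then be expressed by products
  of such maps alone. This is possible because over a field every matrix \<open>R\<close> satisfies
  \<open>R = R C R\<close> for some \<open>C\<close>, which expresses its entries through its own
  columns and rows. The resulting sum of endomorphisms, each factoring through the two restrictions,
  becomes one factorization since \<open>A i\<close> is closed under direct sums.\<close>

section \<open>Matrices\<close>

text \<open>Matrices over a field are von Neumann regular: in matrix form the claim is
  \<open>R = R C R\<close>. The index sets are arbitrary finite sets because the application indexes
  rows and columns by pairs. Rows are added one at a time, each costing at most a rank one
  correction of \<open>C\<close>.\<close>

lemma generalized_inverse:
  fixes R :: "'i \<Rightarrow> 'j \<Rightarrow> 'k::field"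
  assumes "finite I" "finite J"
  shows "\<exists>C. \<forall>i\<in>I. \<forall>j\<in>J. R i j = (\<Sum>(a, b)\<in>J \<times> I. C a b * R i a * R b j)"
  using assms(1)
proof (induction I)
  case empty
  show ?case by simp
next
  case (insert r I)
  then obtain C where C: "\<And>i j. i \<in> I \<Longrightarrow> j \<in> J \<Longrightarrow> R i j = (\<Sum>(a, b)\<in>J \<times> I. C a b * R i a * R b j)"
    by blast
  \<comment> \<open>\<open>\<rho>\<close> is the error of the old \<open>C\<close> on the new row;
    \<open>C0\<close> is \<open>C\<close> padded by zeros at the new index \<open>r\<close>.\<close>
  define \<rho> where "\<rho> j = R r j - (\<Sum>(a, b)\<in>J \<times> I. C a b * R r a * R b j)" for j
  define C0 where "C0 a b = (if b \<in> I then C a b else 0)" for a b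
  have expand: "(\<Sum>(a, b)\<in>J \<times> insert r I. D a b * R i a * R b j)
      = (\<Sum>a\<in>J. D a r * R i a) * R r j + (\<Sum>(a, b)\<in>J \<times> I. D a b * R i a * R b j)" for D :: "'j \<Rightarrow> 'i \<Rightarrow> 'k" and i j
    using insert.hyps
    by (simp add: sum.cartesian_product[symmetric] sum.distrib sum_distrib_right)
  have expand0: "(\<Sum>(a, b)\<in>J \<times> insert r I. C0 a b * R i a * R b j) = (\<Sum>(a, b)\<in>J \<times> I. C a b * R i a * R b j)" for i j
    unfolding expand using insert.hyps by (auto simp: C0_def intro!: sum.cong)
  show ?case
  proof (cases "\<forall>j\<in>J. \<rho> j = 0")
    case True
    have "R i j = (\<Sum>(a, b)\<in>J \<times> insert r I. C0 a b * R i a * R b j)" if "i \<in> insert r I" "j \<in> J" for i j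
      unfolding expand0 using that C True by (auto simp: \<rho>_def)
    then show ?thesis by blast
  next
    case False
    then obtain s where s: "s \<in> J" "\<rho> s \<noteq> 0" by blast
    \<comment> \<open>The column \<open>f\<close> is built so that \<open>R f\<close> is 0 on the
      old rows and \<open>\<rho> s\<close> on row \<open>r\<close>; the row \<open>l\<close> is
      built so that \<open>l R = \<rho> / \<rho> s\<close>. Adding the product \<open>f l\<close> to
      \<open>C0\<close> therefore repairs row \<open>r\<close> and leaves the other rows
      alone.\<close>
    define f where "f a = (if a = s then 1 else 0) - (\<Sum>b\<in>I. C a b * R b s)" for a
    define l where "l b = ((if b = r then 1 else 0) - (\<Sum>a\<in>J. R r a * C0 a b)) / \<rho> s" for b
    have Rf: "(\<Sum>a\<in>J. R i a * f a) = R i s - (\<Sum>(a, b)\<in>J \<times> I. C a b * R i a * R b s)" for i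
    proof -
      have "(\<Sum>a\<in>J. R i a * f a) = (\<Sum>a\<in>J. if a = s then R i a else 0) - (\<Sum>a\<in>J. R i a * (\<Sum>b\<in>I. C a b * R b s))"
        unfolding sum_subtractf[symmetric] by (intro sum.cong) (auto simp: f_def right_diff_distrib)
      also have "(\<Sum>a\<in>J. R i a * (\<Sum>b\<in>I. C a b * R b s)) = (\<Sum>(a, b)\<in>J \<times> I. C a b * R i a * R b s)"
        by (simp add: sum.cartesian_product[symmetric] sum_distrib_left mult_ac)
      finally show ?thesis using s(1) assms(2) by simp
    qed
    have lR: "(\<Sum>b\<in>insert r I. l b * R b j) = \<rho> j / \<rho> s" for j
    proof -
      have "(\<Sum>b\<in>insert r I. l b * R b j) = (R r j - (\<Sum>b\<in>insert r I. \<Sum>a\<in>J. C0 a b * R r a * R b j)) / \<rho> s"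
      proof -
        have "(\<Sum>b\<in>insert r I. l b * R b j)
            = (\<Sum>b\<in>insert r I. (if b = r then R b j else 0) - (\<Sum>a\<in>J. C0 a b * R r a * R b j)) / \<rho> s"
          unfolding sum_divide_distrib
          by (intro sum.cong) (auto simp: l_def algebra_simps sum_distrib_right sum_distrib_left)
        then show ?thesis using insert.hyps by (simp add: sum_subtractf)
      qed
      also have "(\<Sum>b\<in>insert r I. \<Sum>a\<in>J. C0 a b * R r a * R b j) = (\<Sum>(a, b)\<in>J \<times> I. C a b * R r a * R b j)"
        unfolding expand0[symmetric] by (subst sum.swap) (simp add: sum.cartesian_product)
      finally show ?thesis by (simp add: \<rho>_def)
    qed
    define D where "D a b = C0 a b + f a * l b" for a b
    have D: "(\<Sum>(a, b)\<in>J \<times> insert r I. D a b * R i a * R b j)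
        = (\<Sum>(a, b)\<in>J \<times> I. C a b * R i a * R b j) + (\<Sum>a\<in>J. R i a * f a) * (\<Sum>b\<in>insert r I. l b * R b j)" for i j
      unfolding expand0[symmetric] sum_product
      by (simp only: D_def distrib_right sum.distrib sum.cartesian_product[symmetric]) (simp add: mult_ac)
    have "R i j = (\<Sum>(a, b)\<in>J \<times> insert r I. D a b * R i a * R b j)" if "i \<in> insert r I" "j \<in> J" for i j
    proof (cases "i = r")
      case True
      then show ?thesis
        unfolding D lR Rf using s(2) by (simp add: \<rho>_def[symmetric]) (simp add: \<rho>_def)
    next
      case False
      then have "i \<in> I" using that by simp
      then show ?thesis
        unfolding D Rf using C[of i s] C[of i j] s(1) that by simp
    qed
    then show ?thesis by blast
  qed
qed

text \<open>Entrywise and with explicit size, so that an empty combination is the zero matrix of the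
  right size.\<close>

definition lincomb_mat :: "nat \<Rightarrow> nat \<Rightarrow> 'x set \<Rightarrow> ('x \<Rightarrow> 'k::field) \<Rightarrow> ('x \<Rightarrow> 'k mat) \<Rightarrow> 'k mat" where
  "lincomb_mat d e S u F = mat d e (\<lambda>ij. \<Sum>x\<in>S. u x * F x $$ ij)"

lemma lincomb_mat_carrier [simp]: "lincomb_mat d e S u F \<in> carrier_mat d e"
  and lincomb_mat_dim [simp]: "dim_row (lincomb_mat d e S u F) = d" "dim_col (lincomb_mat d e S u F) = e"
  by (simp_all add: lincomb_mat_def)

lemma lincomb_mat_index [simp]:
  "i < d \<Longrightarrow> j < e \<Longrightarrow> lincomb_mat d e S u F $$ (i, j) = (\<Sum>x\<in>S. u x * F x $$ (i, j))"
  by (simp add: lincomb_mat_def)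

declare index_mult_mat(1) [simp del]

lemma index_mult_mat_sum:
  "i < dim_row A \<Longrightarrow> j < dim_col B \<Longrightarrow> dim_col A = dim_row B \<Longrightarrow>
    (A * B) $$ (i, j) = (\<Sum>k<dim_row B. A $$ (i, k) * B $$ (k, j))"
  by (simp add: index_mult_mat(1) scalar_prod_def atLeast0LessThan)

lemma lincomb_mat_cong:
  "(\<And>x. x \<in> S \<Longrightarrow> u x = v x \<and> F x = F' x) \<Longrightarrow> lincomb_mat d e S u F = lincomb_mat d e S v F'"
  by (auto simp: lincomb_mat_def intro!: cong_mat sum.cong)

lemma mult_lincomb_mat:
  assumes "A \<in> carrier_mat c d" "\<And>x. x \<in> S \<Longrightarrow> F x \<in> carrier_mat d e"
  shows "A * lincomb_mat d e S u F = lincomb_mat c e S u (\<lambda>x. A * F x)"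
proof (rule eq_matI)
  fix i j assume ij: "i < dim_row (lincomb_mat c e S u (\<lambda>x. A * F x))" "j < dim_col (lincomb_mat c e S u (\<lambda>x. A * F x))"
  have "(A * lincomb_mat d e S u F) $$ (i, j) = (\<Sum>k<d. A $$ (i, k) * (\<Sum>x\<in>S. u x * F x $$ (k, j)))"
    using ij assms by (simp add: index_mult_mat_sum)
  also have "\<dots> = (\<Sum>x\<in>S. u x * (\<Sum>k<d. A $$ (i, k) * F x $$ (k, j)))"
    by (simp add: sum_distrib_left mult_ac) (rule sum.swap)
  also have "\<dots> = (\<Sum>x\<in>S. u x * (A * F x) $$ (i, j))"
  proof (rule sum.cong)
    fix x assume "x \<in> S"
    then have "F x \<in> carrier_mat d e" by (rule assms)
    then show "u x * (\<Sum>k<d. A $$ (i, k) * F x $$ (k, j)) = u x * (A * F x) $$ (i, j)"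
      using ij assms(1) by (simp add: index_mult_mat_sum)
  qed simp
  finally show "(A * lincomb_mat d e S u F) $$ (i, j) = lincomb_mat c e S u (\<lambda>x. A * F x) $$ (i, j)"
    using ij by simp
qed (use assms in auto)

lemma lincomb_mat_mult:
  assumes "B \<in> carrier_mat e c" "\<And>x. x \<in> S \<Longrightarrow> F x \<in> carrier_mat d e"
  shows "lincomb_mat d e S u F * B = lincomb_mat d c S u (\<lambda>x. F x * B)"
proof (rule eq_matI)
  fix i j assume ij: "i < dim_row (lincomb_mat d c S u (\<lambda>x. F x * B))" "j < dim_col (lincomb_mat d c S u (\<lambda>x. F x * B))"
  have "(lincomb_mat d e S u F * B) $$ (i, j) = (\<Sum>k<e. (\<Sum>x\<in>S. u x * F x $$ (i, k)) * B $$ (k, j))"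
    using ij assms by (simp add: index_mult_mat_sum)
  also have "\<dots> = (\<Sum>x\<in>S. u x * (\<Sum>k<e. F x $$ (i, k) * B $$ (k, j)))"
    by (simp add: sum_distrib_left sum_distrib_right mult_ac) (rule sum.swap)
  also have "\<dots> = (\<Sum>x\<in>S. u x * (F x * B) $$ (i, j))"
  proof (rule sum.cong)
    fix x assume "x \<in> S"
    then have "F x \<in> carrier_mat d e" by (rule assms)
    then show "u x * (\<Sum>k<e. F x $$ (i, k) * B $$ (k, j)) = u x * (F x * B) $$ (i, j)"
      using ij assms(1) by (simp add: index_mult_mat_sum)
  qed simp
  finally show "(lincomb_mat d e S u F * B) $$ (i, j) = lincomb_mat d c S u (\<lambda>x. F x * B) $$ (i, j)"
    using ij by simp
qed (use assms in auto)

lemma mult_lincomb_mat_mult: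
  assumes "A \<in> carrier_mat c d" "B \<in> carrier_mat e f" "\<And>x. x \<in> S \<Longrightarrow> F x \<in> carrier_mat d e"
  shows "A * lincomb_mat d e S u F * B = lincomb_mat c f S u (\<lambda>x. A * F x * B)"
  using assms by (simp add: mult_lincomb_mat lincomb_mat_mult)

text \<open>Padding with zeros makes both factors square without changing the product. A right
  inverse of a square matrix is also a left inverse, yet column \<open>D\<close> of the padded
  \<open>A\<close> is zero.\<close>

lemma right_inverse_dim_le:
  fixes A :: "'k::field mat"
  assumes A: "A \<in> carrier_mat d D" and B: "B \<in> carrier_mat D d" and AB: "A * B = 1\<^sub>m d"
  shows "d \<le> D"
proof (rule ccontr)
  assume "\<not> d \<le> D"
  then have less: "D < d" by simp
  define A' where "A' = mat d d (\<lambda>(i, j). if j < D then A $$ (i, j) else 0)"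
  define B' where "B' = mat d d (\<lambda>(i, j). if i < D then B $$ (i, j) else 0)"
  have c: "A' \<in> carrier_mat d d" "B' \<in> carrier_mat d d" by (auto simp: A'_def B'_def)
  have "A' * B' = A * B"
  proof (rule eq_matI)
    fix i j assume ij: "i < dim_row (A * B)" "j < dim_col (A * B)"
    then have "(A' * B') $$ (i, j) = (\<Sum>k<d. A' $$ (i, k) * B' $$ (k, j))"
      using A B c by (simp add: index_mult_mat_sum)
    also have "\<dots> = (\<Sum>k<D. A $$ (i, k) * B $$ (k, j))"
      using ij A B less by (intro sum.mono_neutral_cong_right) (auto simp: A'_def B'_def)
    finally show "(A' * B') $$ (i, j) = (A * B) $$ (i, j)"
      using ij A B by (simp add: index_mult_mat_sum)
  qed (use A B c in auto)
  then have "B' * A' = 1\<^sub>m d"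
    using mat_mult_left_right_inverse[OF c] AB by simp
  moreover have "(B' * A') $$ (D, D) = 0"
    using less c by (simp add: index_mult_mat_sum A'_def)
  ultimately show False using less by simp
qed

text \<open>This is what later splits off a complement. With \<open>E = 1 - B A\<close> the
  complementary idempotent, each step of the induction on \<open>D - d\<close> appends a row of
  \<open>E\<close> to \<open>A\<close> and a column of \<open>E\<close> to \<open>B\<close>.\<close>

lemma complete_right_inverse:
  fixes A :: "'k::field mat"
  assumes "A \<in> carrier_mat d D" "B \<in> carrier_mat D d" "A * B = 1\<^sub>m d"
  shows "\<exists>P Q. P \<in> carrier_mat D D \<and> Q \<in> carrier_mat D D \<and> P * Q = 1\<^sub>m D \<and>
    (\<forall>i<d. \<forall>j<D. P $$ (i, j) = A $$ (i, j)) \<and> (\<forall>i<D. \<forall>j<d. Q $$ (i, j) = B $$ (i, j))"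
  using assms
proof (induction "D - d" arbitrary: d A B)
  case 0
  then have "d = D" using right_inverse_dim_le[OF 0(2-4)] by simp
  then show ?case using 0 by (intro exI[of _ A] exI[of _ B]) auto
next
  case (Suc m)
  have A: "A \<in> carrier_mat d D" and B: "B \<in> carrier_mat D d" and AB: "A * B = 1\<^sub>m d" by fact+
  define E where "E = 1\<^sub>m D - B * A"
  have E: "E \<in> carrier_mat D D" using A B by (auto simp: E_def)
  have AE: "A * E = 0\<^sub>m d D"
  proof -
    have "A * E = A * 1\<^sub>m D - A * (B * A)"
      unfolding E_def using A B by (intro mult_minus_distrib_mat) auto
    also have "A * (B * A) = A" using A B AB by (simp add: assoc_mult_mat[symmetric, of _ d D _ d _ D])
    finally show ?thesis using A by simp
  qed
  have EB: "E * B = 0\<^sub>m D d"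
  proof -
    have "E * B = 1\<^sub>m D * B - B * A * B"
      unfolding E_def using A B by (intro minus_mult_distrib_mat) auto
    also have "B * A * B = B" using A B AB by (simp add: assoc_mult_mat[of _ D d _ D _ d])
    finally show ?thesis using B by simp
  qed
  have EE: "E * E = E"
  proof -
    have "E * E = E * 1\<^sub>m D - E * (B * A)"
      using A B E by (subst (2) E_def) (intro mult_minus_distrib_mat, auto)
    also have "E * (B * A) = 0\<^sub>m D D" using A B E EB by (simp add: assoc_mult_mat[symmetric, of _ D D _ d _ D])
    finally show ?thesis using E by auto
  qed
  have "\<not> B * A = 1\<^sub>m D"
    using right_inverse_dim_le[OF B A] Suc(2) by auto
  have "\<exists>r<D. \<exists>s<D. E $$ (r, s) \<noteq> 0"
  proof (rule ccontr)
    assume *: "\<not> (\<exists>r<D. \<exists>s<D. E $$ (r, s) \<noteq> 0)"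
    have "B * A = 1\<^sub>m D"
    proof (rule eq_matI)
      fix i j assume "i < dim_row (1\<^sub>m D)" "j < dim_col (1\<^sub>m D)"
      then have ij: "i < D" "j < D" by auto
      then have "E $$ (i, j) = (1\<^sub>m D) $$ (i, j) - (B * A) $$ (i, j)"
        using A B by (simp add: E_def)
      then show "(B * A) $$ (i, j) = 1\<^sub>m D $$ (i, j)" using * ij by (simp)
    qed (use A B in auto)
    then show False using \<open>\<not> B * A = 1\<^sub>m D\<close> by blast
  qed
  then obtain r s where rs: "r < D" "s < D" "E $$ (r, s) \<noteq> 0" by blast
  \<comment> \<open>New row times new column is an entry of \<open>E E = E\<close>, normalised by
    the nonzero entry at \<open>(r, s)\<close>; the mixed products vanish by \<open>A E = 0\<close>
    and \<open>E B = 0\<close>.\<close>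
  define A1 where "A1 = mat (Suc d) D (\<lambda>(i, j). if i < d then A $$ (i, j) else E $$ (r, j) / E $$ (r, s))"
  define B1 where "B1 = mat D (Suc d) (\<lambda>(i, j). if j < d then B $$ (i, j) else E $$ (i, s))"
  have c: "A1 \<in> carrier_mat (Suc d) D" "B1 \<in> carrier_mat D (Suc d)" by (auto simp: A1_def B1_def)
  have sums: "(\<Sum>k<D. X $$ (i, k) * Y $$ (k, j)) = (X * Y) $$ (i, j)"
    if "X \<in> carrier_mat a D" "Y \<in> carrier_mat D b" "i < a" "j < b" for X Y :: "'k mat" and a b i j
    using that by (simp add: index_mult_mat_sum)
  have "A1 * B1 = 1\<^sub>m (Suc d)"
  proof (rule eq_matI)
    fix i j assume "i < dim_row (1\<^sub>m (Suc d) :: 'k mat)" "j < dim_col (1\<^sub>m (Suc d) :: 'k mat)"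
    then have ij: "i < Suc d" "j < Suc d" by auto
    have eq: "(A1 * B1) $$ (i, j) = (\<Sum>k<D. A1 $$ (i, k) * B1 $$ (k, j))"
      using ij c by (simp add: index_mult_mat_sum)
    consider "i < d" "j < d" | "i < d" "j = d" | "i = d" "j < d" | "i = d" "j = d" using ij by linarith
    then show "(A1 * B1) $$ (i, j) = 1\<^sub>m (Suc d) $$ (i, j)"
    proof cases
      case 1
      have "(A1 * B1) $$ (i, j) = (\<Sum>k<D. A $$ (i, k) * B $$ (k, j))"
        unfolding eq using 1 ij by (intro sum.cong) (auto simp: A1_def B1_def)
      then show ?thesis using sums[OF A B 1] AB 1 ij by simp
    next
      case 2
      have "(A1 * B1) $$ (i, j) = (\<Sum>k<D. A $$ (i, k) * E $$ (k, s))"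
        unfolding eq using 2 ij by (intro sum.cong) (auto simp: A1_def B1_def)
      then show ?thesis using sums[OF A E 2(1) rs(2)] AE 2 ij rs by simp
    next
      case 3
      have "(A1 * B1) $$ (i, j) = (\<Sum>k<D. E $$ (r, k) * B $$ (k, j)) / E $$ (r, s)"
        unfolding eq sum_divide_distrib using 3 ij by (intro sum.cong) (auto simp: A1_def B1_def)
      then show ?thesis using sums[OF E B rs(1) 3(2)] EB 3 ij rs by simp
    next
      case 4
      have "(A1 * B1) $$ (i, j) = (\<Sum>k<D. E $$ (r, k) * E $$ (k, s)) / E $$ (r, s)"
        unfolding eq sum_divide_distrib using 4 ij by (intro sum.cong) (auto simp: A1_def B1_def)
      then show ?thesis using sums[OF E E rs(1,2)] EE 4 ij rs by simp
    qed
  qed (use c in auto)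
  moreover have "m = D - Suc d" using Suc(2) by simp
  ultimately obtain P Q where PQ: "P \<in> carrier_mat D D" "Q \<in> carrier_mat D D" "P * Q = 1\<^sub>m D"
    and P: "\<forall>i<Suc d. \<forall>j<D. P $$ (i, j) = A1 $$ (i, j)" and Q: "\<forall>i<D. \<forall>j<Suc d. Q $$ (i, j) = B1 $$ (i, j)"
    using Suc(1)[of "Suc d" A1 B1] c by blast
  have "\<forall>i<d. \<forall>j<D. P $$ (i, j) = A $$ (i, j)" using P by (auto simp: A1_def)
  moreover have "\<forall>i<D. \<forall>j<d. Q $$ (i, j) = B $$ (i, j)" using Q by (auto simp: B1_def)
  ultimately show ?case using PQ by blast
qed

section \<open>Direct summands as retracts\<close>

text \<open>The acting elements form a bare set, so that the same \<open>M\<close> serves for every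
  subgroup without passing to \<open>restrict_rep\<close>.\<close>

definition intertwiner :: "'g set \<Rightarrow> ('g, 'k::field) rep \<Rightarrow> ('g, 'k) rep \<Rightarrow> 'k mat \<Rightarrow> bool" where
  "intertwiner H M N T \<longleftrightarrow> T \<in> carrier_mat (rep_dim N) (rep_dim M) \<and>
     (\<forall>h\<in>H. T * rep_mat M h = rep_mat N h * T)"

text \<open>Splitting data in place of a complement: this form can be multiplied with other
  intertwiners.\<close>

definition retract_of :: "'g set \<Rightarrow> ('g, 'k::field) rep \<Rightarrow> ('g, 'k) rep \<Rightarrow> bool" where
  "retract_of H M N \<longleftrightarrow>
     (\<exists>A B. intertwiner H N M A \<and> intertwiner H M N B \<and> A * B = 1\<^sub>m (rep_dim M))"

lemma intertwiner_carrier: "intertwiner H M N T \<Longrightarrow> T \<in> carrier_mat (rep_dim N) (rep_dim M)"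
  by (simp add: intertwiner_def)

lemma intertwiner_comm: "intertwiner H M N T \<Longrightarrow> h \<in> H \<Longrightarrow> T * rep_mat M h = rep_mat N h * T"
  by (simp add: intertwiner_def)

lemma representation_carrier:
  "representation G M \<Longrightarrow> g \<in> carrier G \<Longrightarrow> rep_mat M g \<in> carrier_mat (rep_dim M) (rep_dim M)"
  by (simp add: representation_def)

lemma representation_one: "representation G M \<Longrightarrow> rep_mat M \<one>\<^bsub>G\<^esub> = 1\<^sub>m (rep_dim M)"
  by (simp add: representation_def)

lemma representation_mult:
  "representation G M \<Longrightarrow> g \<in> carrier G \<Longrightarrow> h \<in> carrier G \<Longrightarrow>
    rep_mat M (g \<otimes>\<^bsub>G\<^esub> h) = rep_mat M g * rep_mat M h"
  by (simp add: representation_def)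

lemma representation_subgroup:
  "representation G M \<Longrightarrow> H \<subseteq> carrier G \<Longrightarrow> representation (G\<lparr>carrier := H\<rparr>) M"
  by (auto simp: representation_def)

lemma representation_restrict:
  assumes "representation G M" "subgroup H G"
  shows "representation (G\<lparr>carrier := H\<rparr>) (restrict_rep H M)"
  using assms subgroup.subset[OF assms(2)] subgroup.one_closed[OF assms(2)] subgroup.m_closed[OF assms(2)]
  by (auto simp: representation_def restrict_rep_def subset_iff)

lemma intertwiner_compose:
  assumes "intertwiner H M N S" "intertwiner H N L T"
    "\<And>h. h \<in> H \<Longrightarrow> rep_mat M h \<in> carrier_mat (rep_dim M) (rep_dim M)"
    "\<And>h. h \<in> H \<Longrightarrow> rep_mat N h \<in> carrier_mat (rep_dim N) (rep_dim N)"
    "\<And>h. h \<in> H \<Longrightarrow> rep_mat L h \<in> carrier_mat (rep_dim L) (rep_dim L)"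
  shows "intertwiner H M L (T * S)"
  unfolding intertwiner_def
proof (intro conjI ballI)
  have c: "S \<in> carrier_mat (rep_dim N) (rep_dim M)" "T \<in> carrier_mat (rep_dim L) (rep_dim N)"
    using assms(1,2) by (auto simp: intertwiner_def)
  show "T * S \<in> carrier_mat (rep_dim L) (rep_dim M)" using c by simp
  fix h assume h: "h \<in> H"
  have "T * S * rep_mat M h = T * (S * rep_mat M h)"
    using c assms(3)[OF h] by (simp add: assoc_mult_mat)
  also have "\<dots> = T * rep_mat N h * S"
    using c assms(4)[OF h] by (simp add: intertwiner_comm[OF assms(1) h] assoc_mult_mat)
  also have "\<dots> = rep_mat L h * T * S"
    by (simp add: intertwiner_comm[OF assms(2) h])
  also have "\<dots> = rep_mat L h * (T * S)"
    using c assms(5)[OF h] by (simp add: assoc_mult_mat)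
  finally show "T * S * rep_mat M h = rep_mat L h * (T * S)" .
qed

definition first_rows :: "nat \<Rightarrow> 'k::field mat \<Rightarrow> 'k mat" where
  "first_rows d X = mat d (dim_col X) (\<lambda>ij. X $$ ij)"

definition first_cols :: "nat \<Rightarrow> 'k::field mat \<Rightarrow> 'k mat" where
  "first_cols d X = mat (dim_row X) d (\<lambda>ij. X $$ ij)"

lemma first_rows_carrier [simp]: "X \<in> carrier_mat m n \<Longrightarrow> first_rows d X \<in> carrier_mat d n"
  by (simp add: first_rows_def)

lemma first_cols_carrier [simp]: "X \<in> carrier_mat m n \<Longrightarrow> first_cols d X \<in> carrier_mat m d"
  by (simp add: first_cols_def)

lemma first_rows_mult:
  assumes "X \<in> carrier_mat m n" "Y \<in> carrier_mat n l" "d \<le> m"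
  shows "first_rows d (X * Y) = first_rows d X * Y"
  by (rule eq_matI) (use assms in \<open>auto simp: first_rows_def index_mult_mat_sum\<close>)

lemma first_cols_mult:
  assumes "X \<in> carrier_mat m n" "Y \<in> carrier_mat n l" "d \<le> l"
  shows "first_cols d (X * Y) = X * first_cols d Y"
  by (rule eq_matI) (use assms in \<open>auto simp: first_cols_def index_mult_mat_sum\<close>)

lemma first_rows_block_diag_mult:
  assumes "X \<in> carrier_mat d d" "Y \<in> carrier_mat e e" "P \<in> carrier_mat (d + e) n"
  shows "first_rows d (four_block_mat X (0\<^sub>m d e) (0\<^sub>m e d) Y * P) = X * first_rows d P"
proof (rule eq_matI)
  fix i j assume "i < dim_row (X * first_rows d P)" "j < dim_col (X * first_rows d P)"
  then have ij: "i < d" "j < n" using assms by (auto simp: first_rows_def)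
  have "(four_block_mat X (0\<^sub>m d e) (0\<^sub>m e d) Y * P) $$ (i, j)
      = (\<Sum>k<d + e. four_block_mat X (0\<^sub>m d e) (0\<^sub>m e d) Y $$ (i, k) * P $$ (k, j))"
    using assms ij by (simp add: index_mult_mat_sum)
  also have "\<dots> = (\<Sum>k<d. X $$ (i, k) * P $$ (k, j))"
    using ij assms by (intro sum.mono_neutral_cong_right) auto
  finally show "first_rows d (four_block_mat X (0\<^sub>m d e) (0\<^sub>m e d) Y * P) $$ (i, j) = (X * first_rows d P) $$ (i, j)"
    using assms ij by (simp add: first_rows_def index_mult_mat_sum)
qed (use assms in \<open>auto simp: first_rows_def\<close>)

lemma first_cols_mult_block_diag:
  assumes "X \<in> carrier_mat d d" "Y \<in> carrier_mat e e" "P \<in> carrier_mat n (d + e)"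
  shows "first_cols d (P * four_block_mat X (0\<^sub>m d e) (0\<^sub>m e d) Y) = first_cols d P * X"
proof (rule eq_matI)
  fix i j assume "i < dim_row (first_cols d P * X)" "j < dim_col (first_cols d P * X)"
  then have ij: "i < n" "j < d" using assms by (auto simp: first_cols_def)
  have "(P * four_block_mat X (0\<^sub>m d e) (0\<^sub>m e d) Y) $$ (i, j)
      = (\<Sum>k<d + e. P $$ (i, k) * four_block_mat X (0\<^sub>m d e) (0\<^sub>m e d) Y $$ (k, j))"
    using assms ij by (simp add: index_mult_mat_sum)
  also have "\<dots> = (\<Sum>k<d. P $$ (i, k) * X $$ (k, j))"
    using ij assms by (intro sum.mono_neutral_cong_right) auto
  finally show "first_cols d (P * four_block_mat X (0\<^sub>m d e) (0\<^sub>m e d) Y) $$ (i, j) = (first_cols d P * X) $$ (i, j)"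
    using assms ij by (simp add: first_cols_def index_mult_mat_sum)
qed (use assms in \<open>auto simp: first_cols_def\<close>)

text \<open>The isomorphism \<open>P\<close> and its inverse \<open>Q\<close> contain the splitting:
  the top rows of \<open>P\<close> project onto \<open>M\<close>, the first columns of
  \<open>Q\<close> include it.\<close>

lemma direct_summand_imp_retract:
  assumes M: "representation G M" and N: "\<And>g. g \<in> carrier G \<Longrightarrow> rep_mat N g \<in> carrier_mat (rep_dim N) (rep_dim N)"
    and "direct_summand G M N"
  shows "retract_of (carrier G) M N"
proof -
  obtain M' where M': "representation G M'" and iso: "rep_iso G N (direct_sum M M')"
    using assms(3) by (auto simp: direct_summand_def)
  let ?d = "rep_dim M" and ?e = "rep_dim M'" and ?D = "rep_dim N"
  let ?S = "\<lambda>g. four_block_mat (rep_mat M g) (0\<^sub>m ?d ?e) (0\<^sub>m ?e ?d) (rep_mat M' g)"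
  have D: "?D = ?d + ?e" using iso by (simp add: rep_iso_def direct_sum_def)
  obtain P where P: "P \<in> carrier_mat ?D ?D" "invertible_mat P"
    and comm: "\<And>g. g \<in> carrier G \<Longrightarrow> P * rep_mat N g = ?S g * P"
    using iso by (auto simp: rep_iso_def direct_sum_def)
  obtain Q where "inverts_mat P Q" "inverts_mat Q P" using P(2) by (auto simp: invertible_mat_def)
  then have PQ: "P * Q = 1\<^sub>m ?D" and QP': "Q * P = 1\<^sub>m (dim_row Q)"
    using P(1) by (auto simp: inverts_mat_def)
  have "dim_col Q = ?D" using arg_cong[OF PQ, of dim_col] by simp
  moreover have "dim_row Q = ?D" using arg_cong[OF QP', of dim_col] P(1) by simp
  ultimately have Q: "Q \<in> carrier_mat ?D ?D" by auto
  have QP: "Q * P = 1\<^sub>m ?D" using QP' \<open>dim_row Q = ?D\<close> by simp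
  have S: "?S g \<in> carrier_mat ?D ?D" if "g \<in> carrier G" for g
    using representation_carrier[OF M that] representation_carrier[OF M' that] by (simp add: D)
  have comm': "rep_mat N g * Q = Q * ?S g" if g: "g \<in> carrier G" for g
  proof -
    have "rep_mat N g * Q = Q * P * (rep_mat N g * Q)" using QP N[OF g] Q by simp
    also have "\<dots> = Q * (P * rep_mat N g) * Q"
      using N[OF g] P(1) Q by (simp add: assoc_mult_mat[of _ ?D ?D _ ?D _ ?D])
    also have "\<dots> = Q * ?S g * (P * Q)"
      using comm[OF g] S[OF g] P(1) Q by (simp add: assoc_mult_mat[of _ ?D ?D _ ?D _ ?D])
    also have "\<dots> = Q * ?S g" unfolding PQ by (rule right_mult_one_mat[OF mult_carrier_mat[OF Q S[OF g]]])
    finally show ?thesis .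
  qed
  have dle: "?d \<le> ?D" using D by simp
  have "intertwiner (carrier G) N M (first_rows ?d P)"
    unfolding intertwiner_def
  proof (intro conjI ballI)
    fix g assume g: "g \<in> carrier G"
    show "first_rows ?d P * rep_mat N g = rep_mat M g * first_rows ?d P"
      using first_rows_mult[OF P(1) N[OF g] dle] comm[OF g] representation_carrier[OF M g]
        representation_carrier[OF M' g] P(1) D by (simp add: first_rows_block_diag_mult)
  qed (use P in auto)
  moreover have "intertwiner (carrier G) M N (first_cols ?d Q)"
    unfolding intertwiner_def
  proof (intro conjI ballI)
    fix g assume g: "g \<in> carrier G"
    show "first_cols ?d Q * rep_mat M g = rep_mat N g * first_cols ?d Q"
      using first_cols_mult[OF N[OF g] Q dle] comm'[OF g] representation_carrier[OF M g]
        representation_carrier[OF M' g] Q D by (simp add: first_cols_mult_block_diag)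
  qed (use Q in auto)
  moreover have "first_rows ?d P * first_cols ?d Q = 1\<^sub>m ?d"
  proof -
    have "first_rows ?d P * first_cols ?d Q = first_rows ?d (first_cols ?d (P * Q))"
      using first_cols_mult[OF P(1) Q dle] first_rows_mult[OF P(1) _ dle, of "first_cols ?d Q" ?d] Q by simp
    also have "\<dots> = 1\<^sub>m ?d" unfolding PQ using dle by (auto simp: first_rows_def first_cols_def)
    finally show ?thesis .
  qed
  ultimately show ?thesis by (auto simp: retract_of_def)
qed

text \<open>Complete \<open>A\<close> and \<open>B\<close> to inverse square matrices
  \<open>P\<close> and \<open>Q\<close>. In the new basis \<open>N\<close> is block diagonal: its
  top rows are governed by \<open>A\<close> and its left columns by \<open>B\<close>, and both are
  equivariant. The lower right block is the complement.\<close>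

lemma retract_imp_direct_summand:
  assumes G: "monoid G" and M: "representation G M" and N: "representation G N"
    and "retract_of (carrier G) M N"
  shows "direct_summand G M N"
proof -
  obtain A B where A: "intertwiner (carrier G) N M A" and B: "intertwiner (carrier G) M N B"
    and AB: "A * B = 1\<^sub>m (rep_dim M)"
    using assms(4) by (auto simp: retract_of_def)
  define d D e where "d = rep_dim M" and "D = rep_dim N" and "e = D - d"
  have cA: "A \<in> carrier_mat d D" and cB: "B \<in> carrier_mat D d"
    using A B by (auto simp: intertwiner_def d_def D_def)
  obtain P Q where P: "P \<in> carrier_mat D D" and Q: "Q \<in> carrier_mat D D" and PQ: "P * Q = 1\<^sub>m D"
    and PA: "\<forall>i<d. \<forall>j<D. P $$ (i, j) = A $$ (i, j)" and QB: "\<forall>i<D. \<forall>j<d. Q $$ (i, j) = B $$ (i, j)"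
    using complete_right_inverse[OF cA cB AB[folded d_def]] by blast
  have "d \<le> D" using right_inverse_dim_le[OF cA cB AB[folded d_def]] .
  then have D: "D = d + e" by (simp add: e_def)
  have A': "first_rows d P = A" using PA P cA by (auto simp: first_rows_def)
  have B': "first_cols d Q = B" using QB Q cB by (auto simp: first_cols_def)
  have QP: "Q * P = 1\<^sub>m D" using mat_mult_left_right_inverse[OF P Q PQ] .
  define S where "S g = P * rep_mat N g * Q" for g
  define M' where "M' = Rep e (\<lambda>g. mat e e (\<lambda>(i, j). S g $$ (d + i, d + j)))"
  have cN: "rep_mat N g \<in> carrier_mat D D" if "g \<in> carrier G" for g
    using representation_carrier[OF N that] by (simp add: D_def)
  have cM: "rep_mat M g \<in> carrier_mat d d" if "g \<in> carrier G" for g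
    using representation_carrier[OF M that] by (simp add: d_def)
  have cS: "S g \<in> carrier_mat D D" if "g \<in> carrier G" for g
    using P Q cN[OF that] by (simp add: S_def)
  have blocks: "S g = four_block_mat (rep_mat M g) (0\<^sub>m d e) (0\<^sub>m e d) (rep_mat M' g)" if g: "g \<in> carrier G" for g
  proof (rule eq_matI)
    \<comment> \<open>Equivariance of \<open>A\<close> makes the upper right block zero;
      \<open>cols\<close> does the same with \<open>B\<close> for the lower left one.\<close>
    have rows: "first_rows d (S g) = rep_mat M g * first_rows d (1\<^sub>m D)"
    proof -
      have "first_rows d (S g) = A * rep_mat N g * Q"
        unfolding S_def A'[symmetric]
        using first_rows_mult[OF _ Q \<open>d \<le> D\<close>, of "P * rep_mat N g"] first_rows_mult[OF P cN[OF g] \<open>d \<le> D\<close>] P cN[OF g]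
        by simp
      also have "\<dots> = rep_mat M g * (A * Q)"
        using intertwiner_comm[OF A g] cA Q cM[OF g] by (simp add: assoc_mult_mat)
      also have "A * Q = first_rows d (P * Q)"
        using P Q \<open>d \<le> D\<close> by (simp add: first_rows_mult[of _ D D] A')
      finally show ?thesis by (simp add: PQ)
    qed
    have cols: "first_cols d (S g) = first_cols d (1\<^sub>m D) * rep_mat M g"
    proof -
      have "first_cols d (S g) = P * (rep_mat N g * B)"
        unfolding S_def B'[symmetric]
        using first_cols_mult[OF P _ \<open>d \<le> D\<close>, of "rep_mat N g * Q"] first_cols_mult[OF cN[OF g] Q \<open>d \<le> D\<close>] P Q cN[OF g]
        by simp
      also have "\<dots> = P * B * rep_mat M g"
        using intertwiner_comm[OF B g] cB P cM[OF g] by (simp add: assoc_mult_mat)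
      also have "P * B = first_cols d (P * Q)"
        using P Q \<open>d \<le> D\<close> by (simp add: first_cols_mult[of _ D D] B')
      finally show ?thesis by (simp add: PQ)
    qed
    fix i j assume "i < dim_row (four_block_mat (rep_mat M g) (0\<^sub>m d e) (0\<^sub>m e d) (rep_mat M' g))"
      "j < dim_col (four_block_mat (rep_mat M g) (0\<^sub>m d e) (0\<^sub>m e d) (rep_mat M' g))"
    then have ij: "i < D" "j < D" using cM[OF g] by (auto simp: D M'_def)
    have top: "S g $$ (i, j) = (if j < d then rep_mat M g $$ (i, j) else 0)" if "i < d"
    proof -
      have "S g $$ (i, j) = (rep_mat M g * first_rows d (1\<^sub>m D)) $$ (i, j)"
        using arg_cong[OF rows, of "\<lambda>X. X $$ (i, j)"] that ij cS[OF g] by (simp add: first_rows_def)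
      also have "\<dots> = (\<Sum>k<d. if k = j then rep_mat M g $$ (i, k) else 0)"
        using that ij cM[OF g] \<open>d \<le> D\<close>
        by (simp add: first_rows_def index_mult_mat_sum if_distrib cong: if_cong)
      finally show ?thesis by (simp add: sum.delta)
    qed
    have left: "S g $$ (i, j) = (if i < d then rep_mat M g $$ (i, j) else 0)" if "j < d"
    proof -
      have "S g $$ (i, j) = (first_cols d (1\<^sub>m D) * rep_mat M g) $$ (i, j)"
        using arg_cong[OF cols, of "\<lambda>X. X $$ (i, j)"] that ij cS[OF g] by (simp add: first_cols_def)
      also have "\<dots> = (\<Sum>k<d. (if i = k then 1 else 0) * rep_mat M g $$ (k, j))"
        using that ij cM[OF g] \<open>d \<le> D\<close>
        by (simp add: first_cols_def index_mult_mat_sum)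
      also have "\<dots> = (\<Sum>k<d. if i = k then rep_mat M g $$ (k, j) else 0)"
        by (intro sum.cong) auto
      finally show ?thesis by (simp add: sum.delta)
    qed
    show "S g $$ (i, j) = four_block_mat (rep_mat M g) (0\<^sub>m d e) (0\<^sub>m e d) (rep_mat M' g) $$ (i, j)"
      using ij top left cM[OF g] D by (auto simp: M'_def)
  qed (use cM[OF g] cS[OF g] in \<open>auto simp: D M'_def\<close>)
  have cM': "rep_mat M' g \<in> carrier_mat e e" for g by (simp add: M'_def)
  have lower: "rep_mat M' g = mat e e (\<lambda>(i, j). S g $$ (d + i, d + j))" for g by (simp add: M'_def)
  have "representation G M'"
    unfolding representation_def
  proof (intro conjI ballI)
    have "S \<one>\<^bsub>G\<^esub> = 1\<^sub>m D" using representation_one[OF N] P PQ by (simp add: S_def D_def)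
    then show "rep_mat M' \<one>\<^bsub>G\<^esub> = 1\<^sub>m (rep_dim M')" by (auto simp: M'_def D)
  next
    fix g h assume g: "g \<in> carrier G" and h: "h \<in> carrier G"
    have gh: "g \<otimes>\<^bsub>G\<^esub> h \<in> carrier G" using G g h by (rule monoid.m_closed)
    have "S g * S h = P * rep_mat N g * (Q * P) * (rep_mat N h * Q)"
      using P Q cN[OF g] cN[OF h] by (simp add: S_def assoc_mult_mat[of _ D D _ D _ D])
    also have "\<dots> = S (g \<otimes>\<^bsub>G\<^esub> h)"
      using P Q cN[OF g] cN[OF h] representation_mult[OF N g h]
      by (simp add: S_def QP assoc_mult_mat[of _ D D _ D _ D])
    finally have "S (g \<otimes>\<^bsub>G\<^esub> h) = S g * S h" ..
    also have "\<dots> = four_block_mat (rep_mat M g * rep_mat M h) (0\<^sub>m d e) (0\<^sub>m e d) (rep_mat M' g * rep_mat M' h)"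
      unfolding blocks[OF g] blocks[OF h]
      using cM[OF g] cM[OF h] cM'[of g] cM'[of h]
      by (subst mult_four_block_mat[of _ d d _ e _ e _ _ d _ e]) auto
    finally have "S (g \<otimes>\<^bsub>G\<^esub> h) = four_block_mat (rep_mat M g * rep_mat M h) (0\<^sub>m d e) (0\<^sub>m e d) (rep_mat M' g * rep_mat M' h)" .
    then show "rep_mat M' (g \<otimes>\<^bsub>G\<^esub> h) = rep_mat M' g * rep_mat M' h"
      unfolding lower[of "g \<otimes>\<^bsub>G\<^esub> h"] using cM[OF g] cM[OF h] cM'[of g] cM'[of h]
      by (intro eq_matI) (simp_all)
  qed (simp add: M'_def)
  moreover have "rep_iso G N (direct_sum M M')"
    unfolding rep_iso_def
  proof (intro conjI bexI[of _ P] ballI)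
    show "rep_dim N = rep_dim (direct_sum M M')" using \<open>d \<le> D\<close> by (simp add: direct_sum_def M'_def e_def D_def d_def)
    show "invertible_mat P" using P Q PQ QP by (auto simp: invertible_mat_def inverts_mat_def intro!: exI[of _ Q])
    show "P \<in> carrier_mat (rep_dim N) (rep_dim N)" using P by (simp add: D_def)
    fix g assume g: "g \<in> carrier G"
    have "P * rep_mat N g = S g * P"
      using P Q cN[OF g] by (simp add: S_def QP assoc_mult_mat[of _ D D _ D _ D])
    moreover have "rep_dim M' = e" by (simp add: M'_def)
    ultimately show "P * rep_mat N g = rep_mat (direct_sum M M') g * P"
      by (simp add: blocks[OF g] direct_sum_def d_def)
  qed
  ultimately show ?thesis by (auto simp: direct_summand_def)
qed

section \<open>Relative projectivity\<close>

text \<open>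
  A transversal of \<open>H\<close> in \<open>K\<close> is replaced by a partition of unity: a function that sums to 1 over
  each left coset. Relative traces then become sums over whole groups, which are easy to reindex.
\<close>

definition coset_weight :: "('g, 'b) monoid_scheme \<Rightarrow> 'g set \<Rightarrow> 'g set \<Rightarrow> ('g \<Rightarrow> 'k::field) \<Rightarrow> bool" where
  "coset_weight G K H w \<longleftrightarrow> (\<forall>g\<in>K. (\<Sum>h\<in>H. w (g \<otimes>\<^bsub>G\<^esub> h)) = 1)"

definition conj_mat :: "('g, 'b) monoid_scheme \<Rightarrow> ('g, 'k::field) rep \<Rightarrow> 'k mat \<Rightarrow> 'g \<Rightarrow> 'k mat" where
  "conj_mat G M \<theta> g = rep_mat M g * \<theta> * rep_mat M (inv\<^bsub>G\<^esub> g)"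

text \<open>If \<open>w\<close> is the indicator of a transversal of \<open>H\<close> in
  \<open>K\<close>, this is the classical relative trace from \<open>H\<close> to \<open>K\<close>.
  The subgroup \<open>H\<close> enters only through the weight.\<close>

definition weighted_trace ::
  "('g, 'b) monoid_scheme \<Rightarrow> 'g set \<Rightarrow> ('g, 'k::field) rep \<Rightarrow> ('g \<Rightarrow> 'k) \<Rightarrow> 'k mat \<Rightarrow> 'k mat" where
  "weighted_trace G K M w \<theta> = lincomb_mat (rep_dim M) (rep_dim M) K w (conj_mat G M \<theta>)"

text \<open>Higman's condition taken as the definition. The weight is left free: for a subgroup
  \<open>H\<close>, the trace of an \<open>H\<close>-endomorphism does not depend on it, by
  \<open>weighted_trace_unique\<close>.\<close>

definition relatively_projective :: "('g, 'b) monoid_scheme \<Rightarrow> 'g set \<Rightarrow> ('g, 'k::field) rep \<Rightarrow> bool" where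
  "relatively_projective G H M \<longleftrightarrow> (\<exists>\<theta> w. intertwiner H M M \<theta> \<and> coset_weight G (carrier G) H w \<and>
     weighted_trace G (carrier G) M w \<theta> = 1\<^sub>m (rep_dim M))"

section \<open>Sums over subgroups and coset weights\<close>

context group
begin

lemma sum_subgroup_mult_right:
  assumes "subgroup K G" "k \<in> K"
  shows "(\<Sum>x\<in>K. f (x \<otimes> k)) = (\<Sum>x\<in>K. f x)"
  by (rule sum.reindex_bij_witness[of _ "\<lambda>x. x \<otimes> inv k" "\<lambda>x. x \<otimes> k"])
    (use assms subgroup.mem_carrier[OF assms(1)] in
      \<open>auto simp: subgroup.m_closed subgroup.m_inv_closed m_assoc\<close>)

lemma sum_subgroup_mult_left:
  assumes "subgroup K G" "k \<in> K"
  shows "(\<Sum>x\<in>K. f (k \<otimes> x)) = (\<Sum>x\<in>K. f x)"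
  by (rule sum.reindex_bij_witness[of _ "\<lambda>x. inv k \<otimes> x" "\<lambda>x. k \<otimes> x"])
    (use assms subgroup.mem_carrier[OF assms(1)] in
      \<open>auto simp: subgroup.m_closed subgroup.m_inv_closed m_assoc[symmetric]\<close>)

lemma sum_subgroup_inv:
  assumes "subgroup K G"
  shows "(\<Sum>x\<in>K. f (inv x)) = (\<Sum>x\<in>K. f x)"
  by (rule sum.reindex_bij_witness[of _ "\<lambda>x. inv x" "\<lambda>x. inv x"])
    (use assms subgroup.mem_carrier[OF assms(1)] in \<open>auto simp: subgroup.m_inv_closed\<close>)

text \<open>Insert the sum of \<open>v\<close> over the coset of \<open>g\<close>, which is 1,
  substitute \<open>g h\<close> for \<open>g\<close>, and the sum of \<open>w\<close> over a coset
  appears, which is 1 as well because inversion permutes \<open>H\<close>.\<close>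

lemma coset_weight_sum_unique:
  fixes f :: "'a \<Rightarrow> 'k::field"
  assumes K: "subgroup K G" and H: "subgroup H G" "H \<subseteq> K"
    and w: "coset_weight G K H w" and v: "coset_weight G K H v"
    and f: "\<And>g h. g \<in> K \<Longrightarrow> h \<in> H \<Longrightarrow> f (g \<otimes> h) = f g"
  shows "(\<Sum>g\<in>K. w g * f g) = (\<Sum>g\<in>K. v g * f g)"
proof -
  have "(\<Sum>g\<in>K. w g * f g) = (\<Sum>g\<in>K. \<Sum>h\<in>H. w g * v (g \<otimes> h) * f (g \<otimes> h))"
  proof (rule sum.cong)
    fix g assume g: "g \<in> K"
    have "(\<Sum>h\<in>H. w g * v (g \<otimes> h) * f (g \<otimes> h)) = (\<Sum>h\<in>H. (w g * f g) * v (g \<otimes> h))"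
      using f[OF g] by (intro sum.cong) auto
    also have "\<dots> = (w g * f g) * 1"
      using v g by (simp add: coset_weight_def sum_distrib_left[symmetric])
    finally show "w g * f g = (\<Sum>h\<in>H. w g * v (g \<otimes> h) * f (g \<otimes> h))" by simp
  qed simp
  also have "\<dots> = (\<Sum>h\<in>H. \<Sum>g\<in>K. w g * v (g \<otimes> h) * f (g \<otimes> h))"
    by (rule sum.swap)
  also have "\<dots> = (\<Sum>h\<in>H. \<Sum>g\<in>K. w (g \<otimes> inv h) * v g * f g)"
  proof (rule sum.cong)
    fix h assume h: "h \<in> H"
    then have "inv h \<in> K" using H K by (auto simp: subgroup.m_inv_closed)
    then have "(\<Sum>g\<in>K. w g * v (g \<otimes> h) * f (g \<otimes> h))
        = (\<Sum>g\<in>K. w (g \<otimes> inv h) * v (g \<otimes> inv h \<otimes> h) * f (g \<otimes> inv h \<otimes> h))"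
      by (intro sum_subgroup_mult_right[OF K, symmetric])
    also have "\<dots> = (\<Sum>g\<in>K. w (g \<otimes> inv h) * v g * f g)"
      using h subgroup.mem_carrier[OF K] subgroup.mem_carrier[OF H(1)]
      by (intro sum.cong) (auto simp: m_assoc subset_iff)
    finally show "(\<Sum>g\<in>K. w g * v (g \<otimes> h) * f (g \<otimes> h)) = (\<Sum>g\<in>K. w (g \<otimes> inv h) * v g * f g)" .
  qed simp
  also have "\<dots> = (\<Sum>g\<in>K. (\<Sum>h\<in>H. w (g \<otimes> inv h)) * (v g * f g))"
    by (subst sum.swap) (simp add: sum_distrib_right sum_distrib_left mult_ac)
  also have "\<dots> = (\<Sum>g\<in>K. v g * f g)"
  proof (rule sum.cong)
    fix g assume "g \<in> K"
    then have "(\<Sum>h\<in>H. w (g \<otimes> inv h)) = 1"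
      using w sum_subgroup_inv[OF H(1), of "\<lambda>h. w (g \<otimes> h)"] by (simp add: coset_weight_def)
    then show "(\<Sum>h\<in>H. w (g \<otimes> inv h)) * (v g * f g) = v g * f g" by simp
  qed simp
  finally show ?thesis .
qed

lemma coset_weight_subset: "coset_weight G (carrier G) H w \<Longrightarrow> K \<subseteq> carrier G \<Longrightarrow> coset_weight G K H w"
  by (auto simp: coset_weight_def)

text \<open>The choice \<open>r g\<close> depends on the coset as a set only, hence is constant on
  it; the indicator of the chosen points sums to 1 over each coset.\<close>

lemma coset_weight_exists:
  assumes H: "subgroup H G" and fin: "finite (carrier G)"
  shows "\<exists>w :: 'a \<Rightarrow> 'k::field. coset_weight G (carrier G) H w"
proof -
  define r where "r g = (SOME x. x \<in> g <# H)" for g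
  define w :: "'a \<Rightarrow> 'k" where "w g = (if g = r g then 1 else 0)" for g
  have "finite H" using finite_subset[OF subgroup.subset[OF H] fin] .
  have "(\<Sum>h\<in>H. w (g \<otimes> h)) = 1" if g: "g \<in> carrier G" for g
  proof -
    have "r g \<in> g <# H" unfolding r_def by (rule someI[of _ g]) (use g H subgroup.one_closed[OF H] in \<open>auto simp: l_coset_def intro!: bexI[of _ \<one>]\<close>)
    then obtain h0 where h0: "h0 \<in> H" "r g = g \<otimes> h0" by (auto simp: l_coset_def)
    have "w (g \<otimes> h) = (if h = h0 then 1 else 0)" if h: "h \<in> H" for h
    proof -
      have "g \<otimes> h \<in> g <# H" using h by (auto simp: l_coset_def)
      then have "r (g \<otimes> h) = r g"
        unfolding r_def using l_repr_independence[of "g \<otimes> h" g H] g H by simp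
      then show ?thesis
        using h h0 g subgroup.mem_carrier[OF H] by (auto simp: w_def)
    qed
    then have "(\<Sum>h\<in>H. w (g \<otimes> h)) = (\<Sum>h\<in>H. if h = h0 then 1 else 0)" by (intro sum.cong) auto
    then show ?thesis using h0 \<open>finite H\<close> by simp
  qed
  then show ?thesis by (auto simp: coset_weight_def)
qed

section \<open>Relative traces of endomorphisms of a representation\<close>

context
  fixes M :: "('a, 'k::field) rep"
  assumes M: "representation G M"
begin

lemma rep_mat_carrier: "g \<in> carrier G \<Longrightarrow> rep_mat M g \<in> carrier_mat (rep_dim M) (rep_dim M)"
  by (rule representation_carrier[OF M])

lemma rep_mat_inv [simp]:
  assumes "g \<in> carrier G"
  shows "rep_mat M g * rep_mat M (inv g) = 1\<^sub>m (rep_dim M)" "rep_mat M (inv g) * rep_mat M g = 1\<^sub>m (rep_dim M)"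
  using assms by (simp_all add: representation_mult[OF M, symmetric] representation_one[OF M])

lemma conj_mat_carrier [simp]:
  "\<theta> \<in> carrier_mat (rep_dim M) (rep_dim M) \<Longrightarrow> g \<in> carrier G \<Longrightarrow> conj_mat G M \<theta> g \<in> carrier_mat (rep_dim M) (rep_dim M)"
  using rep_mat_carrier[of g] rep_mat_carrier[of "inv g"] by (simp add: conj_mat_def)

lemma conj_mat_mult:
  assumes "\<theta> \<in> carrier_mat (rep_dim M) (rep_dim M)" "g \<in> carrier G" "h \<in> carrier G"
  shows "conj_mat G M \<theta> (g \<otimes> h) = conj_mat G M (conj_mat G M \<theta> h) g"
  using assms rep_mat_carrier[of g] rep_mat_carrier[of "inv g"] rep_mat_carrier[of h] rep_mat_carrier[of "inv h"]
  by (simp add: conj_mat_def representation_mult[OF M] inv_mult_group assoc_mult_mat[of _ "rep_dim M" "rep_dim M" _ "rep_dim M" _ "rep_dim M"])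

lemma conj_mat_fixed_iff:
  assumes "\<theta> \<in> carrier_mat (rep_dim M) (rep_dim M)" "h \<in> carrier G"
  shows "conj_mat G M \<theta> h = \<theta> \<longleftrightarrow> \<theta> * rep_mat M h = rep_mat M h * \<theta>"
proof
  assume "conj_mat G M \<theta> h = \<theta>"
  then have "\<theta> * rep_mat M h = rep_mat M h * \<theta> * rep_mat M (inv h) * rep_mat M h"
    by (simp add: conj_mat_def)
  also have "\<dots> = rep_mat M h * \<theta>"
    using assms rep_mat_carrier[of h] rep_mat_carrier[of "inv h"] by (simp add: assoc_mult_mat[of _ "rep_dim M" "rep_dim M" _ "rep_dim M" _ "rep_dim M"])
  finally show "\<theta> * rep_mat M h = rep_mat M h * \<theta>" .
next
  assume "\<theta> * rep_mat M h = rep_mat M h * \<theta>"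
  then have "conj_mat G M \<theta> h = \<theta> * rep_mat M h * rep_mat M (inv h)" by (simp add: conj_mat_def)
  then show "conj_mat G M \<theta> h = \<theta>"
    using assms rep_mat_carrier[of h] rep_mat_carrier[of "inv h"] by (simp add: assoc_mult_mat[of _ "rep_dim M" "rep_dim M" _ "rep_dim M" _ "rep_dim M"])
qed

lemma intertwiner_iff_conj_mat_fixed:
  assumes "H \<subseteq> carrier G"
  shows "intertwiner H M M \<theta> \<longleftrightarrow> \<theta> \<in> carrier_mat (rep_dim M) (rep_dim M) \<and> (\<forall>h\<in>H. conj_mat G M \<theta> h = \<theta>)"
  using assms conj_mat_fixed_iff by (auto simp: intertwiner_def)

lemma conj_mat_intertwiner_mult:
  assumes "intertwiner H M M \<theta>" "H \<subseteq> carrier G" "g \<in> carrier G" "h \<in> H"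
  shows "conj_mat G M \<theta> (g \<otimes> h) = conj_mat G M \<theta> g"
  using assms intertwiner_iff_conj_mat_fixed[of H \<theta>] by (auto simp: conj_mat_mult)

lemma conj_mat_weighted_trace:
  assumes "\<theta> \<in> carrier_mat (rep_dim M) (rep_dim M)" "K \<subseteq> carrier G" "g \<in> carrier G"
  shows "conj_mat G M (weighted_trace G K M w \<theta>) g = lincomb_mat (rep_dim M) (rep_dim M) K w (\<lambda>k. conj_mat G M \<theta> (g \<otimes> k))"
proof -
  have "conj_mat G M (weighted_trace G K M w \<theta>) g
      = lincomb_mat (rep_dim M) (rep_dim M) K w (\<lambda>k. rep_mat M g * conj_mat G M \<theta> k * rep_mat M (inv g))"
    unfolding weighted_trace_def conj_mat_def[of G M "lincomb_mat _ _ _ _ _"]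
    using assms rep_mat_carrier by (intro mult_lincomb_mat_mult) auto
  also have "\<dots> = lincomb_mat (rep_dim M) (rep_dim M) K w (\<lambda>k. conj_mat G M \<theta> (g \<otimes> k))"
    using assms by (intro lincomb_mat_cong) (auto simp: conj_mat_mult conj_mat_def[of G M "conj_mat _ _ _ _"])
  finally show ?thesis .
qed

lemma weighted_trace_unique:
  assumes "intertwiner H M M \<theta>" "subgroup K G" "subgroup H G" "H \<subseteq> K"
    "coset_weight G K H w" "coset_weight G K H v"
  shows "weighted_trace G K M w \<theta> = weighted_trace G K M v \<theta>"
proof -
  have "(\<Sum>g\<in>K. w g * conj_mat G M \<theta> g $$ ij) = (\<Sum>g\<in>K. v g * conj_mat G M \<theta> g $$ ij)" for ij
    using assms conj_mat_intertwiner_mult[OF assms(1)] subgroup.subset[OF assms(2)] subgroup.subset[OF assms(3)]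
    by (intro coset_weight_sum_unique[of K H]) auto
  then show ?thesis by (simp add: weighted_trace_def lincomb_mat_def)
qed

text \<open>Conjugation by \<open>k0\<close> merely replaces the weight by a left translate, which
  is again a weight, and the trace does not see the difference.\<close>

lemma intertwiner_weighted_trace:
  assumes "intertwiner H M M \<theta>" "subgroup K G" "subgroup H G" "H \<subseteq> K" "coset_weight G K H w"
  shows "intertwiner K M M (weighted_trace G K M w \<theta>)"
proof -
  have K: "K \<subseteq> carrier G" using subgroup.subset[OF assms(2)] .
  have \<theta>: "\<theta> \<in> carrier_mat (rep_dim M) (rep_dim M)" using assms(1) by (simp add: intertwiner_def)
  have "conj_mat G M (weighted_trace G K M w \<theta>) k0 = weighted_trace G K M w \<theta>" if k0: "k0 \<in> K" for k0
  proof -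
    have ik0: "inv k0 \<in> K" using assms(2) k0 by (simp add: subgroup.m_inv_closed)
    have w': "coset_weight G K H (\<lambda>k. w (inv k0 \<otimes> k))"
      unfolding coset_weight_def
    proof
      fix g assume "g \<in> K"
      then have "inv k0 \<otimes> g \<in> K" using ik0 assms(2) by (simp add: subgroup.m_closed)
      then have "(\<Sum>h\<in>H. w (inv k0 \<otimes> g \<otimes> h)) = 1" using assms(5) by (simp add: coset_weight_def)
      moreover have "(\<Sum>h\<in>H. w (inv k0 \<otimes> g \<otimes> h)) = (\<Sum>h\<in>H. w (inv k0 \<otimes> (g \<otimes> h)))"
        using \<open>g \<in> K\<close> k0 K subgroup.mem_carrier[OF assms(3)] by (intro sum.cong) (auto simp: m_assoc subset_iff)
      ultimately show "(\<Sum>h\<in>H. w (inv k0 \<otimes> (g \<otimes> h))) = 1" by simp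
    qed
    have "conj_mat G M (weighted_trace G K M w \<theta>) k0 = lincomb_mat (rep_dim M) (rep_dim M) K w (\<lambda>k. conj_mat G M \<theta> (k0 \<otimes> k))"
      using K k0 \<theta> by (intro conj_mat_weighted_trace) auto
    also have "\<dots> = weighted_trace G K M (\<lambda>k. w (inv k0 \<otimes> k)) \<theta>"
    proof -
      have "(\<Sum>k\<in>K. w k * conj_mat G M \<theta> (k0 \<otimes> k) $$ ij) = (\<Sum>k\<in>K. w (inv k0 \<otimes> k) * conj_mat G M \<theta> k $$ ij)" for ij
      proof -
        have "(\<Sum>k\<in>K. w k * conj_mat G M \<theta> (k0 \<otimes> k) $$ ij)
            = (\<Sum>k\<in>K. w (inv k0 \<otimes> (k0 \<otimes> k)) * conj_mat G M \<theta> (k0 \<otimes> k) $$ ij)"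
          using k0 K by (intro sum.cong) (auto simp: m_assoc[symmetric] subset_iff)
        also have "\<dots> = (\<Sum>k\<in>K. w (inv k0 \<otimes> k) * conj_mat G M \<theta> k $$ ij)"
          by (rule sum_subgroup_mult_left[OF assms(2) k0])
        finally show ?thesis .
      qed
      then show ?thesis by (simp add: weighted_trace_def lincomb_mat_def)
    qed
    also have "\<dots> = weighted_trace G K M w \<theta>"
      using assms w' by (intro weighted_trace_unique) auto
    finally show ?thesis .
  qed
  then show ?thesis
    unfolding intertwiner_iff_conj_mat_fixed[OF K] by (simp add: weighted_trace_def)
qed

text \<open>Transitivity of the trace: going from \<open>H\<close> to \<open>K\<close> and then from
  \<open>K\<close> to the whole group is a single trace from \<open>H\<close>.\<close>

lemma relatively_projective_mono:
  assumes fin: "finite (carrier G)" and H: "subgroup H G" and K: "subgroup K G" and HK: "H \<subseteq> K"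
    and "relatively_projective G H M"
  shows "relatively_projective G K M"
proof -
  obtain \<theta> w where \<theta>: "intertwiner H M M \<theta>" and w: "coset_weight G (carrier G) H w"
    and tr: "weighted_trace G (carrier G) M w \<theta> = 1\<^sub>m (rep_dim M)"
    using assms(5) by (auto simp: relatively_projective_def)
  obtain v :: "'a \<Rightarrow> 'k" where v: "coset_weight G (carrier G) K v" using coset_weight_exists[OF K fin] by blast
  have sub: "H \<subseteq> carrier G" "K \<subseteq> carrier G" using H K subgroup.subset by auto
  have c\<theta>: "\<theta> \<in> carrier_mat (rep_dim M) (rep_dim M)" using \<theta> by (simp add: intertwiner_def)
  \<comment> \<open>The convolution over \<open>K\<close> of the two weights. Only the values of
    \<open>w\<close> on \<open>K\<close> enter, and there \<open>w\<close> is still a weight for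
    \<open>H\<close>.\<close>
  define W where "W x = (\<Sum>k\<in>K. v (x \<otimes> inv k) * w k)" for x
  have W: "coset_weight G (carrier G) H W"
    unfolding coset_weight_def
  proof
    fix x assume x: "x \<in> carrier G"
    have "(\<Sum>h\<in>H. W (x \<otimes> h)) = (\<Sum>h\<in>H. \<Sum>k\<in>K. v (x \<otimes> inv k) * w (k \<otimes> h))"
    proof (rule sum.cong)
      fix h assume h: "h \<in> H"
      have "W (x \<otimes> h) = (\<Sum>k\<in>K. v (x \<otimes> h \<otimes> inv (k \<otimes> h)) * w (k \<otimes> h))"
        unfolding W_def by (rule sum_subgroup_mult_right[OF K, symmetric]) (use h HK in auto)
      also have "\<dots> = (\<Sum>k\<in>K. v (x \<otimes> inv k) * w (k \<otimes> h))"
      proof (rule sum.cong)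
        fix k assume k: "k \<in> K"
        then have "h \<in> carrier G" "k \<in> carrier G" using h sub by auto
        then have "x \<otimes> h \<otimes> inv (k \<otimes> h) = x \<otimes> inv k"
          using x m_assoc[of x h "inv h"] by (simp add: inv_mult_group m_assoc[symmetric])
        then show "v (x \<otimes> h \<otimes> inv (k \<otimes> h)) * w (k \<otimes> h) = v (x \<otimes> inv k) * w (k \<otimes> h)" by simp
      qed simp
      finally show "W (x \<otimes> h) = (\<Sum>k\<in>K. v (x \<otimes> inv k) * w (k \<otimes> h))" .
    qed simp
    also have "\<dots> = (\<Sum>k\<in>K. v (x \<otimes> inv k) * (\<Sum>h\<in>H. w (k \<otimes> h)))"
      by (subst sum.swap) (simp add: sum_distrib_left)
    also have "\<dots> = (\<Sum>k\<in>K. v (x \<otimes> inv k))"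
      using w sub by (intro sum.cong) (auto simp: coset_weight_def)
    also have "\<dots> = 1"
      using v x sum_subgroup_inv[OF K, of "\<lambda>k. v (x \<otimes> k)"] by (simp add: coset_weight_def)
    finally show "(\<Sum>h\<in>H. W (x \<otimes> h)) = 1" .
  qed
  have "weighted_trace G (carrier G) M v (weighted_trace G K M w \<theta>) = weighted_trace G (carrier G) M W \<theta>"
  proof (rule eq_matI)
    fix i j assume "i < dim_row (weighted_trace G (carrier G) M W \<theta>)" "j < dim_col (weighted_trace G (carrier G) M W \<theta>)"
    then have ij: "i < rep_dim M" "j < rep_dim M" by (auto simp: weighted_trace_def)
    let ?c = "\<lambda>g. conj_mat G M \<theta> g $$ (i, j)"
    have "weighted_trace G (carrier G) M W \<theta> $$ (i, j) = (\<Sum>x\<in>carrier G. \<Sum>k\<in>K. v (x \<otimes> inv k) * w k * ?c x)"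
      using ij by (simp add: weighted_trace_def W_def sum_distrib_right)
    also have "\<dots> = (\<Sum>k\<in>K. \<Sum>x\<in>carrier G. v (x \<otimes> inv k) * w k * ?c x)" by (rule sum.swap)
    also have "\<dots> = (\<Sum>k\<in>K. \<Sum>g\<in>carrier G. v g * w k * ?c (g \<otimes> k))"
    proof (rule sum.cong)
      fix k assume "k \<in> K"
      then have k: "k \<in> carrier G" using sub by auto
      have "(\<Sum>x\<in>carrier G. v (x \<otimes> inv k) * w k * ?c x) = (\<Sum>g\<in>carrier G. v (g \<otimes> k \<otimes> inv k) * w k * ?c (g \<otimes> k))"
        by (rule sum_subgroup_mult_right[OF subgroup_self k, symmetric])
      then show "(\<Sum>x\<in>carrier G. v (x \<otimes> inv k) * w k * ?c x) = (\<Sum>g\<in>carrier G. v g * w k * ?c (g \<otimes> k))"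
        using k by (simp add: m_assoc)
    qed simp
    also have "\<dots> = (\<Sum>g\<in>carrier G. v g * (\<Sum>k\<in>K. w k * ?c (g \<otimes> k)))"
      by (subst sum.swap) (simp add: sum_distrib_left mult_ac)
    also have "\<dots> = (\<Sum>g\<in>carrier G. v g * conj_mat G M (weighted_trace G K M w \<theta>) g $$ (i, j))"
      using ij c\<theta> sub by (intro sum.cong) (auto simp: conj_mat_weighted_trace)
    also have "\<dots> = weighted_trace G (carrier G) M v (weighted_trace G K M w \<theta>) $$ (i, j)"
      using ij by (simp add: weighted_trace_def[of _ "carrier G"])
    finally show "weighted_trace G (carrier G) M v (weighted_trace G K M w \<theta>) $$ (i, j)
      = weighted_trace G (carrier G) M W \<theta> $$ (i, j)" ..
  qed (auto simp: weighted_trace_def)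
  also have "\<dots> = 1\<^sub>m (rep_dim M)"
    using weighted_trace_unique[OF \<theta> subgroup_self H sub(1) W w] tr by simp
  finally show ?thesis
    using v intertwiner_weighted_trace[OF \<theta> K H HK coset_weight_subset[OF w sub(2)]]
    unfolding relatively_projective_def by blast
qed

text \<open>Transport of structure: \<open>\<theta>\<close> is conjugated by \<open>s\<close> and
  the weight is translated on the right by \<open>s\<close>, since
  \<open>g (s h s^-1) s = (g s) h\<close>.\<close>

lemma relatively_projective_conj:
  assumes H: "subgroup H G" and s: "s \<in> carrier G" and "relatively_projective G H M"
  shows "relatively_projective G ((\<lambda>h. s \<otimes> h \<otimes> inv s) ` H) M"
proof -
  obtain \<theta> w where \<theta>: "intertwiner H M M \<theta>" and w: "coset_weight G (carrier G) H w"
    and tr: "weighted_trace G (carrier G) M w \<theta> = 1\<^sub>m (rep_dim M)"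
    using assms(3) by (auto simp: relatively_projective_def)
  let ?H = "(\<lambda>h. s \<otimes> h \<otimes> inv s) ` H"
  have sub: "H \<subseteq> carrier G" using H subgroup.subset by auto
  have inj: "inj_on (\<lambda>h. s \<otimes> h \<otimes> inv s) H" using sub s by (auto simp: inj_on_def subset_iff)
  have c\<theta>: "\<theta> \<in> carrier_mat (rep_dim M) (rep_dim M)" using \<theta> by (simp add: intertwiner_def)
  have "intertwiner ?H M M (conj_mat G M \<theta> s)"
  proof (subst intertwiner_iff_conj_mat_fixed)
    show "?H \<subseteq> carrier G" using s sub by auto
    have "conj_mat G M (conj_mat G M \<theta> s) (s \<otimes> h \<otimes> inv s) = conj_mat G M \<theta> s" if "h \<in> H" for h
    proof -
      have h: "h \<in> carrier G" using that sub by auto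
      have "conj_mat G M (conj_mat G M \<theta> s) (s \<otimes> h \<otimes> inv s) = conj_mat G M \<theta> (s \<otimes> h \<otimes> inv s \<otimes> s)"
        using h s c\<theta> by (simp add: conj_mat_mult)
      also have "s \<otimes> h \<otimes> inv s \<otimes> s = s \<otimes> h" using h s by (simp add: m_assoc)
      also have "conj_mat G M \<theta> (s \<otimes> h) = conj_mat G M \<theta> s"
        by (rule conj_mat_intertwiner_mult[OF \<theta> sub s that])
      finally show ?thesis .
    qed
    then show "conj_mat G M \<theta> s \<in> carrier_mat (rep_dim M) (rep_dim M) \<and> (\<forall>h\<in>?H. conj_mat G M (conj_mat G M \<theta> s) h = conj_mat G M \<theta> s)"
      using c\<theta> s by auto
  qed
  moreover have "coset_weight G (carrier G) ?H (\<lambda>g. w (g \<otimes> s))"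
    unfolding coset_weight_def
  proof
    fix g assume g: "g \<in> carrier G"
    have "(\<Sum>h\<in>?H. w (g \<otimes> h \<otimes> s)) = (\<Sum>h\<in>H. w (g \<otimes> (s \<otimes> h \<otimes> inv s) \<otimes> s))"
      by (simp add: sum.reindex[OF inj])
    also have "\<dots> = (\<Sum>h\<in>H. w (g \<otimes> s \<otimes> h))"
      using g s sub by (intro sum.cong) (auto simp: m_assoc subset_iff)
    also have "\<dots> = 1" using w g s by (simp add: coset_weight_def)
    finally show "(\<Sum>h\<in>?H. w (g \<otimes> h \<otimes> s)) = 1" .
  qed
  moreover have "weighted_trace G (carrier G) M (\<lambda>g. w (g \<otimes> s)) (conj_mat G M \<theta> s) = 1\<^sub>m (rep_dim M)"
  proof -
    have "weighted_trace G (carrier G) M (\<lambda>g. w (g \<otimes> s)) (conj_mat G M \<theta> s)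
      = lincomb_mat (rep_dim M) (rep_dim M) (carrier G) (\<lambda>g. w (g \<otimes> s)) (\<lambda>g. conj_mat G M \<theta> (g \<otimes> s))"
      unfolding weighted_trace_def using c\<theta> s by (intro lincomb_mat_cong) (auto simp: conj_mat_mult)
    also have "\<dots> = weighted_trace G (carrier G) M w \<theta>"
    proof -
      have "(\<Sum>g\<in>carrier G. w (g \<otimes> s) * conj_mat G M \<theta> (g \<otimes> s) $$ ij) = (\<Sum>g\<in>carrier G. w g * conj_mat G M \<theta> g $$ ij)" for ij
        by (rule sum_subgroup_mult_right[OF subgroup_self s])
      then show ?thesis by (simp add: weighted_trace_def lincomb_mat_def)
    qed
    finally show ?thesis using tr by simp
  qed
  ultimately show ?thesis unfolding relatively_projective_def by blast
qed

end

end

section \<open>Induced representations\<close>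

lemma block_index_less:
  fixes a r i e :: nat
  assumes "a < r" "i < e"
  shows "a * e + i < r * e"
proof -
  have "a * e + i < Suc a * e" using assms(2) by simp
  also have "\<dots> \<le> r * e" using assms(1) by (intro mult_le_mono1) simp
  finally show ?thesis .
qed

lemma sum_blocks:
  fixes f :: "nat \<Rightarrow> 'a::comm_monoid_add"
  shows "(\<Sum>k<r * e. f k) = (\<Sum>a<r. \<Sum>i<e. f (a * e + i))"
proof (induction r)
  case (Suc r)
  have "(\<Sum>k<Suc r * e. f k) = (\<Sum>k<r * e. f k) + (\<Sum>k=r * e..<r * e + e. f k)"
    by (subst sum.atLeastLessThan_concat[of 0 "r * e" "r * e + e" f, symmetric, unfolded atLeast0LessThan, symmetric])
      (simp_all add: atLeast0LessThan add.commute)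
  also have "(\<Sum>k=r * e..<r * e + e. f k) = (\<Sum>i<e. f (r * e + i))"
    using sum.shift_bounds_nat_ivl[of f 0 "r * e" e] by (simp add: atLeast0LessThan add.commute)
  finally show ?case using Suc by simp
qed simp

definition col_block :: "nat \<Rightarrow> nat \<Rightarrow> 'k::field mat \<Rightarrow> 'k mat" where
  "col_block e b X = mat (dim_row X) e (\<lambda>(i, j). X $$ (i, b * e + j))"

definition row_block :: "nat \<Rightarrow> nat \<Rightarrow> 'k::field mat \<Rightarrow> 'k mat" where
  "row_block e a X = mat e (dim_col X) (\<lambda>(i, j). X $$ (a * e + i, j))"

lemma col_block_carrier [simp]: "X \<in> carrier_mat m n \<Longrightarrow> col_block e b X \<in> carrier_mat m e"
  by (simp add: col_block_def)

lemma row_block_carrier [simp]: "X \<in> carrier_mat m n \<Longrightarrow> row_block e a X \<in> carrier_mat e n"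
  by (simp add: row_block_def)

lemma col_block_mult:
  assumes "X \<in> carrier_mat m n" "Y \<in> carrier_mat n (r * e)" "b < r"
  shows "col_block e b (X * Y) = X * col_block e b Y"
  by (rule eq_matI)
    (use assms block_index_less[OF assms(3)] in \<open>auto simp: col_block_def index_mult_mat_sum\<close>)

lemma row_block_mult:
  assumes "X \<in> carrier_mat (r * e) n" "Y \<in> carrier_mat n m" "a < r"
  shows "row_block e a (X * Y) = row_block e a X * Y"
  by (rule eq_matI)
    (use assms block_index_less[OF assms(3)] in \<open>auto simp: row_block_def index_mult_mat_sum\<close>)

lemma div_mod_less:
  fixes k r e :: nat
  assumes "k < r * e"
  shows "k div e < r" "k mod e < e"
  using assms by (metis less_mult_imp_div_less, metis less_nat_zero_code mod_less_divisor mult_0_right neq0_conv)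

lemma eq_mat_col_blockI:
  assumes "X \<in> carrier_mat m (r * e)" "Y \<in> carrier_mat m (r * e)"
    and eq: "\<And>b. b < r \<Longrightarrow> col_block e b X = col_block e b Y"
  shows "X = Y"
proof (rule eq_matI)
  fix i j assume "i < dim_row Y" "j < dim_col Y"
  then have ij: "i < m" "j < r * e" using assms by auto
  have "col_block e (j div e) X $$ (i, j mod e) = col_block e (j div e) Y $$ (i, j mod e)"
    using eq[OF div_mod_less(1)[OF ij(2)]] by simp
  then show "X $$ (i, j) = Y $$ (i, j)"
    using ij assms div_mod_less(2)[OF ij(2)] by (simp add: col_block_def)
qed (use assms in auto)

lemma eq_mat_row_blockI:
  assumes "X \<in> carrier_mat (r * e) m" "Y \<in> carrier_mat (r * e) m"
    and eq: "\<And>a. a < r \<Longrightarrow> row_block e a X = row_block e a Y"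
  shows "X = Y"
proof (rule eq_matI)
  fix i j assume "i < dim_row Y" "j < dim_col Y"
  then have ij: "i < r * e" "j < m" using assms by auto
  have "row_block e (i div e) X $$ (i mod e, j) = row_block e (i div e) Y $$ (i mod e, j)"
    using eq[OF div_mod_less(1)[OF ij(1)]] by simp
  then show "X $$ (i, j) = Y $$ (i, j)"
    using ij assms div_mod_less(2)[OF ij(1)] by (simp add: row_block_def)
qed (use assms in auto)

text \<open>When \<open>X\<close> maps out of an induced representation and \<open>Y\<close> maps
  into it, the sum on the right becomes a relative trace.\<close>

lemma mult_mat_blocks:
  assumes X: "X \<in> carrier_mat m (r * e)" and Y: "Y \<in> carrier_mat (r * e) n"
  shows "X * Y = lincomb_mat m n {..<r} (\<lambda>_. 1) (\<lambda>a. col_block e a X * row_block e a Y)"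
proof (rule eq_matI)
  fix i j assume "i < dim_row (lincomb_mat m n {..<r} (\<lambda>_. 1::'a) (\<lambda>a. col_block e a X * row_block e a Y))"
    "j < dim_col (lincomb_mat m n {..<r} (\<lambda>_. 1::'a) (\<lambda>a. col_block e a X * row_block e a Y))"
  then have ij: "i < m" "j < n" by auto
  then have "(X * Y) $$ (i, j) = (\<Sum>a<r. \<Sum>k<e. X $$ (i, a * e + k) * Y $$ (a * e + k, j))"
    using assms by (simp add: index_mult_mat_sum sum_blocks)
  also have "\<dots> = (\<Sum>a<r. (col_block e a X * row_block e a Y) $$ (i, j))"
    using ij assms
    by (intro sum.cong) (simp_all add: index_mult_mat_sum col_block_def row_block_def)
  finally show "(X * Y) $$ (i, j) = lincomb_mat m n {..<r} (\<lambda>_. 1) (\<lambda>a. col_block e a X * row_block e a Y) $$ (i, j)"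
    using ij by simp
qed (use assms in auto)

lemma rep_dim_induced_rep_along [simp]: "rep_dim (induced_rep_along G H rs N) = length rs * rep_dim N"
  by (simp add: induced_rep_along_def Let_def)

lemma induced_rep_along_carrier [simp]:
  "rep_mat (induced_rep_along G H rs N) g \<in> carrier_mat (length rs * rep_dim N) (length rs * rep_dim N)"
  by (simp add: induced_rep_along_def Let_def)

lemma index_induced_rep_along:
  assumes "a < length rs" "b < length rs" "i < rep_dim N" "j < rep_dim N"
  shows "rep_mat (induced_rep_along G H rs N) g $$ (a * rep_dim N + i, b * rep_dim N + j) =
    (let x = inv\<^bsub>G\<^esub> (rs ! a) \<otimes>\<^bsub>G\<^esub> g \<otimes>\<^bsub>G\<^esub> rs ! b in if x \<in> H then rep_mat N x $$ (i, j) else 0)"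
  using assms block_index_less[OF assms(1,3)] block_index_less[OF assms(2,4)]
  by (simp add: induced_rep_along_def Let_def)

section \<open>Transversals, induction and Frobenius reciprocity\<close>

context group
begin

lemma left_transversal_exists:
  assumes H: "subgroup H G" and fin: "finite (carrier G)"
  shows "\<exists>rs. left_transversal G H rs"
proof -
  have "finite ((\<lambda>g. g <# H) ` carrier G)" using fin by simp
  then obtain cs where cs: "set cs = (\<lambda>g. g <# H) ` carrier G" "distinct cs"
    using finite_distinct_list by metis
  define rs where "rs = map (\<lambda>c. SOME x. x \<in> c) cs"
  have rep: "rs ! a \<in> carrier G \<and> rs ! a <# H = cs ! a" if "a < length cs" for a
  proof -
    have "cs ! a \<in> set cs" using that by simp
    then obtain g where g: "g \<in> carrier G" "cs ! a = g <# H" using cs(1) by auto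
    have "g \<in> cs ! a" using g subgroup.one_closed[OF H] by (auto simp: l_coset_def intro!: bexI[of _ \<one>])
    then have "(SOME x. x \<in> cs ! a) \<in> cs ! a" by (rule someI)
    then have *: "rs ! a \<in> g <# H" using that g by (simp add: rs_def)
    then have "rs ! a \<in> carrier G" using g subgroup.mem_carrier[OF H] by (auto simp: l_coset_def)
    moreover have "rs ! a <# H = g <# H" using l_repr_independence[OF * g(1) H] by simp
    ultimately show ?thesis using g by simp
  qed
  have len: "length rs = length cs" by (simp add: rs_def)
  have "\<exists>!a. a < length rs \<and> g \<in> rs ! a <# H" if g: "g \<in> carrier G" for g
  proof -
    have *: "g \<in> rs ! a <# H \<longleftrightarrow> cs ! a = g <# H" if a: "a < length cs" for a
    proof
      assume "g \<in> rs ! a <# H"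
      then show "cs ! a = g <# H" using l_repr_independence[of g "rs ! a" H] rep[OF a] H by simp
    next
      assume "cs ! a = g <# H"
      then show "g \<in> rs ! a <# H"
        using rep[OF a] g subgroup.one_closed[OF H] by (auto simp: l_coset_def intro!: bexI[of _ \<one>])
    qed
    have "g <# H \<in> set cs" using cs(1) g by auto
    then have "\<exists>!a. a < length cs \<and> cs ! a = g <# H" using cs(2) by (auto simp: distinct_Ex1)
    then show ?thesis using * len by metis
  qed
  moreover have "set rs \<subseteq> carrier G" using rep len unfolding set_conv_nth by auto
  ultimately have "left_transversal G H rs" by (simp add: left_transversal_def)
  then show ?thesis ..
qed

context
  fixes H rs
  assumes H: "subgroup H G" and rs: "left_transversal G H rs"
begin

lemma transversal_carrier: "a < length rs \<Longrightarrow> rs ! a \<in> carrier G"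
  using rs by (auto simp: left_transversal_def)

lemma transversal_index:
  assumes "g \<in> carrier G"
  obtains a x where "a < length rs" "x \<in> H" "g = rs ! a \<otimes> x"
  using rs assms unfolding left_transversal_def l_coset_def by blast

lemma transversal_unique:
  assumes "a < length rs" "b < length rs" "x \<in> H" "y \<in> H" "rs ! a \<otimes> x = rs ! b \<otimes> y"
  shows "a = b"
proof -
  have "rs ! a \<otimes> x \<in> carrier G" using transversal_carrier[OF assms(1)] subgroup.mem_carrier[OF H assms(3)] by simp
  moreover have "rs ! a \<otimes> x \<in> rs ! a <# H" using assms(3) unfolding l_coset_def by blast
  moreover have "rs ! a \<otimes> x \<in> rs ! b <# H" using assms(4) unfolding assms(5) l_coset_def by blast
  ultimately show ?thesis using rs assms(1,2) unfolding left_transversal_def by blast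
qed

text \<open>Here \<open>g\<close> carries the coset of \<open>rs ! b\<close> to that of
  \<open>rs ! a\<close>, with discrepancy \<open>x\<close> in \<open>H\<close>. Hence the block
  matrix of \<open>g\<close> on an induced representation is monomial: block \<open>(a, b)\<close>
  is given by \<open>x\<close>, and it is the only block of its column and of its row that can be
  nonzero.\<close>

lemma transversal_mem_iff:
  assumes "a < length rs" "b < length rs" "x \<in> H" "g \<in> carrier G" "g \<otimes> rs ! b = rs ! a \<otimes> x" "c < length rs"
  shows "inv (rs ! c) \<otimes> g \<otimes> rs ! b \<in> H \<longleftrightarrow> c = a"
    and "inv (rs ! a) \<otimes> g \<otimes> rs ! b = x"
    and "inv (rs ! a) \<otimes> g \<otimes> rs ! c \<in> H \<longleftrightarrow> c = b"
proof -
  note [simp] = transversal_carrier[OF assms(1)] transversal_carrier[OF assms(2)]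
    transversal_carrier[OF assms(6)] subgroup.mem_carrier[OF H assms(3)] assms(4)
  have eq: "inv y \<otimes> g \<otimes> rs ! b = inv y \<otimes> rs ! a \<otimes> x" if "y \<in> carrier G" for y
    using that assms(5) by (simp add: m_assoc)
  show x: "inv (rs ! a) \<otimes> g \<otimes> rs ! b = x" using eq[of "rs ! a"] by simp
  show "inv (rs ! c) \<otimes> g \<otimes> rs ! b \<in> H \<longleftrightarrow> c = a"
  proof
    assume *: "inv (rs ! c) \<otimes> g \<otimes> rs ! b \<in> H"
    have "rs ! c \<otimes> (inv (rs ! c) \<otimes> g \<otimes> rs ! b) = rs ! a \<otimes> x"
      using assms(5) by (simp add: m_assoc[symmetric])
    then show "c = a" using transversal_unique[OF assms(6,1) * assms(3)] by simp
  qed (use x assms(3) in simp)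
  show "inv (rs ! a) \<otimes> g \<otimes> rs ! c \<in> H \<longleftrightarrow> c = b"
  proof
    assume *: "inv (rs ! a) \<otimes> g \<otimes> rs ! c \<in> H"
    define y where "y = inv (rs ! a) \<otimes> g \<otimes> rs ! c"
    have "y \<in> H" using * by (simp add: y_def)
    then have y: "y \<in> carrier G" "inv y \<otimes> x \<in> H"
      using H assms(3) by (auto simp: subgroup.mem_carrier subgroup.m_closed subgroup.m_inv_closed)
    have "g \<otimes> rs ! c = rs ! a \<otimes> y" by (simp add: y_def m_assoc[symmetric])
    then have "inv g \<otimes> (rs ! a \<otimes> y) = rs ! c" using y(1) by (simp add: inv_solve_left')
    moreover have "inv g \<otimes> (rs ! a \<otimes> x) = rs ! b" using assms(5) by (simp add: inv_solve_left')
    moreover have "inv g \<otimes> (rs ! a \<otimes> y) \<otimes> (inv y \<otimes> x) = inv g \<otimes> (rs ! a \<otimes> (y \<otimes> inv y) \<otimes> x)"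
      using y(1) by (simp only: m_assoc m_closed inv_closed transversal_carrier[OF assms(1)]
          subgroup.mem_carrier[OF H assms(3)] assms(4))
    ultimately have "rs ! c \<otimes> (inv y \<otimes> x) = rs ! b \<otimes> \<one>" using y(1) by simp
    then show "c = b" using transversal_unique[OF assms(6,2) y(2) subgroup.one_closed[OF H]] by simp
  qed (use x assms(3) in simp)
qed

text \<open>The weight that turns \<open>weighted_trace\<close> over the whole group into a sum over
  the list \<open>rs\<close>.\<close>

definition "transversal_weight g = (if g \<in> set rs then 1 else (0::'k::field))"

lemma coset_weight_transversal:
  assumes fin: "finite (carrier G)"
  shows "coset_weight G (carrier G) H (transversal_weight :: 'a \<Rightarrow> 'k::field)"
  unfolding coset_weight_def
proof
  fix g assume g: "g \<in> carrier G"
  have "finite H" using finite_subset[OF subgroup.subset[OF H] fin] .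
  obtain a x where ax: "a < length rs" "x \<in> H" "g = rs ! a \<otimes> x" using transversal_index[OF g] .
  have x: "x \<in> carrier G" "inv x \<in> H" using ax H by (auto simp: subgroup.mem_carrier subgroup.m_inv_closed)
  have "g \<otimes> h \<in> set rs \<longleftrightarrow> h = inv x" if h: "h \<in> H" for h
  proof
    have hG: "h \<in> carrier G" using h H by (simp add: subgroup.mem_carrier)
    assume "g \<otimes> h \<in> set rs"
    then obtain b where b: "b < length rs" "rs ! b = g \<otimes> h" by (auto simp: in_set_conv_nth)
    have eq: "rs ! a \<otimes> (x \<otimes> h) = rs ! b \<otimes> \<one>"
      using b(2) ax x hG transversal_carrier[OF ax(1)] by (simp add: m_assoc)
    then have "a = b"
      using transversal_unique[OF ax(1) b(1) subgroup.m_closed[OF H ax(2) h] subgroup.one_closed[OF H]] by simp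
    then have "rs ! a \<otimes> (x \<otimes> h) = rs ! a \<otimes> \<one>" using eq by simp
    then have "x \<otimes> h = \<one>" using transversal_carrier[OF ax(1)] x hG by simp
    then show "h = inv x" using x hG by (metis inv_equality inv_inv inv_closed)
  next
    assume "h = inv x"
    then have "g \<otimes> h = rs ! a" using ax x transversal_carrier[OF ax(1)] by (simp add: m_assoc)
    then show "g \<otimes> h \<in> set rs" using ax by simp
  qed
  then have "(\<Sum>h\<in>H. transversal_weight (g \<otimes> h)) = (\<Sum>h\<in>H. if h = inv x then 1 else (0::'k))"
    by (intro sum.cong) (auto simp: transversal_weight_def)
  then show "(\<Sum>h\<in>H. transversal_weight (g \<otimes> h)) = (1::'k)" using x \<open>finite H\<close> by simp
qed

lemma sum_transversal_weight:
  assumes fin: "finite (carrier G)"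
  shows "(\<Sum>g\<in>carrier G. transversal_weight g * f g) = (\<Sum>a<length rs. f (rs ! a))"
proof -
  have inj: "inj_on ((!) rs) {..<length rs}"
  proof
    fix a b assume "a \<in> {..<length rs}" "b \<in> {..<length rs}" "rs ! a = rs ! b"
    then show "a = b" using transversal_unique[of a b \<one> \<one>] subgroup.one_closed[OF H] by simp
  qed
  have set_rs: "set rs = (!) rs ` {..<length rs}" by (auto simp: in_set_conv_nth)
  have "set rs \<subseteq> carrier G" using rs by (simp add: left_transversal_def)
  then have "(\<Sum>g\<in>carrier G. transversal_weight g * f g) = (\<Sum>g\<in>set rs. f g)"
    using fin by (intro sum.mono_neutral_cong_right) (auto simp: transversal_weight_def)
  also have "\<dots> = (\<Sum>a<length rs. f (rs ! a))" unfolding set_rs by (simp add: sum.reindex[OF inj])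
  finally show ?thesis .
qed

lemma weighted_trace_transversal:
  assumes fin: "finite (carrier G)"
  shows "weighted_trace G (carrier G) M transversal_weight \<theta> =
    lincomb_mat (rep_dim M) (rep_dim M) {..<length rs} (\<lambda>_. 1) (\<lambda>a. conj_mat G M \<theta> (rs ! a))"
  by (simp add: weighted_trace_def lincomb_mat_def sum_transversal_weight[OF fin])

context
  fixes N :: "('a, 'k::field) rep"
  assumes N: "representation (G\<lparr>carrier := H\<rparr>) N"
begin

lemma subgroup_rep_carrier: "h \<in> H \<Longrightarrow> rep_mat N h \<in> carrier_mat (rep_dim N) (rep_dim N)"
  using representation_carrier[OF N] by simp

text \<open>A monomial block matrix on the right permutes column blocks, up to a factor from
  \<open>N\<close>. Together with \<open>row_block_induced_mult\<close> this reduces every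
  computation with induced matrices to single blocks.\<close>

lemma col_block_mult_induced:
  assumes X: "X \<in> carrier_mat m (length rs * rep_dim N)" and ab: "a < length rs" "b < length rs"
    and x: "x \<in> H" and g: "g \<in> carrier G" "g \<otimes> rs ! b = rs ! a \<otimes> x"
  shows "col_block (rep_dim N) b (X * rep_mat (induced_rep_along G H rs N) g)
    = col_block (rep_dim N) a X * rep_mat N x"
proof (rule eq_matI)
  let ?e = "rep_dim N" and ?I = "rep_mat (induced_rep_along G H rs N) g"
  note Nx = subgroup_rep_carrier[OF x]
  fix i j assume "i < dim_row (col_block ?e a X * rep_mat N x)" "j < dim_col (col_block ?e a X * rep_mat N x)"
  then have ij: "i < m" "j < ?e" using X Nx by (auto simp: col_block_def)
  have "col_block ?e b (X * ?I) $$ (i, j) = (X * ?I) $$ (i, b * ?e + j)"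
    using ij X by (simp add: col_block_def)
  also have "\<dots> = (\<Sum>c<length rs. \<Sum>k<?e. X $$ (i, c * ?e + k) * ?I $$ (c * ?e + k, b * ?e + j))"
    using ij X block_index_less[OF ab(2) ij(2)] induced_rep_along_carrier[of G H rs N g]
    by (simp add: index_mult_mat_sum sum_blocks del: induced_rep_along_carrier)
  also have "\<dots> = (\<Sum>c<length rs. if c = a then \<Sum>k<?e. X $$ (i, c * ?e + k) * rep_mat N x $$ (k, j) else 0)"
  proof (rule sum.cong)
    fix c assume "c \<in> {..<length rs}"
    then have c: "c < length rs" by simp
    show "(\<Sum>k<?e. X $$ (i, c * ?e + k) * ?I $$ (c * ?e + k, b * ?e + j))
      = (if c = a then \<Sum>k<?e. X $$ (i, c * ?e + k) * rep_mat N x $$ (k, j) else 0)"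
      using transversal_mem_iff[OF ab x g c] x ij ab c by (auto simp: index_induced_rep_along Let_def)
  qed simp
  also have "\<dots> = (\<Sum>k<?e. X $$ (i, a * ?e + k) * rep_mat N x $$ (k, j))"
    using ab by simp
  also have "\<dots> = (col_block ?e a X * rep_mat N x) $$ (i, j)"
    using ij X Nx by (simp add: index_mult_mat_sum col_block_def)
  finally show "col_block ?e b (X * ?I) $$ (i, j) = (col_block ?e a X * rep_mat N x) $$ (i, j)" .
qed (use X subgroup_rep_carrier[OF x] in \<open>auto simp: col_block_def\<close>)

lemma row_block_induced_mult:
  assumes X: "X \<in> carrier_mat (length rs * rep_dim N) m" and ab: "a < length rs" "b < length rs"
    and x: "x \<in> H" and g: "g \<in> carrier G" "g \<otimes> rs ! b = rs ! a \<otimes> x"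
  shows "row_block (rep_dim N) a (rep_mat (induced_rep_along G H rs N) g * X)
    = rep_mat N x * row_block (rep_dim N) b X"
proof (rule eq_matI)
  let ?e = "rep_dim N" and ?I = "rep_mat (induced_rep_along G H rs N) g"
  note Nx = subgroup_rep_carrier[OF x]
  fix i j assume "i < dim_row (rep_mat N x * row_block ?e b X)" "j < dim_col (rep_mat N x * row_block ?e b X)"
  then have ij: "i < ?e" "j < m" using X Nx by (auto simp: row_block_def)
  have "row_block ?e a (?I * X) $$ (i, j) = (?I * X) $$ (a * ?e + i, j)"
    using ij X by (simp add: row_block_def)
  also have "\<dots> = (\<Sum>c<length rs. \<Sum>k<?e. ?I $$ (a * ?e + i, c * ?e + k) * X $$ (c * ?e + k, j))"
    using ij X block_index_less[OF ab(1) ij(1)] induced_rep_along_carrier[of G H rs N g]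
    by (simp add: index_mult_mat_sum sum_blocks del: induced_rep_along_carrier)
  also have "\<dots> = (\<Sum>c<length rs. if c = b then \<Sum>k<?e. rep_mat N x $$ (i, k) * X $$ (c * ?e + k, j) else 0)"
  proof (rule sum.cong)
    fix c assume "c \<in> {..<length rs}"
    then have c: "c < length rs" by simp
    show "(\<Sum>k<?e. ?I $$ (a * ?e + i, c * ?e + k) * X $$ (c * ?e + k, j))
      = (if c = b then \<Sum>k<?e. rep_mat N x $$ (i, k) * X $$ (c * ?e + k, j) else 0)"
      using transversal_mem_iff[OF ab x g c] x ij ab c by (auto simp: index_induced_rep_along Let_def)
  qed simp
  also have "\<dots> = (\<Sum>k<?e. rep_mat N x $$ (i, k) * X $$ (b * ?e + k, j))"
    using ab by simp
  also have "\<dots> = (rep_mat N x * row_block ?e b X) $$ (i, j)"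
    using ij X Nx by (simp add: index_mult_mat_sum row_block_def)
  finally show "row_block ?e a (?I * X) $$ (i, j) = (rep_mat N x * row_block ?e b X) $$ (i, j)" .
qed (use X subgroup_rep_carrier[OF x] in \<open>auto simp: row_block_def\<close>)

text \<open>The column blocks of the matrix of \<open>g\<close> are read off from those of the
  identity. Multiplicativity is then the cocycle rule
  \<open>g h r_b = g r_a x = r_c (y x)\<close>.\<close>

lemma representation_induced_rep_along: "representation G (induced_rep_along G H rs N)"
proof -
  let ?e = "rep_dim N" and ?r = "length rs"
  let ?I = "rep_mat (induced_rep_along G H rs N)"
  have one: "1\<^sub>m (?r * ?e) \<in> carrier_mat (?r * ?e) (?r * ?e)" by simp
  have I: "?I g \<in> carrier_mat (?r * ?e) (?r * ?e)" for g by simp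
  have col: "col_block ?e b (?I g) = col_block ?e a (1\<^sub>m (?r * ?e)) * rep_mat N x"
    if "a < ?r" "b < ?r" "x \<in> H" "g \<in> carrier G" "g \<otimes> rs ! b = rs ! a \<otimes> x" for a b x g
    using col_block_mult_induced[OF one that] left_mult_one_mat[OF I] by simp
  have "?I \<one> = 1\<^sub>m (?r * ?e)"
  proof (rule eq_mat_col_blockI[OF I one])
    fix b assume b: "b < ?r"
    have "rep_mat N \<one> = 1\<^sub>m ?e" using representation_one[OF N] by simp
    then show "col_block ?e b (?I \<one>) = col_block ?e b (1\<^sub>m (?r * ?e))"
      using col[OF b b subgroup.one_closed[OF H]] transversal_carrier[OF b]
        right_mult_one_mat[OF col_block_carrier[OF one, of ?e b]]
      by simp
  qed
  moreover have "?I (g \<otimes> h) = ?I g * ?I h" if g: "g \<in> carrier G" and h: "h \<in> carrier G" for g h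
  proof (rule eq_mat_col_blockI[OF I])
    show "?I g * ?I h \<in> carrier_mat (?r * ?e) (?r * ?e)" using I by (rule mult_carrier_mat) (rule I)
    fix b assume b: "b < ?r"
    note B = transversal_carrier[OF b]
    obtain a x where a: "a < ?r" "x \<in> H" "h \<otimes> rs ! b = rs ! a \<otimes> x"
      using transversal_index[OF m_closed[OF h B]] .
    note A = transversal_carrier[OF a(1)] subgroup.mem_carrier[OF H a(2)]
    obtain c y where c: "c < ?r" "y \<in> H" "g \<otimes> rs ! a = rs ! c \<otimes> y"
      using transversal_index[OF m_closed[OF g A(1)]] .
    note C = transversal_carrier[OF c(1)] subgroup.mem_carrier[OF H c(2)]
    have yx: "y \<otimes> x \<in> H" using H a c by (simp add: subgroup.m_closed)
    have "g \<otimes> h \<otimes> rs ! b = g \<otimes> rs ! a \<otimes> x" using a g h A B by (simp add: m_assoc)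
    also have "\<dots> = rs ! c \<otimes> (y \<otimes> x)" using c A C by (simp add: m_assoc)
    finally have "col_block ?e b (?I (g \<otimes> h)) = col_block ?e c (1\<^sub>m (?r * ?e)) * rep_mat N (y \<otimes> x)"
      using col[OF c(1) b yx] g h by simp
    also have "rep_mat N (y \<otimes> x) = rep_mat N y * rep_mat N x"
      using representation_mult[OF N, of y x] a c by simp
    also have "col_block ?e c (1\<^sub>m (?r * ?e)) * (rep_mat N y * rep_mat N x) = col_block ?e a (?I g) * rep_mat N x"
      unfolding col[OF c(1) a(1) c(2) g c(3)]
      by (rule assoc_mult_mat[symmetric, OF col_block_carrier[OF one] subgroup_rep_carrier[OF c(2)] subgroup_rep_carrier[OF a(2)]])
    also have "\<dots> = col_block ?e b (?I g * ?I h)"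
      using col_block_mult_induced[OF I a(1) b a(2) h a(3)] by simp
    finally show "col_block ?e b (?I (g \<otimes> h)) = col_block ?e b (?I g * ?I h)" .
  qed
  ultimately show ?thesis by (simp add: representation_def)
qed

context
  fixes M :: "('a, 'k) rep"
  assumes M: "representation G M" and fin: "finite (carrier G)"
begin

text \<open>Frobenius reciprocity: an intertwiner from or to an induced representation is determined
  by one block. Block 0 of \<open>A\<close> and of \<open>B\<close> yields \<open>\<alpha>\<close>
  and \<open>\<beta>\<close>, the other blocks are translates, and the sum of the block products is
  both \<open>A B\<close> and the trace of \<open>\<alpha> \<beta>\<close>.\<close>

lemma retract_induced_imp_trace:
  assumes "retract_of (carrier G) M (induced_rep_along G H rs N)"
  shows "\<exists>\<alpha> \<beta>. intertwiner H N M \<alpha> \<and> intertwiner H M N \<beta> \<and>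
    weighted_trace G (carrier G) M transversal_weight (\<alpha> * \<beta>) = 1\<^sub>m (rep_dim M)"
proof -
  let ?e = "rep_dim N" and ?r = "length rs" and ?d = "rep_dim M"
  let ?I = "rep_mat (induced_rep_along G H rs N)"
  obtain A B where A: "intertwiner (carrier G) (induced_rep_along G H rs N) M A"
    and B: "intertwiner (carrier G) M (induced_rep_along G H rs N) B" and AB: "A * B = 1\<^sub>m ?d"
    using assms by (auto simp: retract_of_def)
  have cA: "A \<in> carrier_mat ?d (?r * ?e)" and cB: "B \<in> carrier_mat (?r * ?e) ?d"
    using A B by (auto simp: intertwiner_def)
  have I: "?I g \<in> carrier_mat (?r * ?e) (?r * ?e)" for g by simp
  obtain a0 where "a0 < ?r" using transversal_index[OF one_closed] by blast
  then have r: "0 < ?r" by (rule le_less_trans[OF le0])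
  \<comment> \<open>The representative \<open>rs ! 0\<close> need not be the identity, so block 0 is
    equivariant only up to conjugation by \<open>s\<close>; the factors
    \<open>rep_mat M (inv s)\<close> and \<open>rep_mat M s\<close> below correct this.\<close>
  define s where "s = rs ! 0"
  have s [simp]: "s \<in> carrier G" using transversal_carrier[OF r] by (simp add: s_def)
  note cM = representation_carrier[OF M]
  have A_block: "col_block ?e a A * rep_mat N x = rep_mat M g * col_block ?e b A"
    if "a < ?r" "b < ?r" "x \<in> H" "g \<in> carrier G" "g \<otimes> rs ! b = rs ! a \<otimes> x" for a b x g
    using col_block_mult_induced[OF cA that] intertwiner_comm[OF A that(4)]
      col_block_mult[OF cM[OF that(4)] cA that(2)] by simp
  have B_block: "rep_mat N x * row_block ?e b B = row_block ?e a B * rep_mat M g"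
    if "a < ?r" "b < ?r" "x \<in> H" "g \<in> carrier G" "g \<otimes> rs ! b = rs ! a \<otimes> x" for a b x g
    using row_block_induced_mult[OF cB that] intertwiner_comm[OF B that(4)]
      row_block_mult[OF cB cM[OF that(4)] that(1)] by simp
  define \<alpha> where "\<alpha> = rep_mat M (inv s) * col_block ?e 0 A"
  define \<beta> where "\<beta> = row_block ?e 0 B * rep_mat M s"
  have c\<alpha>: "\<alpha> \<in> carrier_mat ?d ?e"
    unfolding \<alpha>_def by (rule mult_carrier_mat[OF cM col_block_carrier[OF cA]]) simp
  have c\<beta>: "\<beta> \<in> carrier_mat ?e ?d"
    unfolding \<beta>_def by (rule mult_carrier_mat[OF row_block_carrier[OF cB] cM]) simp
  have MM: "rep_mat M g * (rep_mat M h * X) = rep_mat M (g \<otimes> h) * X"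
    if "g \<in> carrier G" "h \<in> carrier G" "X \<in> carrier_mat ?d n" for g h X n
    using that representation_mult[OF M] assoc_mult_mat[OF cM cM, of g h X n] by simp
  have MM': "X * rep_mat M g * rep_mat M h = X * rep_mat M (g \<otimes> h)"
    if "g \<in> carrier G" "h \<in> carrier G" "X \<in> carrier_mat n ?d" for g h X n
    using that representation_mult[OF M] assoc_mult_mat[OF _ cM cM, of X n g h] by simp
  have \<alpha>: "intertwiner H N M \<alpha>"
    unfolding intertwiner_def
  proof (intro conjI ballI c\<alpha>)
    fix h assume h: "h \<in> H"
    then have hG: "h \<in> carrier G" using H by (simp add: subgroup.mem_carrier)
    have "\<alpha> * rep_mat N h = rep_mat M (inv s) * (col_block ?e 0 A * rep_mat N h)"
      unfolding \<alpha>_def by (rule assoc_mult_mat[OF cM col_block_carrier[OF cA] subgroup_rep_carrier[OF h]]) simp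
    also have "col_block ?e 0 A * rep_mat N h = rep_mat M (s \<otimes> h \<otimes> inv s) * col_block ?e 0 A"
      using A_block[OF r r h, of "s \<otimes> h \<otimes> inv s"] hG by (simp add: s_def[symmetric] m_assoc)
    also have "rep_mat M (inv s) * \<dots> = rep_mat M (inv s \<otimes> (s \<otimes> h \<otimes> inv s)) * col_block ?e 0 A"
      using hG by (intro MM[OF _ _ col_block_carrier[OF cA]]) auto
    also have "inv s \<otimes> (s \<otimes> h \<otimes> inv s) = h \<otimes> inv s" using hG by (simp add: m_assoc[symmetric])
    also have "rep_mat M (h \<otimes> inv s) * col_block ?e 0 A = rep_mat M h * \<alpha>"
      unfolding \<alpha>_def using hG by (intro MM[OF _ _ col_block_carrier[OF cA], symmetric]) auto
    finally show "\<alpha> * rep_mat N h = rep_mat M h * \<alpha>" .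
  qed
  have \<beta>: "intertwiner H M N \<beta>"
    unfolding intertwiner_def
  proof (intro conjI ballI c\<beta>)
    fix h assume h: "h \<in> H"
    then have hG: "h \<in> carrier G" using H by (simp add: subgroup.mem_carrier)
    have "rep_mat N h * \<beta> = rep_mat N h * row_block ?e 0 B * rep_mat M s"
      unfolding \<beta>_def by (rule assoc_mult_mat[symmetric, OF subgroup_rep_carrier[OF h] row_block_carrier[OF cB] cM]) simp
    also have "rep_mat N h * row_block ?e 0 B = row_block ?e 0 B * rep_mat M (s \<otimes> h \<otimes> inv s)"
      using B_block[OF r r h, of "s \<otimes> h \<otimes> inv s"] hG by (simp add: s_def[symmetric] m_assoc)
    also have "\<dots> * rep_mat M s = row_block ?e 0 B * rep_mat M (s \<otimes> h \<otimes> inv s \<otimes> s)"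
      using hG by (intro MM'[OF _ _ row_block_carrier[OF cB]]) auto
    also have "s \<otimes> h \<otimes> inv s \<otimes> s = s \<otimes> h" using hG by (simp add: m_assoc)
    also have "row_block ?e 0 B * rep_mat M (s \<otimes> h) = \<beta> * rep_mat M h"
      unfolding \<beta>_def using hG by (intro MM'[OF _ _ row_block_carrier[OF cB], symmetric]) auto
    finally show "\<beta> * rep_mat M h = rep_mat N h * \<beta>" ..
  qed
  have "col_block ?e a A * row_block ?e a B = conj_mat G M (\<alpha> * \<beta>) (rs ! a)" if a: "a < ?r" for a
  proof -
    note [simp] = transversal_carrier[OF a]
    have N1: "rep_mat N \<one> = 1\<^sub>m ?e" using representation_one[OF N] by simp
    note one = subgroup.one_closed[OF H]
    have "col_block ?e a A = rep_mat M (rs ! a \<otimes> inv s) * col_block ?e 0 A"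
      using A_block[OF a r one, of "rs ! a \<otimes> inv s"] right_mult_one_mat[OF col_block_carrier[OF cA]]
      by (simp add: s_def[symmetric] m_assoc N1)
    also have "\<dots> = rep_mat M (rs ! a) * \<alpha>"
      unfolding \<alpha>_def by (intro MM[OF _ _ col_block_carrier[OF cA], symmetric]) auto
    finally have 1: "col_block ?e a A = rep_mat M (rs ! a) * \<alpha>" .
    have "row_block ?e a B = row_block ?e 0 B * rep_mat M (s \<otimes> inv (rs ! a))"
      using B_block[OF r a one, of "s \<otimes> inv (rs ! a)"] left_mult_one_mat[OF row_block_carrier[OF cB]]
      by (simp add: s_def[symmetric] m_assoc N1)
    also have "\<dots> = \<beta> * rep_mat M (inv (rs ! a))"
      unfolding \<beta>_def by (intro MM'[OF _ _ row_block_carrier[OF cB], symmetric]) auto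
    finally have 2: "row_block ?e a B = \<beta> * rep_mat M (inv (rs ! a))" .
    show ?thesis
      unfolding 1 2 conj_mat_def
      using c\<alpha> c\<beta> cM[of "rs ! a"] cM[of "inv (rs ! a)"]
      by (simp add: assoc_mult_mat[of _ ?d ?e _ ?d _ ?d] assoc_mult_mat[of _ ?d ?d _ ?e _ ?d]
          assoc_mult_mat[of _ ?d ?d _ ?d _ ?d])
  qed
  then have "weighted_trace G (carrier G) M transversal_weight (\<alpha> * \<beta>) = A * B"
    unfolding weighted_trace_transversal[OF fin] mult_mat_blocks[OF cA cB] by (intro lincomb_mat_cong) auto
  then show ?thesis using \<alpha> \<beta> AB by auto
qed

text \<open>The inverse construction: \<open>A\<close> and \<open>B\<close> are glued from the
  translates of \<open>\<alpha>\<close> and \<open>\<beta>\<close> by the coset representatives, and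
  their product is again the trace.\<close>

lemma trace_imp_retract_induced:
  assumes \<alpha>: "intertwiner H N M \<alpha>" and \<beta>: "intertwiner H M N \<beta>"
    and tr: "weighted_trace G (carrier G) M transversal_weight (\<alpha> * \<beta>) = 1\<^sub>m (rep_dim M)"
  shows "retract_of (carrier G) M (induced_rep_along G H rs N)"
proof -
  let ?e = "rep_dim N" and ?r = "length rs" and ?d = "rep_dim M"
  let ?I = "rep_mat (induced_rep_along G H rs N)"
  have I: "?I g \<in> carrier_mat (?r * ?e) (?r * ?e)" for g by simp
  note cM = representation_carrier[OF M]
  have c\<alpha>: "\<alpha> \<in> carrier_mat ?d ?e" and c\<beta>: "\<beta> \<in> carrier_mat ?e ?d"
    using \<alpha> \<beta> by (auto simp: intertwiner_def)
  define A where "A = mat ?d (?r * ?e) (\<lambda>(i, j). (rep_mat M (rs ! (j div ?e)) * \<alpha>) $$ (i, j mod ?e))"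
  define B where "B = mat (?r * ?e) ?d (\<lambda>(i, j). (\<beta> * rep_mat M (inv (rs ! (i div ?e)))) $$ (i mod ?e, j))"
  have cA: "A \<in> carrier_mat ?d (?r * ?e)" and cB: "B \<in> carrier_mat (?r * ?e) ?d" by (auto simp: A_def B_def)
  have colA: "col_block ?e a A = rep_mat M (rs ! a) * \<alpha>" if a: "a < ?r" for a
    by (rule eq_matI) (use block_index_less[OF a] cM[OF transversal_carrier[OF a]] c\<alpha> in
        \<open>auto simp: col_block_def A_def\<close>)
  have rowB: "row_block ?e a B = \<beta> * rep_mat M (inv (rs ! a))" if a: "a < ?r" for a
    by (rule eq_matI) (use block_index_less[OF a] cM[OF inv_closed[OF transversal_carrier[OF a]]] c\<beta> in
        \<open>auto simp: row_block_def B_def\<close>)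
  have MM: "rep_mat M g * (rep_mat M h * X) = rep_mat M (g \<otimes> h) * X"
    if "g \<in> carrier G" "h \<in> carrier G" "X \<in> carrier_mat ?d n" for g h X n
    using that representation_mult[OF M] assoc_mult_mat[OF cM cM, of g h X n] by simp
  have MM': "X * rep_mat M g * rep_mat M h = X * rep_mat M (g \<otimes> h)"
    if "g \<in> carrier G" "h \<in> carrier G" "X \<in> carrier_mat n ?d" for g h X n
    using that representation_mult[OF M] assoc_mult_mat[OF _ cM cM, of X n g h] by simp
  have "intertwiner (carrier G) (induced_rep_along G H rs N) M A"
    unfolding intertwiner_def
  proof (intro conjI ballI)
    fix g assume g: "g \<in> carrier G"
    show "A * ?I g = rep_mat M g * A"
    proof (rule eq_mat_col_blockI[OF mult_carrier_mat[OF cA I] mult_carrier_mat[OF cM[OF g] cA]])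
      fix b assume b: "b < ?r"
      note B = transversal_carrier[OF b]
      obtain a x where a: "a < ?r" "x \<in> H" "g \<otimes> rs ! b = rs ! a \<otimes> x"
        using transversal_index[OF m_closed[OF g B]] .
      note A = transversal_carrier[OF a(1)] subgroup.mem_carrier[OF H a(2)]
      have "col_block ?e b (A * ?I g) = rep_mat M (rs ! a) * \<alpha> * rep_mat N x"
        using col_block_mult_induced[OF cA a(1) b a(2) g a(3)] colA[OF a(1)] by simp
      also have "\<dots> = rep_mat M (rs ! a) * (rep_mat M x * \<alpha>)"
        using assoc_mult_mat[OF cM[OF A(1)] c\<alpha> subgroup_rep_carrier[OF a(2)]] intertwiner_comm[OF \<alpha> a(2)] by simp
      also have "\<dots> = rep_mat M g * (rep_mat M (rs ! b) * \<alpha>)"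
        using MM[OF A c\<alpha>] MM[OF g B c\<alpha>] a(3) by simp
      also have "\<dots> = col_block ?e b (rep_mat M g * A)"
        using col_block_mult[OF cM[OF g] cA b] colA[OF b] by simp
      finally show "col_block ?e b (A * ?I g) = col_block ?e b (rep_mat M g * A)" .
    qed
  qed (use cA in simp)
  moreover have "intertwiner (carrier G) M (induced_rep_along G H rs N) B"
    unfolding intertwiner_def
  proof (intro conjI ballI)
    fix g assume g: "g \<in> carrier G"
    show "B * rep_mat M g = ?I g * B"
    proof (rule eq_mat_row_blockI[OF mult_carrier_mat[OF cB cM[OF g]] mult_carrier_mat[OF I cB]])
      fix a assume a: "a < ?r"
      note A = transversal_carrier[OF a]
      \<comment> \<open>For row blocks the target coset \<open>a\<close> is prescribed, so the
        source \<open>b\<close> is found by applying the inverse of \<open>g\<close>.\<close>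
      obtain b y where b: "b < ?r" "y \<in> H" "inv g \<otimes> rs ! a = rs ! b \<otimes> y"
        using transversal_index[OF m_closed[OF inv_closed[OF g] A]] .
      note B = transversal_carrier[OF b(1)] subgroup.mem_carrier[OF H b(2)]
      define x where "x = inv y"
      have x: "x \<in> H" "x \<in> carrier G" using b(2) H B by (auto simp: x_def subgroup.m_inv_closed)
      have "rs ! a = g \<otimes> (rs ! b \<otimes> y)"
        using b(3)[symmetric] g A by (simp add: m_assoc[symmetric])
      then have gb: "g \<otimes> rs ! b = rs ! a \<otimes> x"
        using g B by (simp add: x_def m_assoc)
      have "row_block ?e a (?I g * B) = rep_mat N x * (\<beta> * rep_mat M (inv (rs ! b)))"
        using row_block_induced_mult[OF cB a b(1) x(1) g gb] rowB[OF b(1)] by simp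
      also have "\<dots> = \<beta> * rep_mat M x * rep_mat M (inv (rs ! b))"
        using assoc_mult_mat[OF subgroup_rep_carrier[OF x(1)] c\<beta> cM[OF inv_closed[OF B(1)]]]
          intertwiner_comm[OF \<beta> x(1)] by simp
      also have "\<dots> = \<beta> * rep_mat M (x \<otimes> inv (rs ! b))"
        by (rule MM'[OF x(2) inv_closed[OF B(1)] c\<beta>])
      also have "x \<otimes> inv (rs ! b) = inv (rs ! a) \<otimes> g"
      proof -
        have "inv (rs ! a) \<otimes> g \<otimes> rs ! b = x"
          using gb g A B x by (simp add: m_assoc) (simp add: m_assoc[symmetric])
        then have "x \<otimes> inv (rs ! b) = inv (rs ! a) \<otimes> g \<otimes> rs ! b \<otimes> inv (rs ! b)" by simp
        then show ?thesis using g A B by (simp add: m_assoc)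
      qed
      also have "\<beta> * rep_mat M (inv (rs ! a) \<otimes> g) = row_block ?e a (B * rep_mat M g)"
        using row_block_mult[OF cB cM[OF g] a] rowB[OF a] MM'[OF inv_closed[OF A] g c\<beta>] by simp
      finally show "row_block ?e a (B * rep_mat M g) = row_block ?e a (?I g * B)" ..
    qed
  qed (use cB in simp)
  moreover have "A * B = 1\<^sub>m ?d"
  proof -
    have "col_block ?e a A * row_block ?e a B = conj_mat G M (\<alpha> * \<beta>) (rs ! a)" if a: "a < ?r" for a
      unfolding colA[OF a] rowB[OF a] conj_mat_def
      using c\<alpha> c\<beta> cM[OF transversal_carrier[OF a]] cM[OF inv_closed[OF transversal_carrier[OF a]]]
      by (simp add: assoc_mult_mat[of _ ?d ?e _ ?d _ ?d] assoc_mult_mat[of _ ?d ?d _ ?e _ ?d]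
          assoc_mult_mat[of _ ?d ?d _ ?d _ ?d])
    then have "A * B = weighted_trace G (carrier G) M transversal_weight (\<alpha> * \<beta>)"
      unfolding weighted_trace_transversal[OF fin] mult_mat_blocks[OF cA cB] by (intro lincomb_mat_cong) auto
    then show ?thesis using tr by simp
  qed
  ultimately show ?thesis by (auto simp: retract_of_def)
qed

end

end

end

lemma some_left_transversal:
  assumes "subgroup H G" "finite (carrier G)"
  shows "left_transversal G H (SOME rs. left_transversal G H rs)"
  by (rule someI_ex[OF left_transversal_exists[OF assms]])

text \<open>A form of Higman's criterion, for a prescribed representation \<open>N\<close> of \<open>H\<close>.\<close>

lemma direct_summand_induced_iff:
  fixes M N :: "('a, 'k::field) rep"
  assumes H: "subgroup H G" and fin: "finite (carrier G)"
    and N: "representation (G\<lparr>carrier := H\<rparr>) N" and M: "representation G M"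
    and w: "coset_weight G (carrier G) H w"
  shows "direct_summand G M (induced_rep G H N) \<longleftrightarrow>
    (\<exists>\<alpha> \<beta>. intertwiner H N M \<alpha> \<and> intertwiner H M N \<beta> \<and>
      weighted_trace G (carrier G) M w (\<alpha> * \<beta>) = 1\<^sub>m (rep_dim M))" (is "?L \<longleftrightarrow> ?R")
proof -
  define rs where "rs = (SOME rs. left_transversal G H rs)"
  have rs: "left_transversal G H rs" unfolding rs_def by (rule some_left_transversal[OF H fin])
  have I: "representation G (induced_rep_along G H rs N)"
    by (rule representation_induced_rep_along[OF H rs N])
  have "?L \<longleftrightarrow> retract_of (carrier G) M (induced_rep_along G H rs N)"
    unfolding induced_rep_def rs_def[symmetric]
    using direct_summand_imp_retract[OF M representation_carrier[OF I]]
      retract_imp_direct_summand[OF monoid_axioms M I] by blast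
  also have "\<dots> \<longleftrightarrow> (\<exists>\<alpha> \<beta>. intertwiner H N M \<alpha> \<and> intertwiner H M N \<beta> \<and>
      weighted_trace G (carrier G) M (transversal_weight rs) (\<alpha> * \<beta>) = 1\<^sub>m (rep_dim M))"
    using retract_induced_imp_trace[OF H rs N M fin] trace_imp_retract_induced[OF H rs N M fin] by blast
  also have "\<dots> \<longleftrightarrow> ?R"
  proof -
    have "weighted_trace G (carrier G) M (transversal_weight rs) (\<alpha> * \<beta>) = weighted_trace G (carrier G) M w (\<alpha> * \<beta>)"
      if "intertwiner H N M \<alpha>" "intertwiner H M N \<beta>" for \<alpha> \<beta>
    proof (rule weighted_trace_unique[OF M _ subgroup_self H subgroup.subset[OF H]])
      show "intertwiner H M M (\<alpha> * \<beta>)"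
        using that representation_carrier[OF M] representation_carrier[OF N] subgroup.mem_carrier[OF H]
        by (intro intertwiner_compose[of H M N]) auto
      show "coset_weight G (carrier G) H (transversal_weight rs :: 'a \<Rightarrow> 'k)"
        by (rule coset_weight_transversal[OF H rs fin])
    qed (rule w)
    then show ?thesis by metis
  qed
  finally show ?thesis .
qed

text \<open>From left to right take \<open>\<theta> = \<alpha> \<beta>\<close>. In the other
  direction induce \<open>M\<close> itself, restricted to \<open>H\<close>, with
  \<open>\<alpha> = 1\<close> and \<open>\<beta> = \<theta>\<close>.\<close>

lemma summand_of_induced_iff:
  fixes M :: "('a, 'k::field) rep"
  assumes H: "subgroup H G" and fin: "finite (carrier G)" and M: "representation G M"
  shows "summand_of_induced G H M \<longleftrightarrow> relatively_projective G H M"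
proof
  obtain w :: "'a \<Rightarrow> 'k" where w: "coset_weight G (carrier G) H w" using coset_weight_exists[OF H fin] by blast
  {
    assume "summand_of_induced G H M"
    then obtain N \<alpha> \<beta> where N: "representation (G\<lparr>carrier := H\<rparr>) N"
      and *: "intertwiner H N M \<alpha>" "intertwiner H M N \<beta>"
      and tr: "weighted_trace G (carrier G) M w (\<alpha> * \<beta>) = 1\<^sub>m (rep_dim M)"
      unfolding summand_of_induced_def using direct_summand_induced_iff[OF H fin _ M w] by blast
    have "intertwiner H M M (\<alpha> * \<beta>)"
      using * representation_carrier[OF M] representation_carrier[OF N] subgroup.mem_carrier[OF H]
      by (intro intertwiner_compose[of H M N]) auto
    then show "relatively_projective G H M" using w tr unfolding relatively_projective_def by blast
  next
    assume "relatively_projective G H M"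
    then obtain \<theta> v where \<theta>: "intertwiner H M M \<theta>" and v: "coset_weight G (carrier G) H v"
      and tr: "weighted_trace G (carrier G) M v \<theta> = 1\<^sub>m (rep_dim M)"
      by (auto simp: relatively_projective_def)
    have c: "\<theta> \<in> carrier_mat (rep_dim M) (rep_dim M)" using \<theta> by (simp add: intertwiner_def)
    have "intertwiner H M M (1\<^sub>m (rep_dim M))"
      using left_mult_one_mat[OF representation_carrier[OF M]] right_mult_one_mat[OF representation_carrier[OF M]]
        subgroup.mem_carrier[OF H]
      by (auto simp: intertwiner_def)
    moreover have "1\<^sub>m (rep_dim M) * \<theta> = \<theta>" using c by simp
    moreover have N: "representation (G\<lparr>carrier := H\<rparr>) M"
      by (rule representation_subgroup[OF M subgroup.subset[OF H]])
    ultimately have "direct_summand G M (induced_rep G H M)"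
      using direct_summand_induced_iff[OF H fin N M v] \<theta> tr by metis
    then show "summand_of_induced G H M" using N by (auto simp: summand_of_induced_def)
  }
qed

end

section \<open>Kronecker products\<close>

lemma kronecker_carrier [simp]:
  "A \<in> carrier_mat a b \<Longrightarrow> B \<in> carrier_mat c d \<Longrightarrow> kronecker A B \<in> carrier_mat (a * c) (b * d)"
  by (simp add: kronecker_def)

lemma index_kronecker:
  assumes "A \<in> carrier_mat a b" "B \<in> carrier_mat c d" "i < a * c" "j < b * d"
  shows "kronecker A B $$ (i, j) = A $$ (i div c, j div d) * B $$ (i mod c, j mod d)"
  using assms by (simp add: kronecker_def)

lemma index_kronecker_blocks:
  assumes "A \<in> carrier_mat a b" "B \<in> carrier_mat c d" "v < a" "w < c" "v' < b" "w' < d"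
  shows "kronecker A B $$ (v * c + w, v' * d + w') = A $$ (v, v') * B $$ (w, w')"
  using assms block_index_less[of v a w c] block_index_less[of v' b w' d]
  by (simp add: index_kronecker)

lemma kronecker_mult:
  fixes A B A' B' :: "'k::field mat"
  assumes A: "A \<in> carrier_mat a b" and B: "B \<in> carrier_mat c d"
    and A': "A' \<in> carrier_mat b a'" and B': "B' \<in> carrier_mat d c'"
  shows "kronecker A B * kronecker A' B' = kronecker (A * A') (B * B')"
proof (rule eq_matI)
  have c: "kronecker A B \<in> carrier_mat (a * c) (b * d)" "kronecker A' B' \<in> carrier_mat (b * d) (a' * c')"
    "kronecker (A * A') (B * B') \<in> carrier_mat (a * c) (a' * c')"
    using assms by auto
  show "dim_row (kronecker A B * kronecker A' B') = dim_row (kronecker (A * A') (B * B'))"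
    "dim_col (kronecker A B * kronecker A' B') = dim_col (kronecker (A * A') (B * B'))"
    using c by auto
  fix i j assume "i < dim_row (kronecker (A * A') (B * B'))" "j < dim_col (kronecker (A * A') (B * B'))"
  then have ij: "i < a * c" "j < a' * c'" using c(3) by auto
  note i = div_mod_less[OF ij(1)] and j = div_mod_less[OF ij(2)]
  have "(kronecker A B * kronecker A' B') $$ (i, j)
      = (\<Sum>x<b. \<Sum>y<d. kronecker A B $$ (i, x * d + y) * kronecker A' B' $$ (x * d + y, j))"
    using c ij by (simp add: index_mult_mat_sum sum_blocks)
  also have "\<dots> = (\<Sum>x<b. \<Sum>y<d. (A $$ (i div c, x) * A' $$ (x, j div c')) * (B $$ (i mod c, y) * B' $$ (y, j mod c')))"
    using assms ij by (intro sum.cong) (simp_all add: index_kronecker[of _ a b _ c d] index_kronecker[of _ b a' _ d c'] block_index_less)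
  also have "\<dots> = (\<Sum>x<b. A $$ (i div c, x) * A' $$ (x, j div c')) * (\<Sum>y<d. B $$ (i mod c, y) * B' $$ (y, j mod c'))"
    by (simp add: sum_product)
  also have "\<dots> = (A * A') $$ (i div c, j div c') * (B * B') $$ (i mod c, j mod c')"
    using assms i j by (simp add: index_mult_mat_sum)
  also have "\<dots> = kronecker (A * A') (B * B') $$ (i, j)"
    using assms ij by (subst index_kronecker[of _ a a' _ c c']) auto
  finally show "(kronecker A B * kronecker A' B') $$ (i, j) = kronecker (A * A') (B * B') $$ (i, j)" .
qed

lemma kronecker_one: "kronecker (1\<^sub>m a) (1\<^sub>m b) = (1\<^sub>m (a * b) :: 'k::field mat)"
proof (rule eq_matI)
  fix i j assume "i < dim_row (1\<^sub>m (a * b) :: 'k mat)" "j < dim_col (1\<^sub>m (a * b) :: 'k mat)"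
  then have ij: "i < a * b" "j < a * b" by auto
  have "i = j \<longleftrightarrow> i div b = j div b \<and> i mod b = j mod b" by (metis div_mult_mod_eq)
  then show "kronecker (1\<^sub>m a) (1\<^sub>m b) $$ (i, j) = (1\<^sub>m (a * b) :: 'k mat) $$ (i, j)"
    using ij div_mod_less[OF ij(1)] div_mod_less[OF ij(2)] by (auto simp: index_kronecker[of _ a a _ b b])
qed (simp_all add: kronecker_def)

lemma kronecker_one_right: "kronecker A (1\<^sub>m 1) = A"
  by (rule eq_matI) (simp_all add: kronecker_def)

lemma kronecker_zero_left: "B \<in> carrier_mat c d \<Longrightarrow> kronecker (0\<^sub>m a b) B = 0\<^sub>m (a * c) (b * d)"
  by (rule eq_matI) (auto simp: kronecker_def div_mod_less)

text \<open>The basis of a tensor product is numbered \<open>v * m + w\<close>. Fixing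
  \<open>w\<close> gives a stride of step \<open>m\<close>, fixing \<open>v\<close> a contiguous
  block. Strides are compatible with matrices \<open>kronecker P 1\<close>, blocks with
  \<open>kronecker 1 Q\<close>.\<close>

definition col_stride :: "nat \<Rightarrow> nat \<Rightarrow> nat \<Rightarrow> 'k::field mat \<Rightarrow> 'k mat" where
  "col_stride n m w X = mat (dim_row X) n (\<lambda>(i, v). X $$ (i, v * m + w))"

definition row_stride :: "nat \<Rightarrow> nat \<Rightarrow> nat \<Rightarrow> 'k::field mat \<Rightarrow> 'k mat" where
  "row_stride n m w X = mat n (dim_col X) (\<lambda>(v, j). X $$ (v * m + w, j))"

lemma col_stride_carrier [simp]: "X \<in> carrier_mat k l \<Longrightarrow> col_stride n m w X \<in> carrier_mat k n"
  by (simp add: col_stride_def)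

lemma row_stride_carrier [simp]: "X \<in> carrier_mat l k \<Longrightarrow> row_stride n m w X \<in> carrier_mat n k"
  by (simp add: row_stride_def)

lemma col_stride_mult:
  assumes "X \<in> carrier_mat k l" "Y \<in> carrier_mat l (n * m)" "w < m"
  shows "col_stride n m w (X * Y) = X * col_stride n m w Y"
  by (rule eq_matI)
    (use assms block_index_less[OF _ assms(3)] in \<open>auto simp: col_stride_def index_mult_mat_sum\<close>)

lemma row_stride_mult:
  assumes "X \<in> carrier_mat (n * m) l" "Y \<in> carrier_mat l k" "w < m"
  shows "row_stride n m w (X * Y) = row_stride n m w X * Y"
  by (rule eq_matI)
    (use assms block_index_less[OF _ assms(3)] in \<open>auto simp: row_stride_def index_mult_mat_sum\<close>)

lemma col_stride_mult_kronecker: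
  assumes X: "X \<in> carrier_mat k (n * m)" and P: "P \<in> carrier_mat n n" and w: "w < m"
  shows "col_stride n m w (X * kronecker P (1\<^sub>m m)) = col_stride n m w X * P"
proof (rule eq_matI)
  have K: "kronecker P (1\<^sub>m m) \<in> carrier_mat (n * m) (n * m)" using P by simp
  fix i v assume "i < dim_row (col_stride n m w X * P)" "v < dim_col (col_stride n m w X * P)"
  then have iv: "i < k" "v < n" using X P by (auto simp: col_stride_def)
  have "col_stride n m w (X * kronecker P (1\<^sub>m m)) $$ (i, v)
      = (\<Sum>a<n. \<Sum>b<m. X $$ (i, a * m + b) * kronecker P (1\<^sub>m m) $$ (a * m + b, v * m + w))"
    using iv X K block_index_less[OF iv(2) w]
    by (simp add: col_stride_def index_mult_mat_sum sum_blocks)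
  also have "\<dots> = (\<Sum>a<n. \<Sum>b<m. if b = w then X $$ (i, a * m + b) * P $$ (a, v) else 0)"
    using iv w P by (intro sum.cong) (auto simp: index_kronecker_blocks[of _ n n _ m m])
  also have "\<dots> = (\<Sum>a<n. X $$ (i, a * m + w) * P $$ (a, v))" using w by simp
  also have "\<dots> = (col_stride n m w X * P) $$ (i, v)"
    using iv X P by (simp add: col_stride_def index_mult_mat_sum)
  finally show "col_stride n m w (X * kronecker P (1\<^sub>m m)) $$ (i, v) = (col_stride n m w X * P) $$ (i, v)" .
qed (use X P in \<open>auto simp: col_stride_def\<close>)

lemma row_stride_kronecker_mult:
  assumes X: "X \<in> carrier_mat (n * m) k" and P: "P \<in> carrier_mat n n" and w: "w < m"
  shows "row_stride n m w (kronecker P (1\<^sub>m m) * X) = P * row_stride n m w X"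
proof (rule eq_matI)
  have K: "kronecker P (1\<^sub>m m) \<in> carrier_mat (n * m) (n * m)" using P by simp
  fix v j assume "v < dim_row (P * row_stride n m w X)" "j < dim_col (P * row_stride n m w X)"
  then have vj: "v < n" "j < k" using X P by (auto simp: row_stride_def)
  have "row_stride n m w (kronecker P (1\<^sub>m m) * X) $$ (v, j)
      = (\<Sum>a<n. \<Sum>b<m. kronecker P (1\<^sub>m m) $$ (v * m + w, a * m + b) * X $$ (a * m + b, j))"
    using vj X K block_index_less[OF vj(1) w]
    by (simp add: row_stride_def index_mult_mat_sum sum_blocks)
  also have "\<dots> = (\<Sum>a<n. \<Sum>b<m. if b = w then P $$ (v, a) * X $$ (a * m + b, j) else 0)"
    using vj w P by (intro sum.cong) (auto simp: index_kronecker_blocks[of _ n n _ m m])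
  also have "\<dots> = (\<Sum>a<n. P $$ (v, a) * X $$ (a * m + w, j))" using w by simp
  also have "\<dots> = (P * row_stride n m w X) $$ (v, j)"
    using vj X P by (simp add: row_stride_def index_mult_mat_sum)
  finally show "row_stride n m w (kronecker P (1\<^sub>m m) * X) $$ (v, j) = (P * row_stride n m w X) $$ (v, j)" .
qed (use X P in \<open>auto simp: row_stride_def\<close>)

lemma col_block_mult_kronecker:
  assumes X: "X \<in> carrier_mat k (n * m)" and Q: "Q \<in> carrier_mat m m" and v: "v < n"
  shows "col_block m v (X * kronecker (1\<^sub>m n) Q) = col_block m v X * Q"
proof (rule eq_matI)
  have K: "kronecker (1\<^sub>m n) Q \<in> carrier_mat (n * m) (n * m)" using Q by simp
  fix i w assume "i < dim_row (col_block m v X * Q)" "w < dim_col (col_block m v X * Q)"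
  then have iw: "i < k" "w < m" using X Q by (auto simp: col_block_def)
  have "col_block m v (X * kronecker (1\<^sub>m n) Q) $$ (i, w)
      = (\<Sum>a<n. \<Sum>b<m. X $$ (i, a * m + b) * kronecker (1\<^sub>m n) Q $$ (a * m + b, v * m + w))"
    using iw X K block_index_less[OF v iw(2)]
    by (simp add: col_block_def index_mult_mat_sum sum_blocks)
  also have "\<dots> = (\<Sum>a<n. if a = v then \<Sum>b<m. X $$ (i, a * m + b) * Q $$ (b, w) else 0)"
    using iw v Q by (intro sum.cong) (auto simp: index_kronecker_blocks[of _ n n _ m m])
  also have "\<dots> = (\<Sum>b<m. X $$ (i, v * m + b) * Q $$ (b, w))" using v by simp
  also have "\<dots> = (col_block m v X * Q) $$ (i, w)"
    using iw X Q by (simp add: col_block_def index_mult_mat_sum)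
  finally show "col_block m v (X * kronecker (1\<^sub>m n) Q) $$ (i, w) = (col_block m v X * Q) $$ (i, w)" .
qed (use X Q in \<open>auto simp: col_block_def\<close>)

lemma row_block_kronecker_mult:
  assumes X: "X \<in> carrier_mat (n * m) k" and Q: "Q \<in> carrier_mat m m" and v: "v < n"
  shows "row_block m v (kronecker (1\<^sub>m n) Q * X) = Q * row_block m v X"
proof (rule eq_matI)
  have K: "kronecker (1\<^sub>m n) Q \<in> carrier_mat (n * m) (n * m)" using Q by simp
  fix w j assume "w < dim_row (Q * row_block m v X)" "j < dim_col (Q * row_block m v X)"
  then have wj: "w < m" "j < k" using X Q by (auto simp: row_block_def)
  have "row_block m v (kronecker (1\<^sub>m n) Q * X) $$ (w, j)
      = (\<Sum>a<n. \<Sum>b<m. kronecker (1\<^sub>m n) Q $$ (v * m + w, a * m + b) * X $$ (a * m + b, j))"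
    using wj X K block_index_less[OF v wj(1)]
    by (simp add: row_block_def index_mult_mat_sum sum_blocks)
  also have "\<dots> = (\<Sum>a<n. if a = v then \<Sum>b<m. Q $$ (w, b) * X $$ (a * m + b, j) else 0)"
    using wj v Q by (intro sum.cong) (auto simp: index_kronecker_blocks[of _ n n _ m m])
  also have "\<dots> = (\<Sum>b<m. Q $$ (w, b) * X $$ (v * m + b, j))" using v by simp
  also have "\<dots> = (Q * row_block m v X) $$ (w, j)"
    using wj X Q by (simp add: row_block_def index_mult_mat_sum)
  finally show "row_block m v (kronecker (1\<^sub>m n) Q * X) $$ (w, j) = (Q * row_block m v X) $$ (w, j)" .
qed (use X Q in \<open>auto simp: row_block_def\<close>)

text \<open>
  Reshape the entries of \<open>B * A\<close> into a matrix whose columns are the strided blocks and whose rows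
  are the contiguous blocks; a generalized inverse \<open>C\<close> of it satisfies \<open>R = R C R\<close>.
\<close>

lemma mult_as_kronecker_sum:
  fixes A B :: "'k::field mat"
  assumes A: "A \<in> carrier_mat d (n * m)" and B: "B \<in> carrier_mat (n * m) d"
  shows "\<exists>C. B * A = lincomb_mat (n * m) (n * m) (({..<m} \<times> {..<m}) \<times> ({..<n} \<times> {..<n})) C
    (\<lambda>((w, w'), (v, v')). kronecker (row_stride n m w B * col_stride n m w' A) (row_block m v B * col_block m v' A))"
proof -
  \<comment> \<open>Under this rearrangement Kronecker products correspond to matrices of rank at
    most one. The columns of \<open>R\<close>, read as square matrices, are the
    \<open>e w w'\<close>, and its rows are the \<open>f v v'\<close>.\<close>
  define R where "R = (\<lambda>(v, v') (w, w'). (B * A) $$ (v * m + w, v' * m + w'))"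
  define e where "e w w' = row_stride n m w B * col_stride n m w' A" for w w'
  define f where "f v v' = row_block m v B * col_block m v' A" for v v'
  have ce: "e w w' \<in> carrier_mat n n" and cf: "f v v' \<in> carrier_mat m m" for w w' v v'
    unfolding e_def f_def
    by (rule mult_carrier_mat[OF row_stride_carrier[OF B] col_stride_carrier[OF A]],
        rule mult_carrier_mat[OF row_block_carrier[OF B] col_block_carrier[OF A]])
  have eR: "e w w' $$ (v, v') = R (v, v') (w, w')" and fR: "f v v' $$ (w, w') = R (v, v') (w, w')"
    if "v < n" "v' < n" "w < m" "w' < m" for v v' w w'
    using that A B block_index_less[OF that(1,3)] block_index_less[OF that(2,4)]
    by (simp_all add: e_def f_def R_def row_stride_def col_stride_def row_block_def col_block_def
        index_mult_mat_sum)
  obtain C where C: "\<And>p q. p \<in> {..<n} \<times> {..<n} \<Longrightarrow> q \<in> {..<m} \<times> {..<m} \<Longrightarrow>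
      R p q = (\<Sum>(a, b)\<in>({..<m} \<times> {..<m}) \<times> ({..<n} \<times> {..<n}). C a b * R p a * R b q)"
    using generalized_inverse[of "{..<n} \<times> {..<n}" "{..<m} \<times> {..<m}" R] by auto
  have "B * A = lincomb_mat (n * m) (n * m) (({..<m} \<times> {..<m}) \<times> ({..<n} \<times> {..<n})) (\<lambda>(a, b). C a b)
    (\<lambda>((w, w'), (v, v')). kronecker (e w w') (f v v'))"
    (is "_ = ?L")
  proof (rule eq_matI)
    fix i j assume "i < dim_row ?L" "j < dim_col ?L"
    then have ij: "i < n * m" "j < n * m" by auto
    let ?p = "(i div m, j div m)" and ?q = "(i mod m, j mod m)"
    note i = div_mod_less[OF ij(1)] and j = div_mod_less[OF ij(2)]
    have "(B * A) $$ (i, j) = R ?p ?q" by (simp add: R_def)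
    also have "\<dots> = (\<Sum>(a, b)\<in>({..<m} \<times> {..<m}) \<times> ({..<n} \<times> {..<n}). C a b * R ?p a * R b ?q)"
      using i j by (intro C) auto
    also have "\<dots> = (\<Sum>x\<in>({..<m} \<times> {..<m}) \<times> ({..<n} \<times> {..<n}). (case x of (a, b) \<Rightarrow> C a b) *
        (\<lambda>((w, w'), v, v'). kronecker (e w w') (f v v')) x $$ (i, j))"
      using i j ij by (intro sum.cong) (auto simp: index_kronecker[OF ce cf] eR fR)
    also have "\<dots> = ?L $$ (i, j)" by (rule lincomb_mat_index[OF ij, symmetric])
    finally show "(B * A) $$ (i, j) = ?L $$ (i, j)" .
  qed (use A B in auto)
  then show ?thesis unfolding e_def f_def by (intro exI[of _ "\<lambda>(a, b). C a b"])
qed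

section \<open>Young subgroups\<close>

lemma finite_sym_group: "finite (carrier (sym_group n))"
  by (simp add: sym_group_def finite_permutations)

lemma young_subgroup_subset: "young_subgroup \<mu> \<subseteq> carrier (sym_group (sum_list \<mu>))"
  by (auto simp: young_subgroup_def sym_group_carrier)

lemma subgroup_young: "subgroup (young_subgroup \<mu>) (sym_group (sum_list \<mu>))"
proof (rule group.subgroupI[OF sym_group_is_group young_subgroup_subset])
  show "young_subgroup \<mu> \<noteq> {}" using permutes_id by (auto simp: young_subgroup_def intro!: exI[of _ id])
next
  fix \<sigma> assume s: "\<sigma> \<in> young_subgroup \<mu>"
  then have p: "\<sigma> permutes {1..sum_list \<mu>}" by (simp add: young_subgroup_def)
  have "inv' \<sigma> ` block \<mu> i = block \<mu> i" if "i < length \<mu>" for i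
  proof -
    have "inv' \<sigma> ` block \<mu> i = inv' \<sigma> ` (\<sigma> ` block \<mu> i)" using s that by (simp add: young_subgroup_def)
    also have "\<dots> = block \<mu> i" using permutes_inj[OF p] by (simp add: image_comp)
    finally show ?thesis .
  qed
  then show "inv\<^bsub>sym_group (sum_list \<mu>)\<^esub> \<sigma> \<in> young_subgroup \<mu>"
    using permutes_inv[OF p] p by (simp add: sym_group_carrier young_subgroup_def)
next
  fix \<sigma> \<tau> assume st: "\<sigma> \<in> young_subgroup \<mu>" "\<tau> \<in> young_subgroup \<mu>"
  then have "(\<sigma> \<circ> \<tau>) ` block \<mu> i = block \<mu> i" if "i < length \<mu>" for i
    using that unfolding image_comp[symmetric] by (simp add: young_subgroup_def)
  then show "\<sigma> \<otimes>\<^bsub>sym_group (sum_list \<mu>)\<^esub> \<tau> \<in> young_subgroup \<mu>"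
    using st by (simp add: young_subgroup_def sym_group_mult permutes_compose)
qed

lemma young_component_permutes:
  assumes "\<sigma> \<in> young_subgroup \<mu>" "k < length \<mu>"
  shows "young_component \<mu> k \<sigma> permutes {1..\<mu> ! k}"
proof (rule bij_imp_permutes)
  have img: "\<sigma> ` block \<mu> k = block \<mu> k" and inj: "inj \<sigma>"
    using assms permutes_inj by (auto simp: young_subgroup_def)
  have shift: "(\<lambda>x. x + offset \<mu> k) ` {1..\<mu> ! k} = block \<mu> k"
    by (simp add: block_def add.commute image_add_atLeastAtMost')
  have "bij_betw (\<lambda>x. x + offset \<mu> k) {1..\<mu> ! k} (block \<mu> k)"
    using shift by (auto simp: bij_betw_def inj_on_def)
  moreover have "bij_betw \<sigma> (block \<mu> k) (block \<mu> k)"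
    using img inj by (auto simp: bij_betw_def inj_on_def)
  moreover have "bij_betw (\<lambda>x. x - offset \<mu> k) (block \<mu> k) {1..\<mu> ! k}"
    by (rule bij_betw_byWitness[where f' = "\<lambda>x. x + offset \<mu> k"]) (auto simp: block_def)
  ultimately have "bij_betw ((\<lambda>x. x - offset \<mu> k) \<circ> \<sigma> \<circ> (\<lambda>x. x + offset \<mu> k)) {1..\<mu> ! k} {1..\<mu> ! k}"
    by (metis bij_betw_trans)
  then show "bij_betw (young_component \<mu> k \<sigma>) {1..\<mu> ! k} {1..\<mu> ! k}"
    by (rule bij_betw_cong[THEN iffD1, rotated]) (simp add: young_component_def)
  fix x assume "x \<notin> {1..\<mu> ! k}"
  then show "young_component \<mu> k \<sigma> x = x" unfolding young_component_def by (rule if_not_P)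
qed

lemma young_component_comp:
  assumes "\<tau> \<in> young_subgroup \<mu>" "k < length \<mu>"
  shows "young_component \<mu> k (\<sigma> \<circ> \<tau>) = young_component \<mu> k \<sigma> \<circ> young_component \<mu> k \<tau>"
proof
  fix x
  show "young_component \<mu> k (\<sigma> \<circ> \<tau>) x = (young_component \<mu> k \<sigma> \<circ> young_component \<mu> k \<tau>) x"
  proof (cases "x \<in> {1..\<mu> ! k}")
    case True
    then have "x + offset \<mu> k \<in> block \<mu> k" by (auto simp: block_def)
    then have "\<tau> (x + offset \<mu> k) \<in> block \<mu> k" using assms by (auto simp: young_subgroup_def)
    then show ?thesis using True by (auto simp: young_component_def block_def)
  qed (auto simp: young_component_def)
qed

lemma young_component_id: "young_component \<mu> k id = id"
  by (auto simp: young_component_def)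

lemma block_pair: "block [i, j] 0 = {1..i}" "block [i, j] (Suc 0) = {i + 1..i + j}"
  by (simp_all add: block_def offset_def)

text \<open>It suffices to preserve the first block, since the second is its complement.\<close>

lemma young_subgroup_pair:
  "\<sigma> \<in> young_subgroup [i, j] \<longleftrightarrow> \<sigma> permutes {1..i + j} \<and> \<sigma> ` {1..i} = {1..i}"
proof -
  have "\<sigma> ` {i + 1..i + j} = {i + 1..i + j}" if s: "\<sigma> permutes {1..i + j}" "\<sigma> ` {1..i} = {1..i}"
  proof -
    have eq: "{i + 1..i + j} = {1..i + j} - {1..i}" by auto
    show ?thesis
      unfolding eq image_set_diff[OF permutes_inj[OF s(1)]] using s(2) permutes_image[OF s(1)] by simp
  qed
  moreover have "(\<forall>k<length [i, j]. P k) \<longleftrightarrow> P 0 \<and> P (Suc 0)" for P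
    by (auto simp: less_Suc_eq)
  ultimately show ?thesis unfolding young_subgroup_def by (auto simp only: block_pair mem_Collect_eq sum_list.Cons sum_list.Nil add_0_right)
qed

section \<open>External tensor products over \<open>S_i \<times> S_j\<close>\<close>

lemma rep_dim_outer_tensor_pair [simp]: "rep_dim (outer_tensor [i, j] [V, W]) = rep_dim V * rep_dim W"
  by (simp add: outer_tensor_def)

lemma young_component_pair_permutes:
  assumes "\<sigma> \<in> young_subgroup [i, j]"
  shows "young_component [i, j] 0 \<sigma> \<in> carrier (sym_group i)"
    "young_component [i, j] (Suc 0) \<sigma> \<in> carrier (sym_group j)"
  using young_component_permutes[OF assms, of 0] young_component_permutes[OF assms, of "Suc 0"]
  by (auto simp: sym_group_carrier)

lemma outer_tensor_pair:
  "rep_mat (outer_tensor [i, j] [V, W]) \<sigma> = kronecker (rep_mat V (young_component [i, j] 0 \<sigma>))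
     (rep_mat W (young_component [i, j] (Suc 0) \<sigma>))"
  by (simp add: outer_tensor_def kronecker_one_right[simplified])

lemma outer_tensor_pair_carrier:
  assumes "representation (sym_group i) V" "representation (sym_group j) W" "\<sigma> \<in> young_subgroup [i, j]"
  shows "rep_mat (outer_tensor [i, j] [V, W]) \<sigma>
    \<in> carrier_mat (rep_dim V * rep_dim W) (rep_dim V * rep_dim W)"
  unfolding outer_tensor_pair
  by (intro kronecker_carrier representation_carrier[OF assms(1)] representation_carrier[OF assms(2)]
      young_component_pair_permutes[OF assms(3)])

lemma representation_outer_tensor_pair:
  assumes V: "representation (sym_group i) V" and W: "representation (sym_group j) W"
  shows "representation (young_group [i, j]) (outer_tensor [i, j] [V, W])"
proof -
  have 1: "rep_mat V id = 1\<^sub>m (rep_dim V)" "rep_mat W id = 1\<^sub>m (rep_dim W)"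
    using representation_one[OF V] representation_one[OF W] by (simp_all add: sym_group_one)
  have "rep_mat (outer_tensor [i, j] [V, W]) (\<sigma> \<circ> \<tau>)
      = rep_mat (outer_tensor [i, j] [V, W]) \<sigma> * rep_mat (outer_tensor [i, j] [V, W]) \<tau>"
    if s: "\<sigma> \<in> young_subgroup [i, j]" and t: "\<tau> \<in> young_subgroup [i, j]" for \<sigma> \<tau>
  proof -
    note s' = young_component_pair_permutes[OF s] and t' = young_component_pair_permutes[OF t]
    show ?thesis
      unfolding outer_tensor_pair
        kronecker_mult[OF representation_carrier[OF V s'(1)] representation_carrier[OF W s'(2)]
          representation_carrier[OF V t'(1)] representation_carrier[OF W t'(2)]]
      using representation_mult[OF V s'(1) t'(1)] representation_mult[OF W s'(2) t'(2)] young_component_comp[OF t, of _ \<sigma>]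
      by (simp add: sym_group_mult)
  qed
  moreover have "rep_mat (outer_tensor [i, j] [V, W]) id = 1\<^sub>m (rep_dim V * rep_dim W)"
    unfolding outer_tensor_pair young_component_id 1 by (rule kronecker_one)
  ultimately show ?thesis
    using outer_tensor_pair_carrier[OF V W] by (simp add: representation_def sym_group_mult sym_group_one)
qed

lemma intertwiner_outer_tensor:
  assumes V: "representation (sym_group i) V" and W: "representation (sym_group j) W"
    and V': "representation (sym_group i) V'" and W': "representation (sym_group j) W'"
    and P: "intertwiner (carrier (sym_group i)) V V' P" and Q: "intertwiner (carrier (sym_group j)) W W' Q"
  shows "intertwiner (young_subgroup [i, j]) (outer_tensor [i, j] [V, W]) (outer_tensor [i, j] [V', W']) (kronecker P Q)"
  unfolding intertwiner_def
proof (intro conjI ballI)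
  show "kronecker P Q \<in> carrier_mat (rep_dim (outer_tensor [i, j] [V', W'])) (rep_dim (outer_tensor [i, j] [V, W]))"
    using P Q by (simp add: intertwiner_def)
  fix \<sigma> assume "\<sigma> \<in> young_subgroup [i, j]"
  note s = young_component_pair_permutes[OF this]
  show "kronecker P Q * rep_mat (outer_tensor [i, j] [V, W]) \<sigma> = rep_mat (outer_tensor [i, j] [V', W']) \<sigma> * kronecker P Q"
    unfolding outer_tensor_pair
      kronecker_mult[OF intertwiner_carrier[OF P] intertwiner_carrier[OF Q] representation_carrier[OF V s(1)] representation_carrier[OF W s(2)]]
      kronecker_mult[OF representation_carrier[OF V' s(1)] representation_carrier[OF W' s(2)] intertwiner_carrier[OF P] intertwiner_carrier[OF Q]]
    by (simp only: intertwiner_comm[OF P s(1)] intertwiner_comm[OF Q s(2)])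
qed

lemma first_block_embedding:
  assumes "\<sigma> permutes {1..i}"
  shows "\<sigma> \<in> young_subgroup [i, j]" "young_component [i, j] 0 \<sigma> = \<sigma>" "young_component [i, j] (Suc 0) \<sigma> = id"
proof -
  show "\<sigma> \<in> young_subgroup [i, j]"
    using permutes_subset[OF assms, of "{1..i + j}"] permutes_image[OF assms] by (auto simp: young_subgroup_pair)
  show "young_component [i, j] 0 \<sigma> = \<sigma>"
    using permutes_not_in[OF assms] by (auto simp: young_component_def offset_def)
  show "young_component [i, j] (Suc 0) \<sigma> = id"
    using permutes_not_in[OF assms] by (auto simp: young_component_def offset_def)
qed

text \<open>Carries \<open>{1..j}\<close> onto the second block of \<open>[i, j]\<close>.
  Restriction within the system is to permutations of an initial segment, so the second factor
  \<open>S_j\<close> is reached by conjugating with this permutation, whose inverse is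
  \<open>block_swap j i\<close>.\<close>

definition block_swap :: "nat \<Rightarrow> nat \<Rightarrow> nat \<Rightarrow> nat" where
  "block_swap i j x = (if x \<in> {1..j} then x + i else if x \<in> {j + 1..i + j} then x - j else x)"

lemma block_swap_permutes: "block_swap i j permutes {1..i + j}"
proof (rule bij_imp_permutes)
  show "bij_betw (block_swap i j) {1..i + j} {1..i + j}"
    by (rule bij_betw_byWitness[where f' = "block_swap j i"]) (auto simp: block_swap_def)
qed (auto simp: block_swap_def)

lemma second_block_embedding:
  fixes i j :: nat
  assumes s: "\<sigma> permutes {1..j}"
  defines "\<rho> \<equiv> block_swap i j \<circ> \<sigma> \<circ> inv' (block_swap i j)"
  shows "\<rho> \<in> young_subgroup [i, j]" "young_component [i, j] 0 \<rho> = id" "young_component [i, j] (Suc 0) \<rho> = \<sigma>"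
proof -
  note t = block_swap_permutes[of i j]
  have inv1: "inv' (block_swap i j) x = x + j" if "x \<in> {1..i}" for x
    using permutes_inverses(2)[OF t, of "x + j"] that by (auto simp: block_swap_def)
  have inv2: "inv' (block_swap i j) (x + i) = x" if "x \<in> {1..j}" for x
    using permutes_inverses(2)[OF t, of x] that by (auto simp: block_swap_def)
  have r1: "\<rho> x = x" if "x \<in> {1..i}" for x
    using that permutes_not_in[OF s, of "x + j"] by (auto simp: \<rho>_def inv1 block_swap_def)
  have r2: "\<rho> (x + i) = \<sigma> x + i" if x: "x \<in> {1..j}" for x
  proof -
    have "\<sigma> x \<in> {1..j}" using x permutes_in_image[OF s] by blast
    then show ?thesis using inv2[OF x] by (simp add: \<rho>_def block_swap_def)
  qed
  have "\<sigma> permutes {1..i + j}" using permutes_subset[OF s] by auto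
  then have "\<rho> permutes {1..i + j}"
    unfolding \<rho>_def using t by (intro permutes_compose permutes_inv)
  moreover have "\<rho> ` {1..i} = {1..i}" using r1 by (auto simp: image_iff)
  ultimately show "\<rho> \<in> young_subgroup [i, j]" by (simp add: young_subgroup_pair)
  show "young_component [i, j] 0 \<rho> = id" using r1 by (auto simp: young_component_def offset_def)
  show "young_component [i, j] (Suc 0) \<rho> = \<sigma>"
    using r2 permutes_not_in[OF s] by (auto simp: young_component_def offset_def)
qed

section \<open>Biproducts and arithmetic of intertwiners\<close>

lemma rep_dim_direct_sum [simp]: "rep_dim (direct_sum V V') = rep_dim V + rep_dim V'"
  by (simp add: direct_sum_def)

lemma rep_dim_restrict_rep [simp]: "rep_dim (restrict_rep H M) = rep_dim M"
  by (simp add: restrict_rep_def)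

lemma rep_mat_restrict_rep [simp]: "h \<in> H \<Longrightarrow> rep_mat (restrict_rep H M) h = rep_mat M h"
  by (simp add: restrict_rep_def)

text \<open>The orthogonality relations \<open>p s = 0\<close> and \<open>q r = 0\<close> are what
  removes the mixed terms in \<open>factors_through_add\<close>.\<close>

lemma direct_sum_biproduct:
  fixes V V' :: "('g, 'k::field) rep"
  assumes V: "representation G V" and V': "representation G V'"
  shows "\<exists>p q r s. intertwiner (carrier G) (direct_sum V V') V p \<and> intertwiner (carrier G) (direct_sum V V') V' q \<and>
    intertwiner (carrier G) V (direct_sum V V') r \<and> intertwiner (carrier G) V' (direct_sum V V') s \<and>
    p * r = 1\<^sub>m (rep_dim V) \<and> q * s = 1\<^sub>m (rep_dim V') \<and>
    p * s = 0\<^sub>m (rep_dim V) (rep_dim V') \<and> q * r = 0\<^sub>m (rep_dim V') (rep_dim V)"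
proof -
  let ?d = "rep_dim V" and ?e = "rep_dim V'"
  define p q r s where "p = mat ?d (?d + ?e) (\<lambda>(i, j). if i = j then 1 else (0::'k))"
    and "q = mat ?e (?d + ?e) (\<lambda>(i, j). if ?d + i = j then 1 else (0::'k))"
    and "r = mat (?d + ?e) ?d (\<lambda>(i, j). if i = j then 1 else (0::'k))"
    and "s = mat (?d + ?e) ?e (\<lambda>(i, j). if i = ?d + j then 1 else (0::'k))"
  note defs = p_def q_def r_def s_def
  \<comment> \<open>Products with the partial identity matrices \<open>p\<close>, \<open>q\<close>,
    \<open>r\<close>, \<open>s\<close> collapse to one term; \<open>delta'\<close> is the version
    shifted by the dimension of \<open>V\<close>.\<close>
  have delta: "(\<Sum>k<n. (if a = k then 1 else (0::'k)) * f k) = (if a < n then f a else 0)"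
    "(\<Sum>k<n. (if k = a then 1 else (0::'k)) * f k) = (if a < n then f a else 0)"
    "(\<Sum>k<n. f k * (if a = k then 1 else (0::'k))) = (if a < n then f a else 0)"
    "(\<Sum>k<n. f k * (if k = a then 1 else (0::'k))) = (if a < n then f a else 0)" for n a :: nat and f
  proof -
    have "(\<Sum>k<n. (if a = k then 1 else (0::'k)) * f k) = (\<Sum>k<n. if a = k then f k else 0)"
      by (intro sum.cong) auto
    then show 1: "(\<Sum>k<n. (if a = k then 1 else (0::'k)) * f k) = (if a < n then f a else 0)" by simp
    then show "(\<Sum>k<n. (if k = a then 1 else (0::'k)) * f k) = (if a < n then f a else 0)"
      "(\<Sum>k<n. f k * (if a = k then 1 else (0::'k))) = (if a < n then f a else 0)"
      "(\<Sum>k<n. f k * (if k = a then 1 else (0::'k))) = (if a < n then f a else 0)"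
      by (simp_all add: eq_commute[of _ a] mult.commute[of "f _"])
  qed
  have delta': "(\<Sum>k<n. f k * (if ?d + k = a then 1 else (0::'k))) = (if ?d \<le> a \<and> a < ?d + n then f (a - ?d) else 0)"
    "(\<Sum>k<n. (if a = ?d + k then 1 else (0::'k)) * f k) = (if ?d \<le> a \<and> a < ?d + n then f (a - ?d) else 0)" for n a f
  proof -
    have *: "?d + k = a \<longleftrightarrow> ?d \<le> a \<and> k = a - ?d" for k by auto
    have "(\<Sum>k<n. f k * (if ?d + k = a then 1 else (0::'k))) = (\<Sum>k<n. if k = a - ?d then if ?d \<le> a then f k else 0 else 0)"
      by (intro sum.cong) (auto simp: *)
    then show 1: "(\<Sum>k<n. f k * (if ?d + k = a then 1 else (0::'k))) = (if ?d \<le> a \<and> a < ?d + n then f (a - ?d) else 0)"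
      by auto
    then show "(\<Sum>k<n. (if a = ?d + k then 1 else (0::'k)) * f k) = (if ?d \<le> a \<and> a < ?d + n then f (a - ?d) else 0)"
      by (simp add: eq_commute[of a] mult.commute[of _ "f _"])
  qed
  have comm: "p * S = X * p" "q * S = Y * q" "r * X = S * r" "s * Y = S * s"
    if X: "X \<in> carrier_mat ?d ?d" and Y: "Y \<in> carrier_mat ?e ?e"
      and S: "S = four_block_mat X (0\<^sub>m ?d ?e) (0\<^sub>m ?e ?d) Y" for X Y S
  proof -
    have cS: "dim_row S = ?d + ?e" "dim_col S = ?d + ?e" using X Y by (auto simp: S)
    have iS: "S $$ (i, j) = (if i < ?d then if j < ?d then X $$ (i, j) else 0
        else if j < ?d then 0 else Y $$ (i - ?d, j - ?d))" if "i < ?d + ?e" "j < ?d + ?e" for i j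
      using that X Y by (auto simp: S)
    show "p * S = X * p" "q * S = Y * q" "r * X = S * r" "s * Y = S * s"
      by (rule eq_matI; use X Y in \<open>simp add: defs index_mult_mat_sum cS delta delta'\<close>;
          use X Y in \<open>auto simp: iS\<close>)+
  qed
  have "p * r = 1\<^sub>m ?d" "q * s = 1\<^sub>m ?e" "p * s = 0\<^sub>m ?d ?e" "q * r = 0\<^sub>m ?e ?d"
    by (rule eq_matI; simp add: defs index_mult_mat_sum delta delta')+
  moreover have "p \<in> carrier_mat ?d (?d + ?e)" "q \<in> carrier_mat ?e (?d + ?e)"
    "r \<in> carrier_mat (?d + ?e) ?d" "s \<in> carrier_mat (?d + ?e) ?e"
    by (simp_all add: defs)
  moreover note comm[OF representation_carrier[OF V] representation_carrier[OF V'] refl]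
  ultimately have "intertwiner (carrier G) (direct_sum V V') V p" "intertwiner (carrier G) (direct_sum V V') V' q"
    "intertwiner (carrier G) V (direct_sum V V') r" "intertwiner (carrier G) V' (direct_sum V V') s"
    by (simp_all add: intertwiner_def direct_sum_def)
  then show ?thesis
    using \<open>p * r = _\<close> \<open>q * s = _\<close> \<open>p * s = _\<close> \<open>q * r = _\<close> by blast
qed

lemma intertwiner_add:
  assumes "intertwiner H M N S" "intertwiner H M N T"
    and M: "\<And>h. h \<in> H \<Longrightarrow> rep_mat M h \<in> carrier_mat (rep_dim M) (rep_dim M)"
    and N: "\<And>h. h \<in> H \<Longrightarrow> rep_mat N h \<in> carrier_mat (rep_dim N) (rep_dim N)"
  shows "intertwiner H M N (S + T)"
  unfolding intertwiner_def
proof (intro conjI ballI)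
  note S = intertwiner_carrier[OF assms(1)] and T = intertwiner_carrier[OF assms(2)]
  show "S + T \<in> carrier_mat (rep_dim N) (rep_dim M)" using S T by simp
  fix h assume h: "h \<in> H"
  show "(S + T) * rep_mat M h = rep_mat N h * (S + T)"
    unfolding add_mult_distrib_mat[OF S T M[OF h]] mult_add_distrib_mat[OF N[OF h] S T]
      intertwiner_comm[OF assms(1) h] intertwiner_comm[OF assms(2) h] ..
qed

lemma intertwiner_smult:
  assumes "intertwiner H M N S"
    and M: "\<And>h. h \<in> H \<Longrightarrow> rep_mat M h \<in> carrier_mat (rep_dim M) (rep_dim M)"
    and N: "\<And>h. h \<in> H \<Longrightarrow> rep_mat N h \<in> carrier_mat (rep_dim N) (rep_dim N)"
  shows "intertwiner H M N (c \<cdot>\<^sub>m S)"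
  unfolding intertwiner_def
proof (intro conjI ballI)
  note S = intertwiner_carrier[OF assms(1)]
  show "c \<cdot>\<^sub>m S \<in> carrier_mat (rep_dim N) (rep_dim M)" using S by simp
  fix h assume h: "h \<in> H"
  show "c \<cdot>\<^sub>m S * rep_mat M h = rep_mat N h * (c \<cdot>\<^sub>m S)"
    unfolding mult_smult_assoc_mat[OF S M[OF h]] mult_smult_distrib[OF N[OF h] S] intertwiner_comm[OF assms(1) h] ..
qed

lemma intertwiner_one:
  assumes "\<And>h. h \<in> H \<Longrightarrow> rep_mat M h \<in> carrier_mat (rep_dim M) (rep_dim M)"
  shows "intertwiner H M M (1\<^sub>m (rep_dim M))"
  using left_mult_one_mat[OF assms] right_mult_one_mat[OF assms] by (simp add: intertwiner_def)

lemma retract_restrict_rep: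
  "retract_of H (restrict_rep H M) N \<longleftrightarrow> retract_of H M N"
  by (simp add: retract_of_def intertwiner_def)

section \<open>Closed inductive systems\<close>

context closed_inductive_system
begin

text \<open>Restriction by one letter is iterated. Even \<open>i = n\<close> takes an argument:
  \<open>restrict_rep\<close> may change values outside the carrier, so the result is only known to
  be isomorphic to \<open>M\<close>.\<close>

lemma restrict_closed:
  assumes "0 < i" "i \<le> n" "M \<in> A n"
  shows "restrict_rep (carrier (sym_group i)) M \<in> A i"
  using assms
proof (induction "n - i" arbitrary: n M)
  case 0
  then have n: "n = i" by simp
  have M: "representation (sym_group i) M" using objects 0 n by auto
  have "(sym_group i)\<lparr>carrier := carrier (sym_group i)\<rparr> = sym_group i" by simp
  then have R: "representation (sym_group i) (restrict_rep (carrier (sym_group i)) M)"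
    using representation_restrict[OF M group.subgroup_self[OF sym_group_is_group]] by simp
  have "rep_iso (sym_group i) M (restrict_rep (carrier (sym_group i)) M)"
    unfolding rep_iso_def
  proof (intro conjI bexI[of _ "1\<^sub>m (rep_dim M)"] ballI)
    show "invertible_mat (1\<^sub>m (rep_dim M))"
      by (auto simp: invertible_mat_def inverts_mat_def intro!: exI[of _ "1\<^sub>m (rep_dim M)"])
    fix g assume g: "g \<in> carrier (sym_group i)"
    show "1\<^sub>m (rep_dim M) * rep_mat M g = rep_mat (restrict_rep (carrier (sym_group i)) M) g * 1\<^sub>m (rep_dim M)"
      using left_mult_one_mat[OF representation_carrier[OF M g]] right_mult_one_mat[OF representation_carrier[OF M g]] g
      by simp
  qed simp_all
  then show ?case using iso_closed[OF 0(2) _ R] 0 n by simp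
next
  case (Suc k)
  let ?R = "restrict_rep (carrier (sym_group (n - 1))) M"
  have "?R \<in> A (n - 1)" using res_closed Suc by auto
  moreover have "k = (n - 1) - i" "i \<le> n - 1" using Suc by auto
  ultimately have "restrict_rep (carrier (sym_group i)) ?R \<in> A i" using Suc by blast
  moreover have "carrier (sym_group i) \<subseteq> carrier (sym_group (n - 1))"
    using permutes_subset[of _ "{1..i}" "{1..n - 1}"] \<open>i \<le> n - 1\<close> by (auto simp: sym_group_carrier)
  then have "restrict_rep (carrier (sym_group i)) ?R = restrict_rep (carrier (sym_group i)) M"
    by (auto simp: restrict_rep_def restrict_def fun_eq_iff)
  ultimately show ?case by simp
qed

text \<open>\<open>U\<close> is fixed while \<open>V\<close> ranges over \<open>A i\<close>. Closure
  of \<open>A i\<close> under direct sums makes these endomorphisms a linear subspace, which is the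
  purpose of the notion.\<close>

definition factors_through :: "nat \<Rightarrow> nat \<Rightarrow> (nat \<Rightarrow> nat, 'k) rep \<Rightarrow> (nat \<Rightarrow> nat, 'k) rep \<Rightarrow> 'k mat \<Rightarrow> bool" where
  "factors_through i j M U \<phi> \<longleftrightarrow> (\<exists>V\<in>A i. \<exists>\<alpha> \<beta>.
     intertwiner (young_subgroup [i, j]) (outer_tensor [i, j] [V, U]) M \<alpha> \<and>
     intertwiner (young_subgroup [i, j]) M (outer_tensor [i, j] [V, U]) \<beta> \<and> \<phi> = \<alpha> * \<beta>)"

context
  fixes i j :: nat and M U :: "(nat \<Rightarrow> nat, 'k) rep"
  assumes i: "0 < i" and U: "representation (sym_group j) U"
    and M: "\<And>\<sigma>. \<sigma> \<in> young_subgroup [i, j] \<Longrightarrow> rep_mat M \<sigma> \<in> carrier_mat (rep_dim M) (rep_dim M)"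
begin

lemma outer_carrier:
  "V \<in> A i \<Longrightarrow> \<sigma> \<in> young_subgroup [i, j] \<Longrightarrow> rep_mat (outer_tensor [i, j] [V, U]) \<sigma>
    \<in> carrier_mat (rep_dim (outer_tensor [i, j] [V, U])) (rep_dim (outer_tensor [i, j] [V, U]))"
  using outer_tensor_pair_carrier[OF objects[OF i] U] by simp

lemma factors_through_zero: "factors_through i j M U (0\<^sub>m (rep_dim M) (rep_dim M))"
proof -
  let ?T = "outer_tensor [i, j] [trivial_rep, U]"
  have T: "trivial_rep \<in> A i" using trivial_closed[OF i] .
  have "intertwiner (young_subgroup [i, j]) ?T M (0\<^sub>m (rep_dim M) (rep_dim ?T))"
    "intertwiner (young_subgroup [i, j]) M ?T (0\<^sub>m (rep_dim ?T) (rep_dim M))"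
    using left_mult_zero_mat[OF M] right_mult_zero_mat[OF M] left_mult_zero_mat[OF outer_carrier[OF T]]
      right_mult_zero_mat[OF outer_carrier[OF T]]
    by (simp_all add: intertwiner_def del: rep_dim_outer_tensor_pair)
  moreover have "0\<^sub>m (rep_dim M) (rep_dim M) = 0\<^sub>m (rep_dim M) (rep_dim ?T) * (0\<^sub>m (rep_dim ?T) (rep_dim M) :: 'k mat)"
    by simp
  ultimately show ?thesis using T unfolding factors_through_def by blast
qed

lemma factors_through_smult:
  assumes "factors_through i j M U \<phi>"
  shows "factors_through i j M U (c \<cdot>\<^sub>m \<phi>)"
proof -
  obtain V \<alpha> \<beta> where V: "V \<in> A i" and \<alpha>: "intertwiner (young_subgroup [i, j]) (outer_tensor [i, j] [V, U]) M \<alpha>"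
    and \<beta>: "intertwiner (young_subgroup [i, j]) M (outer_tensor [i, j] [V, U]) \<beta>" and \<phi>: "\<phi> = \<alpha> * \<beta>"
    using assms by (auto simp: factors_through_def)
  have "intertwiner (young_subgroup [i, j]) (outer_tensor [i, j] [V, U]) M (c \<cdot>\<^sub>m \<alpha>)"
    using intertwiner_smult[OF \<alpha> outer_carrier[OF V] M] by blast
  moreover have "c \<cdot>\<^sub>m \<phi> = (c \<cdot>\<^sub>m \<alpha>) * \<beta>"
    unfolding \<phi> using mult_smult_assoc_mat[OF intertwiner_carrier[OF \<alpha>] intertwiner_carrier[OF \<beta>]] by simp
  ultimately show ?thesis using V \<beta> unfolding factors_through_def by blast
qed

text \<open>Two factorizations, through \<open>V\<close> and through \<open>V'\<close>, are placed
  side by side on \<open>direct_sum V V'\<close>. The mixed products vanish because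
  \<open>p s\<close> and \<open>q r\<close> are zero.\<close>

lemma factors_through_add:
  assumes "factors_through i j M U \<phi>" "factors_through i j M U \<psi>"
  shows "factors_through i j M U (\<phi> + \<psi>)"
proof -
  let ?Y = "young_subgroup [i, j]"
  obtain V \<alpha> \<beta> where V: "V \<in> A i" and \<alpha>: "intertwiner ?Y (outer_tensor [i, j] [V, U]) M \<alpha>"
    and \<beta>: "intertwiner ?Y M (outer_tensor [i, j] [V, U]) \<beta>" and \<phi>: "\<phi> = \<alpha> * \<beta>"
    using assms(1) by (auto simp: factors_through_def)
  obtain V' \<alpha>' \<beta>' where V': "V' \<in> A i" and \<alpha>': "intertwiner ?Y (outer_tensor [i, j] [V', U]) M \<alpha>'"
    and \<beta>': "intertwiner ?Y M (outer_tensor [i, j] [V', U]) \<beta>'" and \<psi>: "\<psi> = \<alpha>' * \<beta>'"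
    using assms(2) by (auto simp: factors_through_def)
  let ?S = "direct_sum V V'"
  have S: "?S \<in> A i" using sum_closed[OF i V V'] .
  obtain p q r s where p: "intertwiner (carrier (sym_group i)) ?S V p"
    and q: "intertwiner (carrier (sym_group i)) ?S V' q"
    and r: "intertwiner (carrier (sym_group i)) V ?S r" and s: "intertwiner (carrier (sym_group i)) V' ?S s"
    and pr: "p * r = 1\<^sub>m (rep_dim V)" and qs: "q * s = 1\<^sub>m (rep_dim V')"
    and ps: "p * s = 0\<^sub>m (rep_dim V) (rep_dim V')" and qr: "q * r = 0\<^sub>m (rep_dim V') (rep_dim V)"
    using direct_sum_biproduct[OF objects[OF i V] objects[OF i V']] by blast
  let ?I = "1\<^sub>m (rep_dim U)"
  have I: "intertwiner (carrier (sym_group j)) U U ?I"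
    by (rule intertwiner_one[OF representation_carrier[OF U]])
  note outer = intertwiner_outer_tensor[OF objects[OF i] U objects[OF i] U _ I]
  have P: "intertwiner ?Y (outer_tensor [i, j] [?S, U]) (outer_tensor [i, j] [V, U]) (kronecker p ?I)"
    and Q: "intertwiner ?Y (outer_tensor [i, j] [?S, U]) (outer_tensor [i, j] [V', U]) (kronecker q ?I)"
    and R: "intertwiner ?Y (outer_tensor [i, j] [V, U]) (outer_tensor [i, j] [?S, U]) (kronecker r ?I)"
    and T: "intertwiner ?Y (outer_tensor [i, j] [V', U]) (outer_tensor [i, j] [?S, U]) (kronecker s ?I)"
    using outer[OF S V p] outer[OF S V' q] outer[OF V S r] outer[OF V' S s] by auto
  define \<alpha>1 \<alpha>2 \<beta>1 \<beta>2 where "\<alpha>1 = \<alpha> * kronecker p ?I" and "\<alpha>2 = \<alpha>' * kronecker q ?I"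
    and "\<beta>1 = kronecker r ?I * \<beta>" and "\<beta>2 = kronecker s ?I * \<beta>'"
  have a: "intertwiner ?Y (outer_tensor [i, j] [?S, U]) M \<alpha>1" "intertwiner ?Y (outer_tensor [i, j] [?S, U]) M \<alpha>2"
    "intertwiner ?Y M (outer_tensor [i, j] [?S, U]) \<beta>1" "intertwiner ?Y M (outer_tensor [i, j] [?S, U]) \<beta>2"
    unfolding \<alpha>1_def \<alpha>2_def \<beta>1_def \<beta>2_def
    using intertwiner_compose[OF P \<alpha> outer_carrier[OF S] outer_carrier[OF V] M]
      intertwiner_compose[OF Q \<alpha>' outer_carrier[OF S] outer_carrier[OF V'] M]
      intertwiner_compose[OF \<beta> R M outer_carrier[OF V] outer_carrier[OF S]]
      intertwiner_compose[OF \<beta>' T M outer_carrier[OF V'] outer_carrier[OF S]] by auto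
  let ?d = "rep_dim M" and ?D = "(rep_dim V + rep_dim V') * rep_dim U"
    and ?v = "rep_dim V * rep_dim U" and ?w = "rep_dim V' * rep_dim U"
  have c: "\<alpha> \<in> carrier_mat ?d ?v" "\<alpha>' \<in> carrier_mat ?d ?w" "\<beta> \<in> carrier_mat ?v ?d" "\<beta>' \<in> carrier_mat ?w ?d"
    "\<alpha>1 \<in> carrier_mat ?d ?D" "\<alpha>2 \<in> carrier_mat ?d ?D" "\<beta>1 \<in> carrier_mat ?D ?d" "\<beta>2 \<in> carrier_mat ?D ?d"
    using \<alpha> \<alpha>' \<beta> \<beta>' a by (auto simp: intertwiner_def)
  have k: "p \<in> carrier_mat (rep_dim V) (rep_dim V + rep_dim V')" "q \<in> carrier_mat (rep_dim V') (rep_dim V + rep_dim V')"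
    "r \<in> carrier_mat (rep_dim V + rep_dim V') (rep_dim V)" "s \<in> carrier_mat (rep_dim V + rep_dim V') (rep_dim V')"
    using p q r s by (auto simp: intertwiner_def)
  have mid: "(X * kronecker x ?I) * (kronecker y ?I * Z) = X * (kronecker (x * y) ?I * Z)"
    if "X \<in> carrier_mat ?d (a * rep_dim U)" "x \<in> carrier_mat a (rep_dim V + rep_dim V')"
      "y \<in> carrier_mat (rep_dim V + rep_dim V') b" "Z \<in> carrier_mat (b * rep_dim U) ?d" for X Z x y a b
  proof -
    have cx: "kronecker x ?I \<in> carrier_mat (a * rep_dim U) ?D" "kronecker y ?I \<in> carrier_mat ?D (b * rep_dim U)"
      using that by auto
    have I1: "?I \<in> carrier_mat (rep_dim U) (rep_dim U)" by simp
    have "kronecker (x * y) ?I = kronecker x ?I * kronecker y ?I"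
      using kronecker_mult[OF that(2) I1 that(3) I1] by simp
    then have "kronecker (x * y) ?I * Z = kronecker x ?I * (kronecker y ?I * Z)"
      using assoc_mult_mat[OF cx that(4)] by simp
    then show ?thesis
      using assoc_mult_mat[OF that(1) cx(1) mult_carrier_mat[OF cx(2) that(4)]] by simp
  qed
  have 11: "\<alpha>1 * \<beta>1 = \<phi>"
    unfolding \<alpha>1_def \<beta>1_def mid[OF c(1) k(1) k(3) c(3)] pr kronecker_one \<phi> using c by simp
  have 22: "\<alpha>2 * \<beta>2 = \<psi>"
    unfolding \<alpha>2_def \<beta>2_def mid[OF c(2) k(2) k(4) c(4)] qs kronecker_one \<psi> using c by simp
  have I1: "?I \<in> carrier_mat (rep_dim U) (rep_dim U)" by simp
  have 12: "\<alpha>1 * \<beta>2 = 0\<^sub>m ?d ?d"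
    unfolding \<alpha>1_def \<beta>2_def mid[OF c(1) k(1) k(4) c(4)] ps kronecker_zero_left[OF I1] using c by simp
  have 21: "\<alpha>2 * \<beta>1 = 0\<^sub>m ?d ?d"
    unfolding \<alpha>2_def \<beta>1_def mid[OF c(2) k(2) k(3) c(3)] qr kronecker_zero_left[OF I1] using c by simp
  have "(\<alpha>1 + \<alpha>2) * (\<beta>1 + \<beta>2) = (\<alpha>1 * \<beta>1 + \<alpha>1 * \<beta>2) + (\<alpha>2 * \<beta>1 + \<alpha>2 * \<beta>2)"
    unfolding add_mult_distrib_mat[OF c(5,6) add_carrier_mat[OF c(8)]]
      mult_add_distrib_mat[OF c(5,7,8)] mult_add_distrib_mat[OF c(6,7,8)] ..
  also have "\<dots> = \<phi> + \<psi>" unfolding 11 22 12 21 \<phi> \<psi> using c(1-4) by simp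
  finally have "\<phi> + \<psi> = (\<alpha>1 + \<alpha>2) * (\<beta>1 + \<beta>2)" ..
  moreover have "intertwiner ?Y (outer_tensor [i, j] [?S, U]) M (\<alpha>1 + \<alpha>2)"
    using intertwiner_add[OF a(1,2) outer_carrier[OF S] M] by blast
  moreover have "intertwiner ?Y M (outer_tensor [i, j] [?S, U]) (\<beta>1 + \<beta>2)"
    using intertwiner_add[OF a(3,4) M outer_carrier[OF S]] by blast
  ultimately show ?thesis using S unfolding factors_through_def by blast
qed

lemma factors_through_carrier: "factors_through i j M U \<phi> \<Longrightarrow> \<phi> \<in> carrier_mat (rep_dim M) (rep_dim M)"
  unfolding factors_through_def intertwiner_def by auto

lemma factors_through_lincomb:
  assumes "finite S" "\<And>x. x \<in> S \<Longrightarrow> factors_through i j M U (F x)"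
  shows "factors_through i j M U (lincomb_mat (rep_dim M) (rep_dim M) S u F)"
  using assms
proof (induction S)
  case empty
  have "lincomb_mat (rep_dim M) (rep_dim M) {} u F = 0\<^sub>m (rep_dim M) (rep_dim M)"
    by (rule eq_matI) auto
  then show ?case using factors_through_zero by simp
next
  case (insert x S)
  have "F x \<in> carrier_mat (rep_dim M) (rep_dim M)" using factors_through_carrier insert by blast
  then have "lincomb_mat (rep_dim M) (rep_dim M) (insert x S) u F
      = u x \<cdot>\<^sub>m F x + lincomb_mat (rep_dim M) (rep_dim M) S u F"
    using insert(1,2) by (intro eq_matI) auto
  then show ?case using insert by (simp add: factors_through_add factors_through_smult)
qed

end

text \<open>
  With \<open>A\<close> and \<open>B\<close> exhibiting \<open>M\<close> as a retract of \<open>V0 \<boxtimes> W0\<close>, every strided block of \<open>A\<close> or \<open>B\<close>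
  intertwines \<open>V0\<close> with the restriction of \<open>M\<close> to \<open>S\<^sub>i\<close>, and every contiguous block, up to the
  conjugation by the block swap, intertwines \<open>W0\<close> with the restriction of \<open>M\<close> to \<open>S\<^sub>j\<close>. Writing
  \<open>1 = A (B A) B\<close> and \<open>B A\<close> as a sum of Kronecker products of such blocks shows that \<open>V0\<close> and \<open>W0\<close> can be
  replaced by objects of the system, without any appeal to the Krull-Schmidt theorem.
\<close>

lemma outer_tensor_factors_in_system:
  assumes i: "0 < i" and j: "0 < j" and M: "M \<in> A (i + j)"
    and V0: "representation (sym_group i) V0" and W0: "representation (sym_group j) W0"
    and ret: "retract_of (young_subgroup [i, j]) M (outer_tensor [i, j] [V0, W0])"
  shows "\<exists>V\<in>A i. \<exists>W\<in>A j. retract_of (young_subgroup [i, j]) M (outer_tensor [i, j] [V, W])"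
proof -
  let ?Y = "young_subgroup [i, j]" and ?d = "rep_dim M" and ?n = "rep_dim V0" and ?m = "rep_dim W0"
  let ?O = "outer_tensor [i, j] [V0, W0]"
  obtain B C where B: "intertwiner ?Y ?O M B" and C: "intertwiner ?Y M ?O C" and BC: "B * C = 1\<^sub>m ?d"
    using ret by (auto simp: retract_of_def)
  have cB: "B \<in> carrier_mat ?d (?n * ?m)" and cC: "C \<in> carrier_mat (?n * ?m) ?d"
    using B C by (auto simp: intertwiner_def)
  have repM: "representation (sym_group (i + j)) M" using objects M i by auto
  have Y: "?Y \<subseteq> carrier (sym_group (i + j))" using young_subgroup_subset[of "[i, j]"] by simp
  note cM = representation_carrier[OF repM]
  have cMY: "rep_mat M \<sigma> \<in> carrier_mat ?d ?d" if "\<sigma> \<in> ?Y" for \<sigma> using cM Y that by auto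
  have oO: "rep_mat ?O \<sigma> \<in> carrier_mat (rep_dim ?O) (rep_dim ?O)" if "\<sigma> \<in> ?Y" for \<sigma>
    using outer_tensor_pair_carrier[OF V0 W0 that] by simp
  \<comment> \<open>The objects of the system that take over from \<open>V0\<close> and
    \<open>W0\<close>: \<open>M\<close> restricted to the permutations of the first
    \<open>i\<close>, respectively the first \<open>j\<close>, letters.\<close>
  define X where "X = restrict_rep (carrier (sym_group i)) M"
  define U where "U = restrict_rep (carrier (sym_group j)) M"
  have X: "X \<in> A i" unfolding X_def by (rule restrict_closed[OF i _ M]) simp
  have UA: "U \<in> A j" unfolding U_def by (rule restrict_closed[OF j _ M]) simp
  note repX = objects[OF i X] and repU = objects[OF j UA]
  have dims [simp]: "rep_dim X = ?d" "rep_dim U = ?d" by (simp_all add: X_def U_def)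
  define \<tau> where "\<tau> = block_swap i j"
  have \<tau>: "\<tau> \<in> carrier (sym_group (i + j))" "inv' \<tau> \<in> carrier (sym_group (i + j))"
    using block_swap_permutes by (simp_all add: \<tau>_def sym_group_carrier permutes_inv)
  have Mmult: "rep_mat M (g \<circ> h) = rep_mat M g * rep_mat M h"
    if "g \<in> carrier (sym_group (i + j))" "h \<in> carrier (sym_group (i + j))" for g h
    using representation_mult[OF repM that] by (simp add: sym_group_mult)
  have Mid: "rep_mat M id = 1\<^sub>m ?d" using representation_one[OF repM] by (simp add: sym_group_one)
  have \<tau>\<tau>: "rep_mat M \<tau> * rep_mat M (inv' \<tau>) = 1\<^sub>m ?d"
    using Mmult[OF \<tau>] Mid permutes_inv_o(1)[OF block_swap_permutes[of i j]] by (simp add: \<tau>_def)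
  have Vid: "rep_mat V0 id = 1\<^sub>m ?n" and Wid: "rep_mat W0 id = 1\<^sub>m ?m"
    using representation_one[OF V0] representation_one[OF W0] by (simp_all add: sym_group_one)
  have first: "\<sigma> \<in> ?Y" "rep_mat ?O \<sigma> = kronecker (rep_mat V0 \<sigma>) (1\<^sub>m ?m)" "rep_mat X \<sigma> = rep_mat M \<sigma>"
    if "\<sigma> \<in> carrier (sym_group i)" for \<sigma>
    using that first_block_embedding[of \<sigma> i j] Wid by (simp_all add: outer_tensor_pair sym_group_carrier X_def)
  \<comment> \<open>\<open>\<rho> \<sigma>\<close> acts on the second block as
    \<open>\<sigma>\<close> acts on \<open>{1..j}\<close>, so on the tensor product it moves the
    factor \<open>W0\<close> alone.\<close>
  define \<rho> where "\<rho> \<sigma> = \<tau> \<circ> \<sigma> \<circ> inv' \<tau>" for \<sigma>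
  have second: "\<rho> \<sigma> \<in> ?Y" "rep_mat ?O (\<rho> \<sigma>) = kronecker (1\<^sub>m ?n) (rep_mat W0 \<sigma>)" "rep_mat U \<sigma> = rep_mat M \<sigma>"
    "\<sigma> \<in> carrier (sym_group (i + j))" if "\<sigma> \<in> carrier (sym_group j)" for \<sigma>
    using that second_block_embedding[of \<sigma> j i] Vid permutes_subset[of \<sigma> "{1..j}" "{1..i + j}"]
    by (auto simp: outer_tensor_pair sym_group_carrier U_def \<rho>_def \<tau>_def)
  have swap1: "rep_mat M (\<rho> \<sigma>) * rep_mat M \<tau> = rep_mat M \<tau> * rep_mat M \<sigma>"
    and swap2: "rep_mat M (inv' \<tau>) * rep_mat M (\<rho> \<sigma>) = rep_mat M \<sigma> * rep_mat M (inv' \<tau>)"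
    if s: "\<sigma> \<in> carrier (sym_group j)" for \<sigma>
  proof -
    have \<rho>: "\<rho> \<sigma> \<in> carrier (sym_group (i + j))" using second(1)[OF s] Y by auto
    have inv: "inv' \<tau> \<circ> \<tau> = id" using permutes_inv_o(2)[OF block_swap_permutes] by (simp add: \<tau>_def)
    have 1: "\<rho> \<sigma> \<circ> \<tau> = \<tau> \<circ> \<sigma>" and 2: "inv' \<tau> \<circ> \<rho> \<sigma> = \<sigma> \<circ> inv' \<tau>"
      using fun_cong[OF inv] by (auto simp: \<rho>_def fun_eq_iff)
    show "rep_mat M (\<rho> \<sigma>) * rep_mat M \<tau> = rep_mat M \<tau> * rep_mat M \<sigma>"
      using Mmult[OF \<rho> \<tau>(1)] Mmult[OF \<tau>(1) second(4)[OF s]] by (simp add: 1)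
    show "rep_mat M (inv' \<tau>) * rep_mat M (\<rho> \<sigma>) = rep_mat M \<sigma> * rep_mat M (inv' \<tau>)"
      using Mmult[OF \<tau>(2) \<rho>] Mmult[OF second(4)[OF s] \<tau>(2)] by (simp add: 2)
  qed
  have rs: "intertwiner (carrier (sym_group i)) X V0 (row_stride ?n ?m w C)" if w: "w < ?m" for w
    unfolding intertwiner_def
  proof (intro conjI ballI)
    show "row_stride ?n ?m w C \<in> carrier_mat ?n (rep_dim X)" using cC by simp
    fix \<sigma> assume s: "\<sigma> \<in> carrier (sym_group i)"
    show "row_stride ?n ?m w C * rep_mat X \<sigma> = rep_mat V0 \<sigma> * row_stride ?n ?m w C"
      using row_stride_mult[OF cC cMY[OF first(1)[OF s]] w] intertwiner_comm[OF C first(1)[OF s]]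
        row_stride_kronecker_mult[OF cC representation_carrier[OF V0 s] w] first(2,3)[OF s] by simp
  qed
  have cs: "intertwiner (carrier (sym_group i)) V0 X (col_stride ?n ?m w B)" if w: "w < ?m" for w
    unfolding intertwiner_def
  proof (intro conjI ballI)
    show "col_stride ?n ?m w B \<in> carrier_mat (rep_dim X) ?n" using cB by simp
    fix \<sigma> assume s: "\<sigma> \<in> carrier (sym_group i)"
    show "col_stride ?n ?m w B * rep_mat V0 \<sigma> = rep_mat X \<sigma> * col_stride ?n ?m w B"
      using col_stride_mult[OF cMY[OF first(1)[OF s]] cB w] intertwiner_comm[OF B first(1)[OF s]]
        col_stride_mult_kronecker[OF cB representation_carrier[OF V0 s] w] first(2,3)[OF s] by simp
  qed
  \<comment> \<open>The blocks are equivariant for permutations of the last \<open>j\<close>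
    letters, whereas \<open>U\<close> is the restriction to the first \<open>j\<close>; the factor
    \<open>rep_mat M \<tau>\<close> reconciles the two.\<close>
  have rb: "intertwiner (carrier (sym_group j)) U W0 (row_block ?m v C * rep_mat M \<tau>)" if v: "v < ?n" for v
    unfolding intertwiner_def
  proof (intro conjI ballI)
    have c: "row_block ?m v C \<in> carrier_mat ?m ?d" using cC by simp
    then show "row_block ?m v C * rep_mat M \<tau> \<in> carrier_mat ?m (rep_dim U)" using cM[OF \<tau>(1)] by simp
    fix \<sigma> assume s: "\<sigma> \<in> carrier (sym_group j)"
    note \<rho> = second(1)[OF s] and cW = representation_carrier[OF W0 s]
    have "row_block ?m v C * rep_mat M \<tau> * rep_mat U \<sigma> = row_block ?m v C * (rep_mat M (\<rho> \<sigma>) * rep_mat M \<tau>)"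
      using assoc_mult_mat[OF c cM[OF \<tau>(1)] cM[OF second(4)[OF s]]] by (simp add: second(3)[OF s] swap1[OF s])
    also have "\<dots> = row_block ?m v C * rep_mat M (\<rho> \<sigma>) * rep_mat M \<tau>"
      by (rule assoc_mult_mat[symmetric, OF c cMY[OF \<rho>] cM[OF \<tau>(1)]])
    also have "row_block ?m v C * rep_mat M (\<rho> \<sigma>) = rep_mat W0 \<sigma> * row_block ?m v C"
      using row_block_mult[OF cC cMY[OF \<rho>] v] intertwiner_comm[OF C \<rho>]
        row_block_kronecker_mult[OF cC cW v] second(2)[OF s] by simp
    also have "\<dots> * rep_mat M \<tau> = rep_mat W0 \<sigma> * (row_block ?m v C * rep_mat M \<tau>)"
      by (rule assoc_mult_mat[OF cW c cM[OF \<tau>(1)]])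
    finally show "row_block ?m v C * rep_mat M \<tau> * rep_mat U \<sigma> = rep_mat W0 \<sigma> * (row_block ?m v C * rep_mat M \<tau>)" .
  qed
  have cb: "intertwiner (carrier (sym_group j)) W0 U (rep_mat M (inv' \<tau>) * col_block ?m v B)" if v: "v < ?n" for v
    unfolding intertwiner_def
  proof (intro conjI ballI)
    have c: "col_block ?m v B \<in> carrier_mat ?d ?m" using cB by simp
    then show "rep_mat M (inv' \<tau>) * col_block ?m v B \<in> carrier_mat (rep_dim U) ?m" using cM[OF \<tau>(2)] by simp
    fix \<sigma> assume s: "\<sigma> \<in> carrier (sym_group j)"
    note \<rho> = second(1)[OF s] and cW = representation_carrier[OF W0 s]
    have "rep_mat M (inv' \<tau>) * col_block ?m v B * rep_mat W0 \<sigma> = rep_mat M (inv' \<tau>) * (col_block ?m v B * rep_mat W0 \<sigma>)"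
      by (rule assoc_mult_mat[OF cM[OF \<tau>(2)] c cW])
    also have "col_block ?m v B * rep_mat W0 \<sigma> = rep_mat M (\<rho> \<sigma>) * col_block ?m v B"
      using col_block_mult[OF cMY[OF \<rho>] cB v] intertwiner_comm[OF B \<rho>]
        col_block_mult_kronecker[OF cB cW v] second(2)[OF s] by simp
    also have "rep_mat M (inv' \<tau>) * \<dots> = rep_mat M (inv' \<tau>) * rep_mat M (\<rho> \<sigma>) * col_block ?m v B"
      by (rule assoc_mult_mat[symmetric, OF cM[OF \<tau>(2)] cMY[OF \<rho>] c])
    also have "\<dots> = rep_mat U \<sigma> * (rep_mat M (inv' \<tau>) * col_block ?m v B)"
      using assoc_mult_mat[OF cM[OF second(4)[OF s]] cM[OF \<tau>(2)] c] by (simp add: second(3)[OF s] swap2[OF s])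
    finally show "rep_mat M (inv' \<tau>) * col_block ?m v B * rep_mat W0 \<sigma> = rep_mat U \<sigma> * (rep_mat M (inv' \<tau>) * col_block ?m v B)" .
  qed
  let ?S = "({..<?m} \<times> {..<?m}) \<times> ({..<?n} \<times> {..<?n})"
  let ?F = "\<lambda>((w, w'), (v, v')). kronecker (row_stride ?n ?m w C * col_stride ?n ?m w' B) (row_block ?m v C * col_block ?m v' B)"
  obtain c where c: "C * B = lincomb_mat (?n * ?m) (?n * ?m) ?S c ?F"
    using mult_as_kronecker_sum[OF cB cC] by blast
  have cF: "?F x \<in> carrier_mat (?n * ?m) (?n * ?m)" for x
  proof -
    obtain w w' v v' where x: "x = ((w, w'), (v, v'))" by (metis surj_pair)
    show ?thesis
      unfolding x prod.case
      by (intro kronecker_carrier mult_carrier_mat[OF row_stride_carrier[OF cC] col_stride_carrier[OF cB]]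
          mult_carrier_mat[OF row_block_carrier[OF cC] col_block_carrier[OF cB]])
  qed
  \<comment> \<open>\<open>C * B\<close> is the idempotent that cuts \<open>M\<close> out of the
    tensor product; squaring \<open>B * C = 1\<close> brings it to the middle, where it can be
    expanded.\<close>
  have "1\<^sub>m ?d = B * (C * B) * C"
    using BC cB cC by (simp add: assoc_mult_mat[symmetric, of B ?d "?n * ?m" C ?d B "?n * ?m"])
  also have "\<dots> = lincomb_mat ?d ?d ?S c (\<lambda>x. B * ?F x * C)"
    unfolding c by (rule mult_lincomb_mat_mult[OF cB cC cF])
  finally have one: "1\<^sub>m ?d = lincomb_mat ?d ?d ?S c (\<lambda>x. B * ?F x * C)" .
  have term_factors: "factors_through i j M U (B * ?F x * C)" if xS: "x \<in> ?S" for x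
  proof -
    obtain w w' v v' where x: "x = ((w, w'), (v, v'))" "w < ?m" "w' < ?m" "v < ?n" "v' < ?n"
      using xS by auto
    \<comment> \<open>Each Kronecker term equals \<open>P * Q\<close> and so passes through the
      tensor product of \<open>X\<close> and \<open>U\<close>; the twists by \<open>\<tau>\<close>
      and its inverse cancel.\<close>
    define P where "P = kronecker (row_stride ?n ?m w C) (row_block ?m v C * rep_mat M \<tau>)"
    define Q where "Q = kronecker (col_stride ?n ?m w' B) (rep_mat M (inv' \<tau>) * col_block ?m v' B)"
    have P: "intertwiner ?Y (outer_tensor [i, j] [X, U]) ?O P"
      unfolding P_def by (rule intertwiner_outer_tensor[OF repX repU V0 W0 rs[OF x(2)] rb[OF x(4)]])
    have Q: "intertwiner ?Y ?O (outer_tensor [i, j] [X, U]) Q"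
      unfolding Q_def by (rule intertwiner_outer_tensor[OF V0 W0 repX repU cs[OF x(3)] cb[OF x(5)]])
    have cXU: "rep_mat (outer_tensor [i, j] [X, U]) \<sigma> \<in> carrier_mat (rep_dim (outer_tensor [i, j] [X, U])) (rep_dim (outer_tensor [i, j] [X, U]))"
      if "\<sigma> \<in> ?Y" for \<sigma> using outer_tensor_pair_carrier[OF repX repU that] by simp
    have "row_block ?m v C * rep_mat M \<tau> * (rep_mat M (inv' \<tau>) * col_block ?m v' B) = row_block ?m v C * col_block ?m v' B"
    proof -
      note r = row_block_carrier[OF cC, of ?m v] and l = col_block_carrier[OF cB, of ?m v']
      have "row_block ?m v C * rep_mat M \<tau> * (rep_mat M (inv' \<tau>) * col_block ?m v' B)
          = row_block ?m v C * (rep_mat M \<tau> * (rep_mat M (inv' \<tau>) * col_block ?m v' B))"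
        by (rule assoc_mult_mat[OF r cM[OF \<tau>(1)] mult_carrier_mat[OF cM[OF \<tau>(2)] l]])
      also have "rep_mat M \<tau> * (rep_mat M (inv' \<tau>) * col_block ?m v' B) = col_block ?m v' B"
        using assoc_mult_mat[OF cM[OF \<tau>(1)] cM[OF \<tau>(2)] l] \<tau>\<tau> left_mult_one_mat[OF l] by simp
      finally show ?thesis .
    qed
    then have PQ: "P * Q = ?F x"
      unfolding P_def Q_def x(1) prod.case
      using kronecker_mult[OF intertwiner_carrier[OF rs[OF x(2)]] intertwiner_carrier[OF rb[OF x(4)]]
          intertwiner_carrier[OF cs[OF x(3)]] intertwiner_carrier[OF cb[OF x(5)]]] by simp
    have cP: "P \<in> carrier_mat (?n * ?m) (?d * ?d)" and cQ: "Q \<in> carrier_mat (?d * ?d) (?n * ?m)"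
      using P Q by (auto simp: intertwiner_def)
    have "B * ?F x * C = (B * P) * (Q * C)"
      unfolding PQ[symmetric] using cB cC cP cQ
      by (simp add: assoc_mult_mat[of _ ?d "?n * ?m" _ "?d * ?d" _ "?n * ?m"] assoc_mult_mat[of _ ?d "?d * ?d" _ "?n * ?m" _ ?d]
          assoc_mult_mat[of _ "?n * ?m" "?d * ?d" _ "?n * ?m" _ ?d] assoc_mult_mat[of _ ?d "?n * ?m" _ "?n * ?m" _ ?d]
          assoc_mult_mat[of _ ?d "?n * ?m" _ "?d * ?d" _ ?d])
    moreover have "intertwiner ?Y (outer_tensor [i, j] [X, U]) M (B * P)"
      by (rule intertwiner_compose[OF P B cXU oO cMY])
    moreover have "intertwiner ?Y M (outer_tensor [i, j] [X, U]) (Q * C)"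
      by (rule intertwiner_compose[OF C Q cMY oO cXU])
    ultimately show ?thesis using X unfolding factors_through_def by blast
  qed
  \<comment> \<open>Summation enlarges the first factor by direct sums; the second remains
    \<open>U\<close>.\<close>
  have "factors_through i j M U (1\<^sub>m ?d)"
    unfolding one by (rule factors_through_lincomb[OF i repU cMY]) (use term_factors in auto)
  then show ?thesis using UA unfolding factors_through_def retract_of_def by metis
qed

end

text \<open>Unentangledness for the composition \<open>[i, j]\<close> gives a splitting
  \<open>\<alpha> \<beta> = 1\<close> through some \<open>V\<close> and \<open>W\<close> of the
  system. If the trace of \<open>\<theta>\<close> is 1, then
  \<open>\<theta> = \<alpha> (\<beta> \<theta>)\<close> factors through the same tensor product, and
  the criterion for a prescribed \<open>N\<close> applies.\<close>

lemma (in unentangled_closed_inductive_system) relatively_projective_imp_summand: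
  assumes i: "0 < i" and j: "0 < j" and M: "M \<in> A (i + j)"
    and rp: "relatively_projective (sym_group (i + j)) (young_subgroup [i, j]) M"
  shows "\<exists>V\<in>A i. \<exists>W\<in>A j. direct_summand (sym_group (i + j)) M
    (induced_rep (sym_group (i + j)) (young_subgroup [i, j]) (outer_tensor [i, j] [V, W]))"
proof -
  let ?Y = "young_subgroup [i, j]" and ?G = "sym_group (i + j)"
  have repM: "representation ?G M" using objects M i by auto
  have Y: "subgroup ?Y ?G" using subgroup_young[of "[i, j]"] by simp
  have "composition (i + j) [i, j]" using i j by (simp add: composition_def)
  moreover have "unentangled_rep (i + j) M" using unentangled M i by simp
  ultimately obtain Ms where Ms: "length Ms = length [i, j]"
    and reps: "\<forall>k<length [i, j]. representation (sym_group ([i, j] ! k)) (Ms ! k)"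
    and ds: "direct_summand (young_group [i, j]) (restrict_rep ?Y M) (outer_tensor [i, j] Ms)"
    unfolding unentangled_rep_def by blast
  obtain V0 W0 where VW: "Ms = [V0, W0]" using Ms by (auto simp: length_Suc_conv)
  have V0: "representation (sym_group i) V0" and W0: "representation (sym_group j) W0"
    using reps[rule_format, of 0] reps[rule_format, of "Suc 0"] VW by auto
  have "representation (young_group [i, j]) (restrict_rep ?Y M)"
    using representation_restrict[OF repM Y] by simp
  then have "retract_of (carrier (young_group [i, j])) (restrict_rep ?Y M) (outer_tensor [i, j] [V0, W0])"
    using ds VW outer_tensor_pair_carrier[OF V0 W0] by (intro direct_summand_imp_retract) auto
  then have "retract_of ?Y M (outer_tensor [i, j] [V0, W0])" by (simp add: retract_restrict_rep)
  then obtain V W where V: "V \<in> A i" and W: "W \<in> A j" and "retract_of ?Y M (outer_tensor [i, j] [V, W])"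
    using outer_tensor_factors_in_system[OF i j M V0 W0] by blast
  then obtain \<alpha> \<beta> where \<alpha>: "intertwiner ?Y (outer_tensor [i, j] [V, W]) M \<alpha>"
    and \<beta>: "intertwiner ?Y M (outer_tensor [i, j] [V, W]) \<beta>" and one: "\<alpha> * \<beta> = 1\<^sub>m (rep_dim M)"
    by (auto simp: retract_of_def)
  obtain \<theta> w where \<theta>: "intertwiner ?Y M M \<theta>" and w: "coset_weight ?G (carrier ?G) ?Y w"
    and tr: "weighted_trace ?G (carrier ?G) M w \<theta> = 1\<^sub>m (rep_dim M)"
    using rp by (auto simp: relatively_projective_def)
  have rO: "representation (?G\<lparr>carrier := ?Y\<rparr>) (outer_tensor [i, j] [V, W])"
    using representation_outer_tensor_pair[OF objects[OF i V] objects[OF j W]] by simp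
  have cM: "rep_mat M \<sigma> \<in> carrier_mat (rep_dim M) (rep_dim M)" if "\<sigma> \<in> ?Y" for \<sigma>
    using representation_carrier[OF repM] subgroup.mem_carrier[OF Y that] .
  have "intertwiner ?Y M (outer_tensor [i, j] [V, W]) (\<beta> * \<theta>)"
    using representation_carrier[OF rO] by (intro intertwiner_compose[OF \<theta> \<beta> cM cM]) auto
  moreover have "\<alpha> * (\<beta> * \<theta>) = \<theta>"
    using assoc_mult_mat[OF intertwiner_carrier[OF \<alpha>] intertwiner_carrier[OF \<beta>] intertwiner_carrier[OF \<theta>]]
      one left_mult_one_mat[OF intertwiner_carrier[OF \<theta>]] by simp
  ultimately have "direct_summand ?G M (induced_rep ?G ?Y (outer_tensor [i, j] [V, W]))"
    using group.direct_summand_induced_iff[OF sym_group_is_group Y finite_sym_group rO repM w] \<alpha> tr by metis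
  then show ?thesis using V W by blast
qed

section \<open>Intransitive subgroups and indices of Young subgroups\<close>

lemma permutes_move_subset:
  assumes "T \<subseteq> {1..n}" "card T = i"
  shows "\<exists>s. s permutes {1..n} \<and> s ` T = {1..i}"
proof -
  have fin: "finite T" using assms(1) finite_subset by blast
  have i: "i \<le> n" using card_mono[OF _ assms(1)] assms(2) by simp
  obtain f where f: "bij_betw f T {1..i}"
    using finite_same_card_bij[OF fin, of "{1..i}"] assms by auto
  have "card ({1..n} - T) = card {i + 1..n}" using assms fin by (simp add: card_Diff_subset)
  then obtain g where g: "bij_betw g ({1..n} - T) {i + 1..n}"
    using finite_same_card_bij[of "{1..n} - T" "{i + 1..n}"] by auto
  define s where "s x = (if x \<in> T then f x else if x \<in> {1..n} then g x else x)" for x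
  have sf: "bij_betw s T {1..i}"
    using f by (rule bij_betw_cong[THEN iffD1, rotated]) (simp add: s_def)
  have "bij_betw s ({1..n} - T) {i + 1..n}"
    using g by (rule bij_betw_cong[THEN iffD1, rotated]) (simp add: s_def)
  then have "bij_betw s (T \<union> ({1..n} - T)) ({1..i} \<union> {i + 1..n})"
    by (intro bij_betw_combine sf) auto
  moreover have "T \<union> ({1..n} - T) = {1..n}" "{1..i} \<union> {i + 1..n} = {1..n}" using assms i by auto
  ultimately have "bij_betw s {1..n} {1..n}" by simp
  moreover have "s x = x" if "x \<notin> {1..n}" for x using that assms(1) by (auto simp: s_def)
  ultimately have "s permutes {1..n}" by (rule bij_imp_permutes)
  then show ?thesis using sf by (auto simp: bij_betw_def)
qed

text \<open>An orbit \<open>T\<close> that misses a point is a nonempty proper stable set. A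
  permutation taking \<open>T\<close> to the initial segment of the same size conjugates
  \<open>H\<close> into the stabilizer of that segment.\<close>

lemma intransitive_conj_subset_young:
  assumes H: "subgroup H (sym_group n)" and "\<not> transitive_on H {1..n}"
  shows "\<exists>i j s. 0 < i \<and> 0 < j \<and> i + j = n \<and> s \<in> carrier (sym_group n) \<and>
    (\<lambda>h. s \<otimes>\<^bsub>sym_group n\<^esub> h \<otimes>\<^bsub>sym_group n\<^esub> inv\<^bsub>sym_group n\<^esub> s) ` H \<subseteq> young_subgroup [i, j]"
proof -
  obtain x y where x: "x \<in> {1..n}" and y: "y \<in> {1..n}" and no: "\<And>\<sigma>. \<sigma> \<in> H \<Longrightarrow> \<sigma> x \<noteq> y"
    using assms(2) by (auto simp: transitive_on_def)
  define T where "T = (\<lambda>\<sigma>. \<sigma> x) ` H"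
  have perm: "\<sigma> permutes {1..n}" if "\<sigma> \<in> H" for \<sigma>
    using subgroup.mem_carrier[OF H that] by (simp add: sym_group_carrier)
  have T: "T \<subseteq> {1..n}" using permutes_in_image[OF perm] x by (auto simp: T_def)
  have "id \<in> H" using subgroup.one_closed[OF H] by (simp add: sym_group_one)
  then have "id x \<in> T" unfolding T_def by (rule imageI)
  then have "x \<in> T" by simp
  have "y \<notin> T" using no by (auto simp: T_def)
  have finT: "finite T" using T finite_subset by blast
  have 1: "0 < card T" using \<open>x \<in> T\<close> finT card_gt_0_iff by blast
  have 2: "card T < n"
  proof -
    have "T \<subset> {1..n}" using T y \<open>y \<notin> T\<close> by blast
    then show ?thesis using psubset_card_mono[of "{1..n}" T] by simp
  qed
  obtain s where s: "s permutes {1..n}" "s ` T = {1..card T}" using permutes_move_subset[OF T refl] by blast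
  have sG: "s \<in> carrier (sym_group n)" using s by (simp add: sym_group_carrier)
  have "s \<circ> h \<circ> inv' s \<in> young_subgroup [card T, n - card T]" if h: "h \<in> H" for h
  proof -
    have "h (\<sigma> x) \<in> T" if "\<sigma> \<in> H" for \<sigma>
    proof -
      have "(\<lambda>\<sigma>. \<sigma> x) (h \<circ> \<sigma>) \<in> T"
        unfolding T_def by (rule imageI) (rule subgroup.m_closed[OF H h that, unfolded sym_group_mult])
      then show ?thesis by simp
    qed
    then have "h ` T \<subseteq> T" by (auto simp: T_def)
    then have hT: "h ` T = T"
      using finT permutes_inj[OF perm[OF h]] by (meson endo_inj_surj inj_on_subset subset_UNIV)
    have "(s \<circ> h \<circ> inv' s) ` {1..card T} = s ` h ` inv' s ` s ` T" by (simp add: s(2) image_comp comp_assoc)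
    also have "inv' s ` s ` T = T" using permutes_inj[OF s(1)] by (simp add: image_comp)
    finally have "(s \<circ> h \<circ> inv' s) ` {1..card T} = {1..card T}" using hT s(2) by simp
    moreover have "(s \<circ> h \<circ> inv' s) permutes {1..n}"
      using s(1) perm[OF h] by (intro permutes_compose permutes_inv)
    ultimately show ?thesis using 2 by (simp add: young_subgroup_pair)
  qed
  then have "(\<lambda>h. s \<otimes>\<^bsub>sym_group n\<^esub> h \<otimes>\<^bsub>sym_group n\<^esub> inv\<^bsub>sym_group n\<^esub> s) ` H \<subseteq> young_subgroup [card T, n - card T]"
    using sG by (auto simp: sym_group_mult)
  then show ?thesis using 1 2 sG by (intro exI[of _ "card T"] exI[of _ "n - card T"] exI[of _ s]) auto
qed

text \<open>\<open>S_i \<times> S_j\<close> is the stabilizer of \<open>{1..i}\<close>, so its left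
  cosets correspond to the images of this set, which are all the subsets of size
  \<open>i\<close>.\<close>

lemma length_young_transversal:
  assumes rs: "left_transversal (sym_group (i + j)) (young_subgroup [i, j]) rs"
  shows "length rs = (i + j) choose i"
proof -
  let ?G = "sym_group (i + j)" and ?Y = "young_subgroup [i, j]"
  interpret group ?G by (rule sym_group_is_group)
  have Y: "subgroup ?Y ?G" using subgroup_young[of "[i, j]"] by simp
  have perm: "rs ! a permutes {1..i + j}" if "a < length rs" for a
    using transversal_carrier[OF Y rs that] by (simp add: sym_group_carrier)
  let ?T = "{T. T \<subseteq> {1..i + j} \<and> card T = i}"
  have "inj_on (\<lambda>a. rs ! a ` {1..i}) {..<length rs}"
  proof (rule inj_onI)
    fix a b assume ab: "a \<in> {..<length rs}" "b \<in> {..<length rs}" and eq: "rs ! a ` {1..i} = rs ! b ` {1..i}"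
    define y where "y = inv' (rs ! a) \<circ> rs ! b"
    note pa = perm[of a] and pb = perm[of b]
    have "y ` {1..i} = inv' (rs ! a) ` rs ! a ` {1..i}" unfolding y_def image_comp[symmetric] eq ..
    also have "\<dots> = {1..i}" using permutes_inj[OF pa] ab by (simp add: image_comp)
    finally have "y \<in> ?Y"
      using ab pa pb unfolding young_subgroup_pair by (auto simp: y_def intro!: permutes_compose permutes_inv)
    moreover have "rs ! a \<otimes>\<^bsub>?G\<^esub> y = rs ! b \<otimes>\<^bsub>?G\<^esub> \<one>\<^bsub>?G\<^esub>"
      using permutes_inv_o(1)[OF pa] ab by (simp add: sym_group_mult sym_group_one y_def o_assoc)
    ultimately show "a = b"
      using transversal_unique[OF Y rs _ _ _ subgroup.one_closed[OF Y]] ab by blast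
  qed
  moreover have "rs ! a ` {1..i} \<in> ?T" if a: "a < length rs" for a
  proof -
    have "rs ! a ` {1..i} \<subseteq> rs ! a ` {1..i + j}" by (intro image_mono) auto
    also have "\<dots> = {1..i + j}" by (rule permutes_image[OF perm[OF a]])
    finally have "rs ! a ` {1..i} \<subseteq> {1..i + j}" .
    moreover have "card (rs ! a ` {1..i}) = i"
      using card_image[OF permutes_inj_on[OF perm[OF a]], of "{1..i}"] by simp
    ultimately show ?thesis by simp
  qed
  moreover have "\<exists>a<length rs. T = rs ! a ` {1..i}" if "T \<in> ?T" for T
  proof -
    obtain s where s: "s permutes {1..i + j}" "s ` T = {1..i}" using permutes_move_subset \<open>T \<in> ?T\<close> by blast
    have "inv' s ` s ` T = T" using permutes_inj[OF s(1)] by (simp add: image_comp)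
    then have T: "inv' s ` {1..i} = T" using s(2) by simp
    have "inv' s \<in> carrier ?G" using s(1) by (simp add: sym_group_carrier permutes_inv)
    then obtain a x where a: "a < length rs" "x \<in> ?Y" "inv' s = rs ! a \<otimes>\<^bsub>?G\<^esub> x"
      using transversal_index[OF Y rs] by blast
    have "T = rs ! a ` x ` {1..i}" using a(3) T by (simp add: sym_group_mult image_comp)
    also have "x ` {1..i} = {1..i}" using a(2) by (simp add: young_subgroup_pair)
    finally show ?thesis using a(1) by blast
  qed
  ultimately have "bij_betw (\<lambda>a. rs ! a ` {1..i}) {..<length rs} ?T"
    unfolding bij_betw_def by blast
  then have "length rs = card {T. T \<subseteq> {1..i + j} \<and> card T = i}"
    using bij_betw_same_card by fastforce
  then show ?thesis by (simp add: n_subsets)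
qed

text \<open>Scalars are fixed by conjugation, so the trace multiplies them by the index; start from
  the inverse of the index.\<close>

lemma (in group) relatively_projective_of_index:
  fixes M :: "('a, 'k::field) rep"
  assumes fin: "finite (carrier G)" and H: "subgroup H G" and M: "representation G M"
    and rs: "left_transversal G H rs" and ne: "of_nat (length rs) \<noteq> (0::'k)"
  shows "relatively_projective G H M"
proof -
  let ?d = "rep_dim M" and ?c = "inverse (of_nat (length rs)) :: 'k"
  have cM: "rep_mat M g \<in> carrier_mat ?d ?d" if "g \<in> carrier G" for g using representation_carrier[OF M that] .
  have cMH: "rep_mat M h \<in> carrier_mat ?d ?d" if "h \<in> H" for h using cM subgroup.mem_carrier[OF H that] .
  have \<theta>: "intertwiner H M M (?c \<cdot>\<^sub>m 1\<^sub>m ?d)"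
    by (rule intertwiner_smult[OF intertwiner_one[OF cMH] cMH cMH])
  have G: "intertwiner (carrier G) M M (?c \<cdot>\<^sub>m 1\<^sub>m ?d)"
    by (rule intertwiner_smult[OF intertwiner_one[OF cM] cM cM])
  have conj: "conj_mat G M (?c \<cdot>\<^sub>m 1\<^sub>m ?d) g = ?c \<cdot>\<^sub>m 1\<^sub>m ?d" if "g \<in> carrier G" for g
    using G intertwiner_iff_conj_mat_fixed[OF M, of "carrier G"] that by blast
  have "weighted_trace G (carrier G) M (transversal_weight rs) (?c \<cdot>\<^sub>m 1\<^sub>m ?d)
      = lincomb_mat ?d ?d {..<length rs} (\<lambda>_. 1) (\<lambda>a. ?c \<cdot>\<^sub>m 1\<^sub>m ?d)"
    unfolding weighted_trace_transversal[OF H rs fin]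
    using conj transversal_carrier[OF H rs] by (intro lincomb_mat_cong) auto
  also have "\<dots> = 1\<^sub>m ?d" by (rule eq_matI) (use ne in auto)
  finally show ?thesis
    using \<theta> coset_weight_transversal[OF H rs fin] unfolding relatively_projective_def by blast
qed

lemma (in group) relatively_projective_self:
  fixes M :: "('a, 'k::field) rep"
  assumes fin: "finite (carrier G)" and M: "representation G M"
  shows "relatively_projective G (carrier G) M"
proof (rule relatively_projective_of_index[OF fin subgroup_self M])
  show "left_transversal G (carrier G) [\<one>]"
    by (auto simp: left_transversal_def l_coset_def)
qed simp

text \<open>
  For \<open>n\<close> not a power of \<open>p\<close> and \<open>p\<^sup>v\<close> the exact power of \<open>p\<close> dividing \<open>n\<close>, the index
  of \<open>S\<^sub>i \<times> S\<^sub>j\<close> with \<open>i = p\<^sup>v\<close> is prime to \<open>p\<close>.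
\<close>

lemma relatively_projective_not_prime_power:
  fixes M :: "(nat \<Rightarrow> nat, 'k::field) rep"
  assumes p: "prime p" "CHAR('k) = p" and n: "0 < n" and M: "representation (sym_group n) M"
    and np: "\<nexists>m. n = p ^ m"
  shows "\<exists>i j. 0 < i \<and> 0 < j \<and> i + j = n \<and> relatively_projective (sym_group n) (young_subgroup [i, j]) M"
proof -
  obtain v m where m: "n = p ^ v * m" "\<not> p dvd m"
    using multiplicity_decompose'[of n p] n p(1) by (metis not_prime_unit neq0_conv)
  define i j where "i = p ^ v" and "j = n - i"
  have "m \<noteq> 0" using m(1) n by auto
  \<comment> \<open>The value \<open>m = 1\<close> is the excluded power of \<open>p\<close>; for
    \<open>m > 1\<close> both \<open>i\<close> and \<open>j\<close> are positive.\<close>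
  moreover have "m \<noteq> 1" using m(1) np by auto
  ultimately have "1 < m" by simp
  have i: "0 < i" using p(1) by (simp add: i_def prime_gt_0_nat)
  have "i < i * m" using i \<open>1 < m\<close> by simp
  then have "i < n" by (simp add: m(1) i_def)
  then have j: "0 < j" "i + j = n" by (auto simp: j_def)
  \<comment> \<open>The count from Wielandt's proof of Sylow's theorem: choosing
    \<open>p ^ v\<close> out of \<open>p ^ v * m\<close> contributes no power of \<open>p\<close>
    beyond those in \<open>m\<close>.\<close>
  have "multiplicity p (n choose i) = multiplicity p m"
    using const_p_fac[of m p v] \<open>m \<noteq> 0\<close> p(1) by (simp add: m(1) i_def)
  then have "multiplicity p (n choose i) = 0" using m(2) by (simp add: not_dvd_imp_multiplicity_0)
  moreover have "n choose i \<noteq> 0" using \<open>i < n\<close> by simp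
  ultimately have "\<not> p dvd (n choose i)"
    using p(1) multiplicity_eq_zero_iff[of "n choose i" p] not_prime_unit by blast
  then have ne: "of_nat (n choose i) \<noteq> (0::'k)" using p(2) by (simp add: of_nat_eq_0_iff_char_dvd)
  have Y: "subgroup (young_subgroup [i, j]) (sym_group n)" using subgroup_young[of "[i, j]"] j by simp
  obtain rs where rs: "left_transversal (sym_group n) (young_subgroup [i, j]) rs"
    using group.left_transversal_exists[OF sym_group_is_group Y finite_sym_group] by blast
  then have "length rs = n choose i" using length_young_transversal[of i j rs] j by simp
  then have "relatively_projective (sym_group n) (young_subgroup [i, j]) M"
    using group.relatively_projective_of_index[OF sym_group_is_group finite_sym_group Y M rs] ne by simp
  then show ?thesis using i j by blast
qed

lemma young_subgroup_pair_proper: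
  assumes "0 < i" "0 < j"
  shows "young_subgroup [i, j] \<noteq> carrier (sym_group (i + j))"
proof -
  \<comment> \<open>Interchanges the first and the last letter, which lie in different
    blocks.\<close>
  have "transpose 1 (i + j) permutes {1..i + j}" using assms by (intro permutes_swap_id) auto
  moreover have "transpose 1 (i + j) \<notin> young_subgroup [i, j]"
  proof
    assume "transpose 1 (i + j) \<in> young_subgroup [i, j]"
    then have "transpose 1 (i + j) ` {1..i} = {1..i}" by (simp add: young_subgroup_pair)
    moreover have "transpose 1 (i + j) 1 \<in> transpose 1 (i + j) ` {1..i}"
      using assms by (intro imageI) simp
    ultimately have "transpose 1 (i + j) 1 \<in> {1..i}" by simp
    then show False using assms by simp
  qed
  ultimately show ?thesis unfolding set_eq_iff sym_group_carrier by blast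
qed

text \<open>A composition with at most one part gives the whole group. With two parts or more, the
  first block is stable and contains 1 but not \<open>n\<close>, so 1 cannot be moved to
  \<open>n\<close>.\<close>

lemma proper_young_subgroup_not_transitive:
  assumes \<mu>: "composition n \<mu>" and proper: "young_subgroup \<mu> \<noteq> carrier (sym_group n)" and H: "H \<subseteq> young_subgroup \<mu>"
  shows "\<not> transitive_on H {1..n}"
proof
  assume t: "transitive_on H {1..n}"
  have sum: "sum_list \<mu> = n" using \<mu> by (simp add: composition_def)
  show False
  proof (cases \<mu>)
    case Nil
    then have "young_subgroup \<mu> = carrier (sym_group n)"
      using sum by (auto simp: young_subgroup_def sym_group_carrier)
    then show False using proper by simp
  next
    case (Cons l \<nu>)
    have l: "0 < l" using \<mu> Cons by (simp add: composition_def)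
    have b0: "block \<mu> 0 = {1..l}" by (simp add: block_def offset_def Cons)
    show False
    proof (cases \<nu>)
      case Nil
      then have "\<mu> = [n]" using sum Cons by simp
      then have "young_subgroup \<mu> = {\<sigma>. \<sigma> permutes {1..n} \<and> \<sigma> ` {1..n} = {1..n}}"
        by (simp add: young_subgroup_def block_def offset_def)
      also have "\<dots> = carrier (sym_group n)"
        unfolding set_eq_iff mem_Collect_eq sym_group_carrier using permutes_image by blast
      finally have "young_subgroup \<mu> = carrier (sym_group n)" .
      then show False using proper by simp
    next
      case (Cons l' \<nu>')
      then have "0 < l'" "l + l' \<le> n" using \<mu> sum \<open>\<mu> = l # \<nu>\<close> by (auto simp: composition_def)
      then have "1 \<in> {1..n}" "n \<in> {1..n}" "l < n" by auto
      then obtain \<sigma> where s: "\<sigma> \<in> H" "\<sigma> 1 = n" using t unfolding transitive_on_def by blast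
      then have "\<sigma> ` block \<mu> 0 = block \<mu> 0" using H \<open>\<mu> = l # \<nu>\<close> by (auto simp: young_subgroup_def)
      moreover have "1 \<in> block \<mu> 0" using l b0 by simp
      ultimately have "n \<in> block \<mu> 0" using s(2) by blast
      then show False using b0 \<open>l < n\<close> by simp
    qed
  qed
qed

section \<open>Conjugate subgroups and existence of vertices\<close>

lemma (in group) subgroup_conjugate:
  assumes H: "subgroup H G" and s: "s \<in> carrier G"
  shows "subgroup ((\<lambda>h. s \<otimes> h \<otimes> inv s) ` H) G"
proof (rule subgroupI)
  note mem = subgroup.mem_carrier[OF H]
  show "(\<lambda>h. s \<otimes> h \<otimes> inv s) ` H \<subseteq> carrier G" using s mem by auto
  show "(\<lambda>h. s \<otimes> h \<otimes> inv s) ` H \<noteq> {}" using subgroup.one_closed[OF H] by blast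
  fix x assume "x \<in> (\<lambda>h. s \<otimes> h \<otimes> inv s) ` H"
  then obtain h where h: "h \<in> H" "x = s \<otimes> h \<otimes> inv s" by blast
  have "inv x = s \<otimes> inv h \<otimes> inv s" using h s mem by (simp add: inv_mult_group m_assoc)
  then show "inv x \<in> (\<lambda>h. s \<otimes> h \<otimes> inv s) ` H" using h(1) subgroup.m_inv_closed[OF H] by blast
  fix y assume "y \<in> (\<lambda>h. s \<otimes> h \<otimes> inv s) ` H"
  then obtain k where k: "k \<in> H" "y = s \<otimes> k \<otimes> inv s" by blast
  have "x \<otimes> y = s \<otimes> (h \<otimes> (inv s \<otimes> s) \<otimes> k) \<otimes> inv s"
    unfolding h(2) k(2) using s mem[OF h(1)] mem[OF k(1)] by (simp only: m_assoc m_closed inv_closed)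
  also have "\<dots> = s \<otimes> (h \<otimes> k) \<otimes> inv s" using s mem[OF h(1)] by simp
  finally show "x \<otimes> y \<in> (\<lambda>h. s \<otimes> h \<otimes> inv s) ` H" using subgroup.m_closed[OF H h(1) k(1)] by blast
qed

text \<open>Descent on the order of \<open>K\<close>. Beyond existence, this puts a vertex inside
  any given subgroup relative to which \<open>M\<close> is projective.\<close>

lemma (in group) vertex_below:
  assumes fin: "finite (carrier G)" and "subgroup K G" "summand_of_induced G K M"
  shows "\<exists>H. H \<subseteq> K \<and> is_vertex G H M"
  using assms(2,3)
proof (induction "card K" arbitrary: K rule: less_induct)
  case less
  show ?case
  proof (cases "is_vertex G K M")
    case False
    then obtain L where L: "subgroup L G" "L \<subset> K" "summand_of_induced G L M"
      using less.prems by (auto simp: is_vertex_def)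
    have "finite K" using finite_subset[OF subgroup.subset[OF less.prems(1)] fin] .
    then have "card L < card K" using L(2) by (rule psubset_card_mono)
    then show ?thesis using less.hyps[OF _ L(1,3)] L(2) by blast
  qed auto
qed

section \<open>Equivalence of the three conditions and the prime power condition\<close>

theorem proposition3p2:
  fixes A :: "nat \<Rightarrow> (nat \<Rightarrow> nat, 'k::field) rep set"
    and M :: "(nat \<Rightarrow> nat, 'k) rep"
    and n p :: nat
  assumes "CHAR('k) = p" and "p > 0"
    and "unentangled_closed_inductive_system A"
    and "n > 0"
    and "M \<in> A n"
    and "indecomposable (sym_group n) M"
  shows "let
      C1 = (\<forall>i j V W. i > 0 \<longrightarrow> j > 0 \<longrightarrow> i + j = n \<longrightarrow> V \<in> A i \<longrightarrow> W \<in> A j \<longrightarrow>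
              \<not> direct_summand (sym_group n) M
                  (induced_rep (sym_group n) (young_subgroup [i, j]) (outer_tensor [i, j] [V, W])));
      C2 = (\<forall>\<mu>. composition n \<mu> \<longrightarrow> young_subgroup \<mu> \<noteq> carrier (sym_group n) \<longrightarrow>
              \<not> summand_of_induced (sym_group n) (young_subgroup \<mu>) M);
      C3 = ((\<exists>H. is_vertex (sym_group n) H M) \<and>
            (\<forall>H. is_vertex (sym_group n) H M \<longrightarrow> transitive_on H {1..n}))
    in (C1 \<longleftrightarrow> C2) \<and> (C2 \<longleftrightarrow> C3) \<and> (C1 \<longrightarrow> (\<exists>m. n = p ^ m))"
proof -
  interpret unentangled_closed_inductive_system A by fact
  interpret group "sym_group n" by (rule sym_group_is_group)
  note fin = finite_sym_group[of n]
  have repM: "representation (sym_group n) M" using objects assms by auto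
  have p: "prime p" using prime_CHAR_semidom[where 'a = 'k] assms by simp
  define C1 where "C1 \<longleftrightarrow> (\<forall>i j V W. i > 0 \<longrightarrow> j > 0 \<longrightarrow> i + j = n \<longrightarrow> V \<in> A i \<longrightarrow> W \<in> A j \<longrightarrow>
      \<not> direct_summand (sym_group n) M
        (induced_rep (sym_group n) (young_subgroup [i, j]) (outer_tensor [i, j] [V, W])))"
  define C2 where "C2 \<longleftrightarrow> (\<forall>\<mu>. composition n \<mu> \<longrightarrow> young_subgroup \<mu> \<noteq> carrier (sym_group n) \<longrightarrow>
      \<not> summand_of_induced (sym_group n) (young_subgroup \<mu>) M)"
  define C3 where "C3 \<longleftrightarrow> (\<exists>H. is_vertex (sym_group n) H M) \<and>
      (\<forall>H. is_vertex (sym_group n) H M \<longrightarrow> transitive_on H {1..n})"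
  let ?rp = "\<lambda>i j. relatively_projective (sym_group n) (young_subgroup [i, j]) M"
  \<comment> \<open>The common hub: each of the three conditions is compared with the negation of
    \<open>Split\<close>.\<close>
  define Split where "Split \<longleftrightarrow> (\<exists>i j. 0 < i \<and> 0 < j \<and> i + j = n \<and> ?rp i j)"
  have young: "subgroup (young_subgroup \<mu>) (sym_group n)" if "composition n \<mu>" for \<mu>
    using subgroup_young[of \<mu>] that by (simp add: composition_def)
  have pair: "composition n [i, j]" if "0 < i" "0 < j" "i + j = n" for i j
    using that by (simp add: composition_def)
  note iff = summand_of_induced_iff[OF _ fin repM]
  \<comment> \<open>Conjugate \<open>H\<close> into some \<open>S_i \<times> S_j\<close>, then
    enlarge; both operations preserve relative projectivity.\<close>
  have intransitive: Split if H: "subgroup H (sym_group n)" "\<not> transitive_on H {1..n}"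
    "summand_of_induced (sym_group n) H M" for H
  proof -
    let ?conj = "\<lambda>s. (\<lambda>h. s \<otimes>\<^bsub>sym_group n\<^esub> h \<otimes>\<^bsub>sym_group n\<^esub> inv\<^bsub>sym_group n\<^esub> s) ` H"
    obtain i j s where ij: "0 < i" "0 < j" "i + j = n" and s: "s \<in> carrier (sym_group n)"
      and sub: "?conj s \<subseteq> young_subgroup [i, j]"
      using intransitive_conj_subset_young[OF H(1,2)] by blast
    have "subgroup (?conj s) (sym_group n)"
      by (rule subgroup_conjugate[OF H(1) s])
    moreover have "relatively_projective (sym_group n) (?conj s) M"
      using relatively_projective_conj[OF repM H(1) s] iff[OF H(1)] H(3) by blast
    ultimately have "relatively_projective (sym_group n) (young_subgroup [i, j]) M"
      using relatively_projective_mono[OF repM fin _ young[OF pair[OF ij]] sub] by blast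
    then show Split unfolding Split_def using ij by blast
  qed
  have 1: "C1 \<longleftrightarrow> \<not> Split"
  proof
    assume C1
    show "\<not> Split"
    proof
      assume Split
      then obtain i j where ij: "0 < i" "0 < j" "i + j = n" and rp: "?rp i j" by (auto simp: Split_def)
      \<comment> \<open>Here unentangledness enters: it provides \<open>V\<close> and
        \<open>W\<close> inside the system.\<close>
      then show False
        using relatively_projective_imp_summand[OF ij(1,2), of M] assms(5) \<open>C1\<close> unfolding C1_def by blast
    qed
  next
    assume no: "\<not> Split"
    show C1
      unfolding C1_def
    proof (intro allI impI notI)
      fix i j V W
      assume ij: "0 < i" "0 < j" "i + j = n" and V: "V \<in> A i" and W: "W \<in> A j"
        and ds: "direct_summand (sym_group n) M (induced_rep (sym_group n) (young_subgroup [i, j]) (outer_tensor [i, j] [V, W]))"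
      have "representation ((sym_group n)\<lparr>carrier := young_subgroup [i, j]\<rparr>) (outer_tensor [i, j] [V, W])"
        using representation_outer_tensor_pair[OF objects[OF ij(1) V] objects[OF ij(2) W]] ij(3) by simp
      then have "summand_of_induced (sym_group n) (young_subgroup [i, j]) M"
        using ds by (auto simp: summand_of_induced_def)
      then show False using no ij iff[OF young[OF pair[OF ij]]] unfolding Split_def by blast
    qed
  qed
  have 2: "C2 \<longleftrightarrow> \<not> Split"
  proof
    assume C2
    show "\<not> Split"
    proof
      assume Split
      then obtain i j where ij: "0 < i" "0 < j" "i + j = n" and rp: "?rp i j" by (auto simp: Split_def)
      have "young_subgroup [i, j] \<noteq> carrier (sym_group n)"
        using young_subgroup_pair_proper[OF ij(1,2)] ij(3) by simp
      then show False
        using \<open>C2\<close> pair[OF ij] iff[OF young[OF pair[OF ij]]] rp unfolding C2_def by blast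
    qed
  next
    assume "\<not> Split"
    \<comment> \<open>A proper Young subgroup is itself intransitive, so \<open>intransitive\<close>
      applies to it.\<close>
    then show C2
      unfolding C2_def
      using intransitive[OF young] proper_young_subgroup_not_transitive[OF _ _ subset_refl] by blast
  qed
  have 3: "C3 \<longleftrightarrow> \<not> Split"
  proof
    assume C3
    show "\<not> Split"
    proof
      assume Split
      then obtain i j where ij: "0 < i" "0 < j" "i + j = n" and rp: "?rp i j" by (auto simp: Split_def)
      note Y = young[OF pair[OF ij]]
      \<comment> \<open>A vertex inside \<open>S_i \<times> S_j\<close> is intransitive, while
        \<open>C3\<close> speaks of every vertex.\<close>
      obtain H where "H \<subseteq> young_subgroup [i, j]" "is_vertex (sym_group n) H M"
        using vertex_below[OF fin Y] iff[OF Y] rp by blast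
      moreover have "young_subgroup [i, j] \<noteq> carrier (sym_group n)"
        using young_subgroup_pair_proper[OF ij(1,2)] ij(3) by simp
      ultimately show False
        using \<open>C3\<close> proper_young_subgroup_not_transitive[OF pair[OF ij]] unfolding C3_def by blast
    qed
  next
    assume no: "\<not> Split"
    \<comment> \<open>Descending from the whole group gives the existence half of \<open>C3\<close>;
      an intransitive vertex would yield \<open>Split\<close>.\<close>
    have "relatively_projective (sym_group n) (carrier (sym_group n)) M"
      by (rule relatively_projective_self[OF fin repM])
    then have "\<exists>H. is_vertex (sym_group n) H M"
      using vertex_below[OF fin subgroup_self] iff[OF subgroup_self] by blast
    then show C3
      unfolding C3_def using intransitive no by (auto simp: is_vertex_def)
  qed
  have "\<exists>m. n = p ^ m" if C1
    using relatively_projective_not_prime_power[OF p assms(1,4) repM] that 1 unfolding Split_def by blast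
  then show ?thesis
    unfolding Let_def C1_def[symmetric] C2_def[symmetric] C3_def[symmetric] using 1 2 3 by blast
qed

end
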